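(* Let $T:\mathcal J(T)\to\mathcal J(T)$ be a random critically finite map. If $b_T<+\infty$, then there exists a number $b_T^+>b_T$ such that $[0,b_T^+)\subset AA(T)$.
   Context: Random critically finite maps. Let $I=[0,1]$ and let $\mathcal G$ be a finite collection of closed subintervals of $I$ with pairwise disjoint interiors such that $0$ and $1$ belong to two different elements of $\mathcal G$, denoted $\Delta_0\ni 0$ and $\Delta_1\ni 1$. Put $I_*=\bigcup_{\Delta\in\mathcal G}\Delta$. Let $\mathcal G=\mathcal G_C\cup\mathcal G_E$ be a disjoint union, let $\kappa>1$, $A>1$, and let $\gamma:\mathcal G_C\to\{1,2,\dots\}$, $\Delta\mapsto\gamma_\Delta$. $\mathcal M(\mathcal G;\kappa,A,\gamma)$ is the set of continuous maps $f:I_*\to I$ such that (derivatives at endpoints of the intervals of $\mathcal G$ being one-sided, within the interval considered): (M1) for every $\Delta\in\mathcal G$, $f|_\Delta$ is $C^3$, injective, $f(\Delta)=I$, and the Schwarzian derivative $S(f|_\Delta)=\frac{f'''}{f'}-\frac32\left(\frac{f''}{f'}\right)^2$ is negative; (M2) $|f'(x)|\ge\kappa$ for all $x\in\Delta$, $\Delta\in\mathcal G_E$; (M3) for every $\Delta\in\mathcal G_C$ there is a unique $c_\Delta\in\Delta$, in fact $c_\Delta\in\partial\Delta$, with $f'(c_\Delta)=0$; (M4) $f(c_\Delta)\in\{0,1\}$ for all $\Delta\in\mathcal G_C$, and $f(1)=0$; (M5) $f(0)=0$, $f'(0)\ge\kappa$, $f'(1)\le-\kappa$, $\|f'\|_\infty\le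 A$, and there is $s\in(0,1)$ such that $(f|_{\Delta_0})^{-1}(\max\{|\Delta_0|,|\Delta_1|\})\le s$ and $|f'(x)|\ge\kappa$ for all $x\in[0,s]\cup[1-s,1]$; (M6) for every $\Delta\in\mathcal G_C$ there is a $C^3$ function $A_\Delta:\Delta\to[1/A,A]\cup[-A,-1/A]$ with $|A_\Delta'(x)|\in[1/A,A]$ and $f(x)=f(c_\Delta)+A_\Delta(x)(x-c_\Delta)^{1+\gamma_\Delta}$ for all $x\in\Delta$. The points $c_\Delta$ and values $f(c_\Delta)$ do not depend on $f$ in the class. It is assumed that (M7) there is $\Delta\in\mathcal G_C$ with $f(c_\Delta)=0$. Let $(\Omega,\mathcal F,m)$ be a complete probability space, $\theta:\Omega\to\Omega$ an invertible (bimeasurable) $m$-preserving ergodic map, and $\Omega\ni\omega\mapsto T_\omega\in\mathcal M(\mathcal G;\kappa,A,\gamma)$ measurable, i.e. $\omega\mapsto T_\omega(x)$ is measurable for every $x\in I_*$. Put $T_{\omega,\Delta}^{-1}=(T_\omega|_\Delta)^{-1}:I\to\Delta$ and $T_\omega^n=T_{\theta^{n-1}(\omega)}\circ\cdots\circ T_\omega$ where defined. Let $\mathcal J_\omega(T)=\{x\in I:T^n_\omega(x)\in I_*\ \forall n\ge0\}$, so $T_\omega(\mathcal J_\omega(T))=\mathcal J_{\theta(\omega)}(T)$, $\mathcal J(T)=\bigcup_{\omega}\{\omega\}\times\mathcal J_\omega(T)$, and $T:\mathcal J(T)\to\mathcal J(T)$, $T(\omega,x)=(\theta(\omega),T_\omega(x))$.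 This $T$ is called a random critically finite map. Truncated systems, pressure, $AA(T)$ and $b_T$. For $k\ge1$ let $T_{\omega,0}^{-k}=T_{\omega,\Delta_0}^{-1}\circ T_{\theta(\omega),\Delta_0}^{-1}\circ\cdots\circ T_{\theta^{k-1}(\omega),\Delta_0}^{-1}$, $U_\omega(k)=[T_{\omega,0}^{-k}(1),1]$, and $\mathcal J^{(k)}_\omega(T)=\bigcap_{n\ge0}T_\omega^{-n}(I_*\cap U_{\theta^n(\omega)}(k))$, a nonempty closed set with $T_\omega(\mathcal J^{(k)}_\omega(T))\subset\mathcal J^{(k)}_{\theta(\omega)}(T)$. For $t\ge0$ let $\mathcal L_{t,k,\omega}g(x)=\sum_{y\in\mathcal J^{(k)}_\omega(T),\,T_\omega(y)=x}g(y)|T_\omega'(y)|^{-t}$, an operator $C(\mathcal J^{(k)}_\omega(T))\to C(\mathcal J^{(k)}_{\theta(\omega)}(T))$. There exist a random probability measure $\nu_{t,k}$ (a probability measure on $\Omega\times I$ with marginal $m$ on $\Omega$ and disintegration $(\nu_{t,k,\omega})_\omega$) supported on $\bigcup_\omega\{\omega\}\times\mathcal J_\omega^{(k)}(T)$ and a measurable $\lambda_{t,k}:\Omega\to(0,\infty)$ with $\mathcal L_{t,k,\omega}^*\nu_{t,k,\theta(\omega)}=\lambda_{t,k,\omega}\nu_{t,k,\omega}$ for $m$-a.e. $\omega$. Put $\mathcal E\mathrm P_k(t)=\int_\Omega\log\lambda_{t,k,\omega}\,dm(\omega)$ (independent of the choice of $\nu_{t,k}$) and $\mathcal E\mathrm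 P_\infty(t)=\lim_{k\to\infty}\mathcal E\mathrm P_k(t)$ (the limit exists, the sequence being nondecreasing). Let $\chi_0=\int_\Omega\log|T'_\omega(0)|\,dm(\omega)$ and $\gamma_+=\max\{\gamma_\Delta:\Delta\in\mathcal G_C\}$. Then $AA(T)=\{t\ge0:\mathcal E\mathrm P_\infty(t)>-\frac{1}{1+\gamma_+}\chi_0t\}$. The set $D_T=\{t\ge0:\mathcal E\mathrm P_\infty(t)\ge0\}$ is an interval of the form $[0,b_T)$ or $[0,b_T]$; this defines $b_T\in[0,\infty]$. *)

theory Defs
  imports "HOL-Probability.Probability"
begin

text \<open>On a nondegenerate closed interval \<open>D\<close> this is the ordinary derivative at interior
  points and the one-sided derivative at the endpoints.\<close>

definition deriv_within :: "real set \<Rightarrow> (real \<Rightarrow> real) \<Rightarrow> real \<Rightarrow> real" where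
  "deriv_within D f x = vector_derivative f (at x within D)"

lemma deriv_within_eqI:
  assumes "a < b" "x \<in> {a..b}" "(f has_real_derivative f') (at x within {a..b})"
  shows "deriv_within {a..b} f x = f'"
  unfolding deriv_within_def
  using assms vector_derivative_within_cbox[of a b x f f']
  by (simp add: has_real_derivative_iff_has_vector_derivative)

definition Cn_on :: "nat \<Rightarrow> real set \<Rightarrow> (real \<Rightarrow> real) \<Rightarrow> bool" where
  "Cn_on n D f \<longleftrightarrow>
     (\<forall>j<n. \<forall>x\<in>D. ((deriv_within D ^^ j) f) differentiable (at x within D)) \<and>
     continuous_on D ((deriv_within D ^^ n) f)"

definition schwarzian :: "real set \<Rightarrow> (real \<Rightarrow> real) \<Rightarrow> real \<Rightarrow> real" where
  "schwarzian D f x =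
     (deriv_within D ^^ 3) f x / deriv_within D f x
     - 3/2 * ((deriv_within D ^^ 2) f x / deriv_within D f x)\<^sup>2"

definition interval_system :: "real set set \<Rightarrow> bool" where
  "interval_system G \<longleftrightarrow>
     finite G \<and>
     (\<forall>D\<in>G. \<exists>a b. 0 \<le> a \<and> a < b \<and> b \<le> 1 \<and> D = {a..b}) \<and>
     (\<forall>D\<in>G. \<forall>E\<in>G. D \<noteq> E \<longrightarrow> interior D \<inter> interior E = {}) \<and>
     (\<exists>D\<in>G. \<exists>E\<in>G. 0 \<in> D \<and> 1 \<in> E \<and> D \<noteq> E)"

text \<open>In an interval system each of \<open>0\<close> and \<open>1\<close> lies in exactly one element.\<close>

definition Delta0 :: "real set set \<Rightarrow> real set" where
  "Delta0 G = (THE D. D \<in> G \<and> 0 \<in> D)"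

definition Delta1 :: "real set set \<Rightarrow> real set" where
  "Delta1 G = (THE D. D \<in> G \<and> 1 \<in> D)"

text \<open>The critical points \<open>c D\<close> and critical values \<open>v D\<close> (for \<open>D \<in> GC\<close>) are common to all
  maps of the class, hence they are parameters of it.  Maps are total functions of which
  only the restriction to \<open>\<Union>G\<close> matters.  The Schwarzian derivative is undefined at
  critical points, so its sign is prescribed where the first derivative is nonzero.  The
  expansion bound on \<open>{0..s} \<union> {1 - s..1}\<close> concerns the part of that set inside \<open>\<Union>G\<close>,
  where the map is defined.\<close>

definition critically_finite_maps ::
  "real set set \<Rightarrow> real set set \<Rightarrow> real set set \<Rightarrow> real \<Rightarrow> real \<Rightarrow> (real set \<Rightarrow> nat) \<Rightarrow>
   (real set \<Rightarrow> real) \<Rightarrow> (real set \<Rightarrow> real) \<Rightarrow> (real \<Rightarrow> real) set" where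
  "critically_finite_maps G GC GE \<kappa> A \<gamma> c v = {f.
     continuous_on (\<Union>G) f \<and> f ` (\<Union>G) \<subseteq> {0..1} \<and>
     (\<forall>D\<in>G. Cn_on 3 D f \<and> inj_on f D \<and> f ` D = {0..1} \<and>
        (\<forall>x\<in>D. deriv_within D f x \<noteq> 0 \<longrightarrow> schwarzian D f x < 0)) \<and>
     (\<forall>D\<in>GE. \<forall>x\<in>D. \<kappa> \<le> \<bar>deriv_within D f x\<bar>) \<and>
     (\<forall>D\<in>GC. c D \<in> frontier D \<and> (\<forall>x\<in>D. deriv_within D f x = 0 \<longleftrightarrow> x = c D)) \<and>
     (\<forall>D\<in>GC. f (c D) = v D \<and> v D \<in> {0, 1}) \<and> f 1 = 0 \<and>
     f 0 = 0 \<and> \<kappa> \<le> deriv_within (Delta0 G) f 0 \<and> deriv_within (Delta1 G) f 1 \<le> - \<kappa> \<and>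
     (\<forall>D\<in>G. \<forall>x\<in>D. \<bar>deriv_within D f x\<bar> \<le> A) \<and>
     (\<exists>s. 0 < s \<and> s < 1 \<and>
        inv_into (Delta0 G) f
          (max (measure lborel (Delta0 G)) (measure lborel (Delta1 G))) \<le> s \<and>
        (\<forall>D\<in>G. \<forall>x\<in>D \<inter> ({0..s} \<union> {1 - s..1}). \<kappa> \<le> \<bar>deriv_within D f x\<bar>)) \<and>
     (\<forall>D\<in>GC. \<exists>a. Cn_on 3 D a \<and>
        (\<forall>x\<in>D. a x \<in> {1/A..A} \<union> {-A..-(1/A)} \<and>
               \<bar>deriv_within D a x\<bar> \<in> {1/A..A} \<and>
               f x = f (c D) + a x * (x - c D) ^ (1 + \<gamma> D)))}"

definition ergodic_automorphism :: "'w measure \<Rightarrow> ('w \<Rightarrow> 'w) \<Rightarrow> bool" where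
  "ergodic_automorphism M \<theta> \<longleftrightarrow>
     bij_betw \<theta> (space M) (space M) \<and>
     \<theta> \<in> measurable M M \<and> inv_into (space M) \<theta> \<in> measurable M M \<and>
     distr M M \<theta> = M \<and>
     (\<forall>B\<in>sets M. \<theta> -` B \<inter> space M = B \<longrightarrow> measure M B = 0 \<or> measure M B = 1)"

definition random_critically_finite ::
  "'w measure \<Rightarrow> ('w \<Rightarrow> 'w) \<Rightarrow> real set set \<Rightarrow> real set set \<Rightarrow> real set set \<Rightarrow>
   real \<Rightarrow> real \<Rightarrow> (real set \<Rightarrow> nat) \<Rightarrow> (real set \<Rightarrow> real) \<Rightarrow> (real set \<Rightarrow> real) \<Rightarrow>
   ('w \<Rightarrow> real \<Rightarrow> real) \<Rightarrow> bool" where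
  "random_critically_finite M \<theta> G GC GE \<kappa> A \<gamma> c v T \<longleftrightarrow>
     prob_space M \<and> complete_measure M \<and> ergodic_automorphism M \<theta> \<and>
     interval_system G \<and> G = GC \<union> GE \<and> GC \<inter> GE = {} \<and>
     1 < \<kappa> \<and> 1 < A \<and> (\<forall>D\<in>GC. 1 \<le> \<gamma> D) \<and>
     (\<forall>\<omega>\<in>space M. T \<omega> \<in> critically_finite_maps G GC GE \<kappa> A \<gamma> c v) \<and>
     (\<forall>x\<in>\<Union>G. (\<lambda>\<omega>. T \<omega> x) \<in> borel_measurable M) \<and>
     (\<exists>D\<in>GC. v D = 0)"

fun random_iter :: "('w \<Rightarrow> 'w) \<Rightarrow> ('w \<Rightarrow> real \<Rightarrow> real) \<Rightarrow> nat \<Rightarrow> 'w \<Rightarrow> real \<Rightarrow> real" where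
  "random_iter \<theta> T 0 \<omega> x = x"
| "random_iter \<theta> T (Suc n) \<omega> x = T ((\<theta> ^^ n) \<omega>) (random_iter \<theta> T n \<omega> x)"

fun inverse_branch0 ::
  "real set set \<Rightarrow> ('w \<Rightarrow> 'w) \<Rightarrow> ('w \<Rightarrow> real \<Rightarrow> real) \<Rightarrow> nat \<Rightarrow> 'w \<Rightarrow> real \<Rightarrow> real" where
  "inverse_branch0 G \<theta> T 0 \<omega> y = y"
| "inverse_branch0 G \<theta> T (Suc k) \<omega> y =
     inv_into (Delta0 G) (T \<omega>) (inverse_branch0 G \<theta> T k (\<theta> \<omega>) y)"

definition trunc_domain ::
  "real set set \<Rightarrow> ('w \<Rightarrow> 'w) \<Rightarrow> ('w \<Rightarrow> real \<Rightarrow> real) \<Rightarrow> nat \<Rightarrow> 'w \<Rightarrow> real set" where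
  "trunc_domain G \<theta> T k \<omega> = {inverse_branch0 G \<theta> T k \<omega> 1..1}"

definition trunc_julia ::
  "real set set \<Rightarrow> ('w \<Rightarrow> 'w) \<Rightarrow> ('w \<Rightarrow> real \<Rightarrow> real) \<Rightarrow> nat \<Rightarrow> 'w \<Rightarrow> real set" where
  "trunc_julia G \<theta> T k \<omega> =
     {x. \<forall>n. random_iter \<theta> T n \<omega> x \<in> \<Union>G \<inter> trunc_domain G \<theta> T k ((\<theta> ^^ n) \<omega>)}"

text \<open>For \<open>k \<ge> 1\<close> the truncated fibre contains no endpoint of an element of \<open>G\<close>: endpoints are
  mapped to \<open>0\<close> or \<open>1\<close>, and \<open>1\<close> is mapped to \<open>0\<close>, which lies outside every truncated domain.
  So the derivatives below are two-sided and nonzero, and the sum is over a finite set.\<close>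

definition transfer_op ::
  "real set set \<Rightarrow> ('w \<Rightarrow> 'w) \<Rightarrow> ('w \<Rightarrow> real \<Rightarrow> real) \<Rightarrow> real \<Rightarrow> nat \<Rightarrow> 'w \<Rightarrow>
   (real \<Rightarrow> real) \<Rightarrow> real \<Rightarrow> real" where
  "transfer_op G \<theta> T t k \<omega> g x =
     (\<Sum>y | y \<in> trunc_julia G \<theta> T k \<omega> \<and> T \<omega> y = x.
        g y * \<bar>deriv_within (\<Union>G) (T \<omega>) y\<bar> powr (- t))"

text \<open>A random probability measure with marginal \<open>M\<close> is given by its disintegration, a
  probability kernel \<open>\<nu>\<close> from \<open>M\<close> to the Borel sets of the line.  The eigenmeasure equation
  for the dual operator is tested against all continuous functions on the compact fibre.\<close>

definition conformal_pair ::
  "'w measure \<Rightarrow> real set set \<Rightarrow> ('w \<Rightarrow> 'w) \<Rightarrow> ('w \<Rightarrow> real \<Rightarrow> real) \<Rightarrow> real \<Rightarrow> nat \<Rightarrow>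
   ('w \<Rightarrow> real measure) \<Rightarrow> ('w \<Rightarrow> real) \<Rightarrow> bool" where
  "conformal_pair M G \<theta> T t k \<nu> lam \<longleftrightarrow>
     \<nu> \<in> measurable M (prob_algebra borel) \<and>
     (AE \<omega> in M. measure (\<nu> \<omega>) (trunc_julia G \<theta> T k \<omega>) = 1) \<and>
     lam \<in> borel_measurable M \<and> (\<forall>\<omega>\<in>space M. 0 < lam \<omega>) \<and>
     (AE \<omega> in M. \<forall>g. continuous_on (trunc_julia G \<theta> T k \<omega>) g \<longrightarrow>
        (LINT x : trunc_julia G \<theta> T k (\<theta> \<omega>) | \<nu> (\<theta> \<omega>). transfer_op G \<theta> T t k \<omega> g x) =
        lam \<omega> * (LINT x : trunc_julia G \<theta> T k \<omega> | \<nu> \<omega>. g x))"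

text \<open>The description is well defined because conformal pairs exist and all of them give the
  same value of the integral.\<close>

definition trunc_pressure ::
  "'w measure \<Rightarrow> real set set \<Rightarrow> ('w \<Rightarrow> 'w) \<Rightarrow> ('w \<Rightarrow> real \<Rightarrow> real) \<Rightarrow> nat \<Rightarrow> real \<Rightarrow> real" where
  "trunc_pressure M G \<theta> T k t =
     (THE p. \<exists>\<nu> lam. conformal_pair M G \<theta> T t k \<nu> lam \<and> p = (\<integral>\<omega>. ln (lam \<omega>) \<partial>M))"

text \<open>The limit may be infinite.\<close>

definition pressure ::
  "'w measure \<Rightarrow> real set set \<Rightarrow> ('w \<Rightarrow> 'w) \<Rightarrow> ('w \<Rightarrow> real \<Rightarrow> real) \<Rightarrow> real \<Rightarrow> ereal" where
  "pressure M G \<theta> T t = lim (\<lambda>k. ereal (trunc_pressure M G \<theta> T k t))"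

definition chi0 ::
  "'w measure \<Rightarrow> real set set \<Rightarrow> ('w \<Rightarrow> real \<Rightarrow> real) \<Rightarrow> real" where
  "chi0 M G T = (\<integral>\<omega>. ln \<bar>deriv_within (Delta0 G) (T \<omega>) 0\<bar> \<partial>M)"

definition gamma_plus :: "real set set \<Rightarrow> (real set \<Rightarrow> nat) \<Rightarrow> nat" where
  "gamma_plus GC \<gamma> = Max (\<gamma> ` GC)"

definition AA ::
  "'w measure \<Rightarrow> real set set \<Rightarrow> real set set \<Rightarrow> (real set \<Rightarrow> nat) \<Rightarrow> ('w \<Rightarrow> 'w) \<Rightarrow>
   ('w \<Rightarrow> real \<Rightarrow> real) \<Rightarrow> real set" where
  "AA M G GC \<gamma> \<theta> T =
     {t. 0 \<le> t \<and>
         pressure M G \<theta> T t > ereal (- (1 / (1 + real (gamma_plus GC \<gamma>))) * chi0 M G T * t)}"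

definition b_T ::
  "'w measure \<Rightarrow> real set set \<Rightarrow> ('w \<Rightarrow> 'w) \<Rightarrow> ('w \<Rightarrow> real \<Rightarrow> real) \<Rightarrow> ereal" where
  "b_T M G \<theta> T = Sup (ereal ` {t. 0 \<le> t \<and> pressure M G \<theta> T t \<ge> 0})"

end

theory Submission
  imports Defs
begin

text \<open>
  Inverse branches of the maps of the class have positive Schwarzian derivative, a property that is
  preserved under composition and says that \<open>\<bar>F'\<bar>\<close> raised to the power \<open>- 1/2\<close> is concave.  This gives a
  Koebe distortion estimate for all inverse branches of all orders, and away from \<open>0\<close> and \<open>1\<close>, where
  the truncated fibres live, it bounds their derivatives and makes their images shrink.  A coupling
  of admissible words through the symbol \<open>\<Delta>\<^sub>1\<close> then shows that the normalised iterates
  \<open>L\<^sup>n g / L\<^sup>n 1\<close> of the truncated transfer operators converge to constants.  The limits are the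
  conformal measures, and \<open>n\<close> times the truncated pressure differs by a bounded amount from the integral
  of the logarithm of the \<open>n\<close>-th partition sum.  Comparing partition sums, the pressure \<open>P\<close> is
  nonincreasing, satisfies \<open>P(t) \<ge> P(s) - (t - s) ln A\<close> for \<open>s \<le> t\<close>, and \<open>P(0) > 0\<close>.
  Hence \<open>P \<ge> 0\<close> on \<open>[0, b\<^sub>T)\<close>, \<open>b\<^sub>T > 0\<close>, and \<open>P(t) \<ge> - (t - b\<^sub>T) ln A\<close> from \<open>b\<^sub>T\<close> on, which exceeds
  the line \<open>- \<chi>\<^sub>0 t / (1 + \<gamma>\<^sub>+)\<close> on an interval to the right of \<open>b\<^sub>T\<close>.
\<close>

text \<open>At level \<open>k\<close> the truncation forbids \<open>k\<close> consecutive letters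
  \<open>D0\<close>. Whether a word may be placed over a base point thus depends on how many letters
  \<open>D0\<close> begin the itinerary of that point, so the sums over two base points run over
  different words and cannot be compared term by term. The remedy is the interval at 1: it lies to
  the right of \<beta>, so a letter \<open>D1\<close> ends every run, and a word ending in it is
  admissible over all points of the fibre or over none. This replacement costs a factor A^t, visible
  in the constants \<open>C\<close> and \<open>gap\<close>. Critical points are endpoints of
  branches, so inverse branches may have infinite derivative at 0 and 1; the margin
  \<open>\<tau> k\<close> between the fibre and {0, 1} keeps this away. All constants depend on
  \<open>k\<close> and \<open>t\<close> but not on the length of words. They enter the logarithm of
  a partition sum as a bounded error and disappear on division by n, so the comparisons of pressures
  carry no constants and survive the limit in \<open>k\<close>.\<close>

section \<open>Positive Schwarzian derivative and the Koebe estimate\<close>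

text \<open>The last inequality says that the Schwarzian derivative is nonnegative.\<close>

definition expanding_schwarz :: "(real \<Rightarrow> real) \<Rightarrow> (real \<Rightarrow> real) \<Rightarrow> bool" where
  "expanding_schwarz F F1 \<longleftrightarrow>
     ((\<forall>x\<in>{0<..<1}. 0 < F1 x) \<or> (\<forall>x\<in>{0<..<1}. F1 x < 0)) \<and>
     (\<exists>F2 F3. \<forall>x\<in>{0<..<1}. F x \<in> {0<..<1} \<and> DERIV F x :> F1 x \<and>
        DERIV F1 x :> F2 x \<and> DERIV F2 x :> F3 x \<and> 3/2 * (F2 x)\<^sup>2 \<le> F1 x * F3 x)"

lemma expanding_schwarz_ident: "expanding_schwarz (\<lambda>x. x) (\<lambda>x. 1)"
  unfolding expanding_schwarz_def
  by (intro conjI disjI1 exI[of _ "\<lambda>x. 0"] ballI) auto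

text \<open>The reason is the cocycle rule S(F o H) = (S(F) o H) H'^2 + S(H), whose two terms are
  nonnegative.\<close>

lemma expanding_schwarz_compose:
  assumes F: "expanding_schwarz F F1" and H: "expanding_schwarz H H1"
  shows "expanding_schwarz (\<lambda>x. F (H x)) (\<lambda>x. F1 (H x) * H1 x)"
proof -
  from F obtain F2 F3 where F23: "\<And>x. x \<in> {0<..<1} \<Longrightarrow> F x \<in> {0<..<1} \<and> DERIV F x :> F1 x \<and>
        DERIV F1 x :> F2 x \<and> DERIV F2 x :> F3 x \<and> 3/2 * (F2 x)\<^sup>2 \<le> F1 x * F3 x"
    unfolding expanding_schwarz_def by blast
  from H obtain H2 H3 where H23: "\<And>x. x \<in> {0<..<1} \<Longrightarrow> H x \<in> {0<..<1} \<and> DERIV H x :> H1 x \<and>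
        DERIV H1 x :> H2 x \<and> DERIV H2 x :> H3 x \<and> 3/2 * (H2 x)\<^sup>2 \<le> H1 x * H3 x"
    unfolding expanding_schwarz_def by blast
  have sgn: "(\<forall>x\<in>{0<..<1}. 0 < F1 (H x) * H1 x) \<or> (\<forall>x\<in>{0<..<1}. F1 (H x) * H1 x < 0)"
  proof -
    have *: "H x \<in> {0<..<1}" if "x \<in> {0<..<1}" for x using H23[OF that] by blast
    have "(\<forall>x\<in>{0<..<1}. 0 < F1 x) \<or> (\<forall>x\<in>{0<..<1}. F1 x < 0)"
      "(\<forall>x\<in>{0<..<1}. 0 < H1 x) \<or> (\<forall>x\<in>{0<..<1}. H1 x < 0)"
      using F H unfolding expanding_schwarz_def by simp_all
    then consider "\<forall>x\<in>{0<..<1}. 0 < F1 (H x) \<and> 0 < H1 x" | "\<forall>x\<in>{0<..<1}. F1 (H x) < 0 \<and> H1 x < 0"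
      | "\<forall>x\<in>{0<..<1}. 0 < F1 (H x) \<and> H1 x < 0" | "\<forall>x\<in>{0<..<1}. F1 (H x) < 0 \<and> 0 < H1 x"
      using * by (elim disjE) metis+
    then show ?thesis
      by cases (simp_all add: mult_pos_pos mult_neg_neg mult_pos_neg mult_neg_pos)
  qed
  define K2 where "K2 x = F2 (H x) * (H1 x)\<^sup>2 + F1 (H x) * H2 x" for x
  define K3 where "K3 x = F3 (H x) * (H1 x)^3 + 3 * F2 (H x) * H1 x * H2 x + F1 (H x) * H3 x" for x
  have "F (H x) \<in> {0<..<1} \<and> DERIV (\<lambda>x. F (H x)) x :> F1 (H x) * H1 x \<and>
        DERIV (\<lambda>x. F1 (H x) * H1 x) x :> K2 x \<and> DERIV K2 x :> K3 x \<and>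
        3/2 * (K2 x)\<^sup>2 \<le> (F1 (H x) * H1 x) * K3 x" if x: "x \<in> {0<..<1}" for x
  proof (intro conjI)
    note h = H23[OF x]
    then have hx: "H x \<in> {0<..<1}" by blast
    note f = F23[OF hx]
    have [derivative_intros]: "DERIV (\<lambda>x. F (H x)) x :> F1 (H x) * H1 x"
      "DERIV (\<lambda>x. F1 (H x)) x :> F2 (H x) * H1 x" "DERIV (\<lambda>x. F2 (H x)) x :> F3 (H x) * H1 x"
      "DERIV H1 x :> H2 x" "DERIV H2 x :> H3 x"
      using f h by (auto intro: DERIV_chain2)
    show "F (H x) \<in> {0<..<1}" using f by blast
    show "DERIV (\<lambda>x. F (H x)) x :> F1 (H x) * H1 x" by fact
    show "DERIV (\<lambda>x. F1 (H x) * H1 x) x :> K2 x"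
      unfolding K2_def by (auto intro!: derivative_eq_intros simp: power2_eq_square)
    show "DERIV K2 x :> K3 x"
      unfolding K2_def[abs_def] K3_def
      by (auto intro!: derivative_eq_intros simp: power2_eq_square power3_eq_cube algebra_simps)
    \<comment> \<open>The cocycle rule multiplied by the square of \<open>F1 (H x) * H1 x\<close>,
      which clears all denominators.\<close>
    have "(F1 (H x) * H1 x) * K3 x - 3/2 * (K2 x)\<^sup>2 =
      (F1 (H x) * F3 (H x) - 3/2 * (F2 (H x))\<^sup>2) * (H1 x)^4 +
      (H1 x * H3 x - 3/2 * (H2 x)\<^sup>2) * (F1 (H x))\<^sup>2"
      unfolding K2_def K3_def by algebra
    also have "\<dots> \<ge> 0" using f h by (intro add_nonneg_nonneg mult_nonneg_nonneg) auto
    finally show "3/2 * (K2 x)\<^sup>2 \<le> (F1 (H x) * H1 x) * K3 x" by simp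
  qed
  with sgn show ?thesis unfolding expanding_schwarz_def by blast
qed

section \<open>Concavity and the Koebe inequality\<close>

text \<open>The chord from \<open>x\<close> through \<open>p\<close> continues to an endpoint of the
  unit interval, where the function is still nonnegative; so \<open>f p\<close> is at least the
  share of \<open>f x\<close> given by the distances to that endpoint. The endpoints lie outside the
  domain, hence the auxiliary point \<open>e\<close>, which is finally moved to 0 or 1.\<close>

lemma concave_on_unit_growth:
  fixes f :: "real \<Rightarrow> real"
  assumes conc: "concave_on {0<..<1} f" and pos: "\<And>x. x \<in> {0<..<1} \<Longrightarrow> 0 \<le> f x"
    and x: "x \<in> {0<..<1}" and p: "\<tau> \<le> p" "p \<le> 1 - \<tau>" "0 < \<tau>"
  shows "f x \<le> f p * (1 + \<bar>p - x\<bar> / \<tau>)"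
proof -
  have p01: "p \<in> {0<..<1}" using p by auto
  have key: "f x * (p - e) \<le> f p * (x - e)" if "0 < e" "e < p" "p \<le> x" for e
  proof -
    define u where "u = (p - e) / (x - e)"
    have u: "0 \<le> u" "u \<le> 1" using that by (auto simp: u_def)
    have "(1 - u) * f e + u * f x \<le> f ((1 - u) *\<^sub>R e + u *\<^sub>R x)"
      using conc u that x p01 unfolding concave_on_iff by auto
    moreover have "u * (x - e) = p - e" using that by (simp add: u_def)
    then have "(1 - u) *\<^sub>R e + u *\<^sub>R x = p" by (simp add: algebra_simps)
    moreover have "0 \<le> (1 - u) * f e" using u pos[of e] that p01 by auto
    ultimately have "u * f x \<le> f p" by simp
    then show ?thesis using that by (simp add: u_def field_simps)
  qed
  have key2: "f x * (e - p) \<le> f p * (e - x)" if "e < 1" "p < e" "x \<le> p" for e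
  proof -
    define u where "u = (e - p) / (e - x)"
    have u: "0 \<le> u" "u \<le> 1" using that by (auto simp: u_def)
    have "(1 - u) * f e + u * f x \<le> f ((1 - u) *\<^sub>R e + u *\<^sub>R x)"
      using conc u that x p01 unfolding concave_on_iff by auto
    moreover have "u * (e - x) = e - p" using that by (simp add: u_def)
    then have "(1 - u) *\<^sub>R e + u *\<^sub>R x = p" by (simp add: algebra_simps)
    moreover have "0 \<le> (1 - u) * f e" using u pos[of e] that p01 by auto
    ultimately have "u * f x \<le> f p" by simp
    then show ?thesis using that by (simp add: u_def field_simps)
  qed
  have fp: "0 \<le> f p" using pos p01 by blast
  show ?thesis
  proof (cases "p \<le> x")
    case True
    have "f x * p \<le> f p * x"
    proof (rule tendsto_le[of "at_right 0"])
      show "((\<lambda>e. f p * (x - e)) \<longlongrightarrow> f p * x) (at_right 0)"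
        by (auto intro!: tendsto_eq_intros)
      show "((\<lambda>e. f x * (p - e)) \<longlongrightarrow> f x * p) (at_right 0)"
        by (auto intro!: tendsto_eq_intros)
      show "\<forall>\<^sub>F e in at_right 0. f x * (p - e) \<le> f p * (x - e)"
        using eventually_at_right_less[of 0] eventually_at_right_real[of 0 p]
        by (rule eventually_elim2) (use key True p01 in auto)
    qed simp
    then have "f x \<le> f p * (1 + (x - p) / p)" using p01 by (simp add: field_simps)
    also have "\<dots> \<le> f p * (1 + (x - p) / \<tau>)"
      using fp True p by (intro mult_left_mono add_left_mono divide_left_mono) auto
    finally show ?thesis using True by simp
  next
    case False
    have "f x * (1 - p) \<le> f p * (1 - x)"
    proof (rule tendsto_le[of "at_left 1"])
      show "((\<lambda>e. f p * (e - x)) \<longlongrightarrow> f p * (1 - x)) (at_left 1)"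
        by (auto intro!: tendsto_eq_intros)
      show "((\<lambda>e. f x * (e - p)) \<longlongrightarrow> f x * (1 - p)) (at_left 1)"
        by (auto intro!: tendsto_eq_intros)
      show "\<forall>\<^sub>F e in at_left 1. f x * (e - p) \<le> f p * (e - x)"
        using eventually_at_left_real[of p 1]
        by (rule eventually_mono) (use key2 False p01 in auto)
    qed simp
    then have "f x \<le> f p * (1 + (p - x) / (1 - p))" using p01 by (simp add: field_simps)
    also have "\<dots> \<le> f p * (1 + (p - x) / \<tau>)"
      using fp False p by (intro mult_left_mono add_left_mono divide_left_mono) auto
    finally show ?thesis using False by simp
  qed
qed

text \<open>For \<phi> = F'^(-1/2) one finds \<phi>'' = - S(F) \<phi> / 2, so \<phi> is concave. The
  growth bound for \<phi>, inverted and squared, is the estimate.\<close>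

lemma koebe_pos:
  fixes F1 F2 F3 :: "real \<Rightarrow> real"
  assumes pos: "\<And>x. x \<in> {0<..<1} \<Longrightarrow> 0 < F1 x"
    and d1: "\<And>x. x \<in> {0<..<1} \<Longrightarrow> DERIV F1 x :> F2 x"
    and d2: "\<And>x. x \<in> {0<..<1} \<Longrightarrow> DERIV F2 x :> F3 x"
    and S: "\<And>x. x \<in> {0<..<1} \<Longrightarrow> 3/2 * (F2 x)\<^sup>2 \<le> F1 x * F3 x"
    and x: "x \<in> {0<..<1}" and p: "\<tau> \<le> p" "p \<le> 1 - \<tau>" "0 < \<tau>"
  shows "F1 p \<le> F1 x * (1 + \<bar>p - x\<bar> / \<tau>)\<^sup>2"
proof -
  define \<phi> where "\<phi> x = 1 / sqrt (F1 x)" for x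
  define \<phi>1 where "\<phi>1 x = - F2 x / (2 * F1 x * sqrt (F1 x))" for x
  define \<phi>2 where "\<phi>2 x = - (F1 x * F3 x - 3/2 * (F2 x)\<^sup>2) / (2 * (F1 x)\<^sup>2 * sqrt (F1 x))" for x
  have "concave_on {0<..<1} \<phi>"
  proof (rule f''_le0_imp_concave)
    fix x :: real assume x: "x \<in> {0<..<1}"
    have s: "sqrt (F1 x) > 0" "sqrt (F1 x) * sqrt (F1 x) = F1 x" using pos[OF x] by auto
    obtain r where r: "r > 0" "F1 x = r * r" "sqrt (F1 x) = r" using s by metis
    show "DERIV \<phi> x :> \<phi>1 x"
      unfolding \<phi>_def \<phi>1_def using pos[OF x] d1[OF x]
      by (auto intro!: derivative_eq_intros simp: field_simps)
    show "DERIV \<phi>1 x :> \<phi>2 x"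
      unfolding \<phi>1_def \<phi>2_def using pos[OF x] d1[OF x] d2[OF x] r
      by (auto intro!: derivative_eq_intros) (simp add: field_simps power2_eq_square)
    show "\<phi>2 x \<le> 0" unfolding \<phi>2_def using S[OF x] pos[OF x] by (auto simp: divide_simps)
  qed simp
  then have "\<phi> x \<le> \<phi> p * (1 + \<bar>p - x\<bar> / \<tau>)"
    by (rule concave_on_unit_growth) (use pos x p in \<open>auto simp: \<phi>_def intro: less_imp_le\<close>)
  moreover have px: "0 < F1 p" "0 < F1 x" using pos x p by auto
  ultimately have "sqrt (F1 p) \<le> sqrt (F1 x) * (1 + \<bar>p - x\<bar> / \<tau>)"
    by (simp add: \<phi>_def divide_simps mult_ac)
  then have "(sqrt (F1 p))\<^sup>2 \<le> (sqrt (F1 x) * (1 + \<bar>p - x\<bar> / \<tau>))\<^sup>2"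
    using px by (intro power_mono) auto
  then show ?thesis using px by (simp add: power_mult_distrib)
qed

text \<open>Only \<open>p\<close> keeps a distance from 0 and 1. Near the ends the derivative may
  blow up, but it cannot become small compared with its value at \<open>p\<close>; accordingly the
  inequality goes in one direction.\<close>

lemma koebe:
  assumes F: "expanding_schwarz F F1" and x: "x \<in> {0<..<1}" and p: "\<tau> \<le> p" "p \<le> 1 - \<tau>" "0 < \<tau>"
  shows "\<bar>F1 p\<bar> \<le> \<bar>F1 x\<bar> * (1 + \<bar>p - x\<bar> / \<tau>)\<^sup>2"
proof -
  from F obtain F2 F3 where F23: "\<And>x. x \<in> {0<..<1} \<Longrightarrow> F x \<in> {0<..<1} \<and> DERIV F x :> F1 x \<and>
        DERIV F1 x :> F2 x \<and> DERIV F2 x :> F3 x \<and> 3/2 * (F2 x)\<^sup>2 \<le> F1 x * F3 x"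
    unfolding expanding_schwarz_def by blast
  have px: "p \<in> {0<..<1}" using p by auto
  from F consider "\<forall>x\<in>{0<..<1}. 0 < F1 x" | "\<forall>x\<in>{0<..<1}. F1 x < 0"
    unfolding expanding_schwarz_def by blast
  then show ?thesis
  proof cases
    case 1
    then have "F1 p \<le> F1 x * (1 + \<bar>p - x\<bar> / \<tau>)\<^sup>2"
      using F23 x p by (intro koebe_pos[of F1 F2 F3]) auto
    moreover have "0 < F1 p" "0 < F1 x" using 1 x px by blast+
    ultimately show ?thesis by simp
  next
    case 2
    then have "- F1 p \<le> - F1 x * (1 + \<bar>p - x\<bar> / \<tau>)\<^sup>2"
      using F23 x p
      by (intro koebe_pos[of "\<lambda>x. - F1 x" "\<lambda>x. - F2 x" "\<lambda>x. - F3 x"])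
         (auto intro!: derivative_eq_intros)
    moreover have "F1 p < 0" "F1 x < 0" using 2 x px by blast+
    ultimately show ?thesis by simp
  qed
qed

corollary koebe_unit:
  assumes F: "expanding_schwarz F F1" and x: "x \<in> {0<..<1}" and p: "\<tau> \<le> p" "p \<le> 1 - \<tau>" "0 < \<tau>"
  shows "\<bar>F1 p\<bar> * \<tau>\<^sup>2 \<le> \<bar>F1 x\<bar>"
proof -
  have "\<tau> + \<bar>p - x\<bar> \<le> 1" using x p by auto
  then have "(\<tau> + \<bar>p - x\<bar>) / \<tau> \<le> 1 / \<tau>" using p by (intro divide_right_mono) auto
  then have "1 + \<bar>p - x\<bar> / \<tau> \<le> 1 / \<tau>" using p by (simp add: add_divide_distrib)
  then have "(1 + \<bar>p - x\<bar> / \<tau>)\<^sup>2 \<le> (1 / \<tau>)\<^sup>2" using p by (intro power_mono) auto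
  then have "\<bar>F1 x\<bar> * (1 + \<bar>p - x\<bar> / \<tau>)\<^sup>2 \<le> \<bar>F1 x\<bar> * (1 / \<tau>)\<^sup>2" by (rule mult_left_mono) simp
  with koebe[OF assms] have "\<bar>F1 p\<bar> \<le> \<bar>F1 x\<bar> * (1 / \<tau>)\<^sup>2" by linarith
  then show ?thesis using p by (simp add: field_simps power_divide)
qed

section \<open>Bounds on derivatives and lengths of images\<close>

lemma mvt_01:
  fixes F :: "real \<Rightarrow> real"
  assumes "continuous_on {0..1} F" "\<And>x. x \<in> {0<..<1} \<Longrightarrow> DERIV F x :> F1 x" "0 \<le> a" "a < b" "b \<le> 1"
  shows "\<exists>z\<in>{a<..<b}. F b - F a = (b - a) * F1 z"
proof -
  have "\<exists>z>a. z < b \<and> F b - F a = (*) (F1 z) (b - a)"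
  proof (rule mvt[OF \<open>a < b\<close>])
    show "continuous_on {a..b} F" using assms by (auto intro: continuous_on_subset)
    show "(F has_derivative (*) (F1 z)) (at z)" if "a < z" "z < b" for z
      using assms(2)[of z] that assms by (auto simp: has_field_derivative_def)
  qed blast
  then show ?thesis by (auto simp: mult.commute)
qed

text \<open>The image has length at most 1, so somewhere the derivative is at most 1 in modulus, and
  Koebe carries this to every \<open>p\<close> with margin \<tau>. The bound is the same for all F,
  in particular for inverse branches of all orders.\<close>

lemma expanding_schwarz_deriv_le:
  assumes F: "expanding_schwarz F F1" and c: "continuous_on {0..1} F" and r: "F ` {0..1} \<subseteq> {0..1}"
    and p: "\<tau> \<le> p" "p \<le> 1 - \<tau>" "0 < \<tau>"
  shows "\<bar>F1 p\<bar> * \<tau>\<^sup>2 \<le> 1"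
proof -
  have d: "\<And>x. x \<in> {0<..<1} \<Longrightarrow> DERIV F x :> F1 x" using F unfolding expanding_schwarz_def by blast
  obtain z where z: "z \<in> {0<..<1}" "F 1 - F 0 = F1 z" using mvt_01[OF c d, of 0 1] by auto
  have "F 1 \<in> {0..1}" "F 0 \<in> {0..1}" using r by (force simp: image_subset_iff)+
  then have "\<bar>F1 z\<bar> \<le> 1" using z by auto
  then show ?thesis using koebe_unit[OF F z(1) p] by linarith
qed

text \<open>The margin [0, \<tau>] takes a definite share of the image: on it the derivative is at
  least \<tau>^2 times that in the middle, and its length is \<tau>, whence \<tau>^3. The hypothesis
  \<open>mono\<close> expresses that the images of margin and middle do not overlap.\<close>

lemma expanding_schwarz_middle_le:
  assumes F: "expanding_schwarz F F1" and c: "continuous_on {0..1} F" and \<tau>: "0 < \<tau>"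
    and xy: "x \<in> {\<tau>..1-\<tau>}" "y \<in> {\<tau>..1-\<tau>}"
    and mono: "\<bar>F x - F y\<bar> + \<bar>F \<tau> - F 0\<bar> \<le> \<bar>F 1 - F 0\<bar>"
  shows "\<bar>F x - F y\<bar> * (1 + \<tau>^3) \<le> \<bar>F 1 - F 0\<bar>"
proof (cases "x = y")
  case False
  have d: "\<And>x. x \<in> {0<..<1} \<Longrightarrow> DERIV F x :> F1 x" using F unfolding expanding_schwarz_def by blast
  obtain a b where ab: "a \<in> {\<tau>..1-\<tau>}" "b \<in> {\<tau>..1-\<tau>}" "a < b" "\<bar>F x - F y\<bar> = \<bar>F b - F a\<bar>"
    using False xy by (metis abs_minus_commute linorder_neqE)
  obtain p where p: "p \<in> {a<..<b}" "F b - F a = (b - a) * F1 p" using mvt_01[OF c d, of a b] ab \<tau> by auto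
  obtain z where z: "z \<in> {0<..<\<tau>}" "F \<tau> - F 0 = \<tau> * F1 z" using mvt_01[OF c d, of 0 \<tau>] ab \<tau> by auto
  have "\<bar>F1 p\<bar> * \<tau>\<^sup>2 \<le> \<bar>F1 z\<bar>" using p ab z \<tau> by (intro koebe_unit[OF F]) auto
  then have "\<tau> * (\<bar>F1 p\<bar> * \<tau>\<^sup>2) \<le> \<bar>F \<tau> - F 0\<bar>" using z \<tau> by (simp add: abs_mult)
  moreover have "\<bar>F b - F a\<bar> \<le> \<bar>F1 p\<bar>" using p ab \<tau> by (auto simp: abs_mult intro: mult_left_le_one_le)
  then have "\<bar>F b - F a\<bar> * \<tau>^3 \<le> \<bar>F1 p\<bar> * \<tau>^3" using \<tau> by (intro mult_right_mono) auto
  ultimately have "\<bar>F x - F y\<bar> * \<tau>^3 \<le> \<bar>F \<tau> - F 0\<bar>"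
    using ab by (simp add: power2_eq_square power3_eq_cube mult_ac)
  then show ?thesis using mono by (simp add: algebra_simps)
qed simp

section \<open>Full branches and their inverses\<close>

lemma full_branch_monotone:
  fixes f :: "real \<Rightarrow> real"
  assumes ab: "a < b" and c: "continuous_on {a..b} f" and inj: "inj_on f {a..b}" and img: "f ` {a..b} = {0..1}"
  shows "(strict_mono_on {a..b} f \<and> f a = 0 \<and> f b = 1) \<or> (strict_antimono_on {a..b} f \<and> f a = 1 \<and> f b = 0)"
proof -
  have mem: "a \<in> {a..b}" "b \<in> {a..b}" using ab by auto
  then have r: "f a \<in> {0..1}" "f b \<in> {0..1}" using img by blast+
  have "0 \<in> f ` {a..b}" "1 \<in> f ` {a..b}" using img by auto
  then obtain x y where xy: "x \<in> {a..b}" "f x = 0" "y \<in> {a..b}" "f y = 1" by (metis imageE)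
  have "strict_mono_on {a..b} f \<or> strict_antimono_on {a..b} f"
    using injective_eq_monotone_map[of "{a..b}" f] c inj by (simp add: is_interval_cc)
  then show ?thesis
  proof
    assume m: "strict_mono_on {a..b} f"
    have "mono_on {a..b} f" using m by (rule strict_mono_on_imp_mono_on)
    then have "f a \<le> f x" "f y \<le> f b"
      by (rule monotone_onD; use xy mem in simp)+
    then show ?thesis using m r xy by auto
  next
    assume m: "strict_antimono_on {a..b} f"
    then have m': "antimono_on {a..b} f" by (simp add: strict_antimono_iff_antimono)
    have "f y \<le> f a" "f b \<le> f x"
      by (rule monotone_onD[OF m']; use xy mem in simp)+
    then show ?thesis using m r xy by auto
  qed
qed

lemma full_branch_deriv_within:
  assumes ab: "a < b" and C3: "Cn_on 3 {a..b} f" and x: "x \<in> {a<..<b}" and j: "j < 3"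
  shows "DERIV ((deriv_within {a..b} ^^ j) f) x :> (deriv_within {a..b} ^^ Suc j) f x"
proof -
  have "((deriv_within {a..b} ^^ j) f) differentiable (at x within {a..b})"
    using C3 x j unfolding Cn_on_def by auto
  then obtain D where D: "((deriv_within {a..b} ^^ j) f has_real_derivative D) (at x within {a..b})"
    by (auto simp: real_differentiable_def)
  have "deriv_within {a..b} ((deriv_within {a..b} ^^ j) f) x = D"
    using deriv_within_eqI[OF ab _ D] x by auto
  moreover have "at x within {a..b} = at x" using x by (intro at_within_interior) (auto simp: interior_atLeastAtMost_real)
  ultimately show ?thesis using D by simp
qed

lemma full_branch_continuous:
  assumes "Cn_on 3 D f"
  shows "continuous_on D f"
proof -
  have "\<forall>x\<in>D. ((deriv_within D ^^ 0) f) differentiable (at x within D)"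
    using assms unfolding Cn_on_def by force
  then show ?thesis by (auto simp: continuous_on_eq_continuous_within intro!: differentiable_imp_continuous_within)
qed

text \<open>From S(F) = - (S(f) o F) F'^2 a negative Schwarzian derivative of a branch becomes
  positive for its inverse. A critical point can only be an endpoint, so \<open>nz\<close> concerns
  the interior, and F is smooth on the open unit interval but perhaps not up to its ends.\<close>

lemma full_branch_inverse:
  fixes f :: "real \<Rightarrow> real"
  assumes ab: "a < b" and C3: "Cn_on 3 {a..b} f" and inj: "inj_on f {a..b}" and img: "f ` {a..b} = {0..1}"
    and S: "\<And>x. x \<in> {a..b} \<Longrightarrow> deriv_within {a..b} f x \<noteq> 0 \<Longrightarrow> schwarzian {a..b} f x < 0"
    and nz: "\<And>x. x \<in> {a<..<b} \<Longrightarrow> deriv_within {a..b} f x \<noteq> 0"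
    and sub: "0 \<le> a" "b \<le> 1"
  defines "F \<equiv> inv_into {a..b} f"
  shows "continuous_on {0..1} F" "F ` {0..1} = {a..b}" "\<And>x. x \<in> {0..1} \<Longrightarrow> f (F x) = x"
    "\<And>x. x \<in> {a..b} \<Longrightarrow> F (f x) = x" "\<And>x. x \<in> {0<..<1} \<Longrightarrow> F x \<in> {a<..<b}"
    "expanding_schwarz F (\<lambda>x. 1 / deriv_within {a..b} f (F x))"
proof -
  have c: "continuous_on {a..b} f" using C3 by (rule full_branch_continuous)
  show Ff: "\<And>x. x \<in> {a..b} \<Longrightarrow> F (f x) = x" unfolding F_def using inj by (auto intro: inv_into_f_f)
  show cF: "continuous_on {0..1} F"
    using continuous_on_inv[OF c compact_Icc, of F] Ff img by auto
  show F_img: "F ` {0..1} = {a..b}"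
    unfolding F_def img[symmetric] using inj by (simp add: inv_into_image_cancel)
  show fF: "\<And>x. x \<in> {0..1} \<Longrightarrow> f (F x) = x"
    unfolding F_def using img by (auto intro: f_inv_into_f)
  note mon = full_branch_monotone[OF ab c inj img]
  show F_int: "F x \<in> {a<..<b}" if "x \<in> {0<..<1}" for x
  proof -
    have "F x \<in> {a..b}" using F_img that by auto
    moreover have "f (F x) = x" using fF that by auto
    then have "F x \<noteq> a" "F x \<noteq> b" using mon that by auto
    ultimately show ?thesis by auto
  qed
  define f1 where "f1 = deriv_within {a..b} f"
  define f2 where "f2 = deriv_within {a..b} f1"
  define f3 where "f3 = deriv_within {a..b} f2"
  have d: "DERIV f x :> f1 x" "DERIV f1 x :> f2 x" "DERIV f2 x :> f3 x" if "x \<in> {a<..<b}" for x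
    using full_branch_deriv_within[OF ab C3 that, of 0] full_branch_deriv_within[OF ab C3 that, of 1]
      full_branch_deriv_within[OF ab C3 that, of 2]
    by (auto simp: f1_def f2_def f3_def numeral_2_eq_2)
  have sg: "(\<forall>x\<in>{a<..<b}. 0 < f1 x) \<or> (\<forall>x\<in>{a<..<b}. f1 x < 0)"
    using mon
  proof (elim disjE conjE)
    assume "strict_mono_on {a..b} f"
    then have m: "mono_on {a..b} f" by (rule strict_mono_on_imp_mono_on)
    have "0 \<le> f1 x" if "x \<in> {a<..<b}" for x
      using mono_on_imp_deriv_nonneg[OF m d(1)[OF that]] that by (auto simp: interior_atLeastAtMost_real)
    then show ?thesis using nz unfolding f1_def[symmetric] by (metis order_le_less)
  next
    assume "strict_antimono_on {a..b} f"
    then have m: "mono_on {a..b} (\<lambda>x. - f x)"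
      unfolding strict_antimono_iff_antimono by (auto simp: monotone_on_def)
    have "0 \<le> - f1 x" if "x \<in> {a<..<b}" for x
      using mono_on_imp_deriv_nonneg[OF m DERIV_minus[OF d(1)[OF that]]] that
      by (auto simp: interior_atLeastAtMost_real)
    then show ?thesis using nz unfolding f1_def[symmetric] by (metis neg_0_le_iff_le order_le_less)
  qed
  have S': "f1 x * f3 x \<le> 3/2 * (f2 x)\<^sup>2" if "x \<in> {a<..<b}" for x
  proof -
    have n: "f1 x \<noteq> 0" using nz that by (simp add: f1_def)
    have "schwarzian {a..b} f x < 0" using S nz that by auto
    then have "f3 x / f1 x - 3/2 * (f2 x / f1 x)\<^sup>2 < 0"
      unfolding schwarzian_def by (simp add: f1_def f2_def f3_def eval_nat_numeral)
    then have "(f3 x / f1 x - 3/2 * (f2 x / f1 x)\<^sup>2) * (f1 x)\<^sup>2 \<le> 0"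
      by (intro mult_nonpos_nonneg) auto
    moreover have "(f3 x / f1 x - 3/2 * (f2 x / f1 x)\<^sup>2) * (f1 x)\<^sup>2 = f1 x * f3 x - 3/2 * (f2 x)\<^sup>2"
      using n by (simp add: field_simps power2_eq_square)
    ultimately show ?thesis by simp
  qed
  show "expanding_schwarz F (\<lambda>x. 1 / deriv_within {a..b} f (F x))"
    unfolding expanding_schwarz_def f1_def[symmetric]
  proof (intro conjI exI ballI)
    show "(\<forall>x\<in>{0<..<1}. 0 < 1 / f1 (F x)) \<or> (\<forall>x\<in>{0<..<1}. 1 / f1 (F x) < 0)"
      using sg F_int by (metis divide_less_0_1_iff zero_less_divide_1_iff)
    fix x :: real assume x: "x \<in> {0<..<1}"
    note Fx = F_int[OF x]
    show "F x \<in> {0<..<1}" using Fx sub by auto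
    have n: "f1 (F x) \<noteq> 0" using nz[OF Fx] by (simp add: f1_def)
    have "DERIV F x :> inverse (f1 (F x))"
    proof (rule DERIV_inverse_function[where a=0 and b=1 and f=f])
      show "isCont F x" using cF x
        by (intro continuous_on_interior[of "{0..1}"]) (auto simp: interior_atLeastAtMost_real)
    qed (use d(1)[OF Fx] n x fF in auto)
    then show dF [derivative_intros]: "DERIV F x :> 1 / f1 (F x)" by (simp add: field_simps)
    have [derivative_intros]: "DERIV (\<lambda>x. f1 (F x)) x :> f2 (F x) * (1 / f1 (F x))"
      "DERIV (\<lambda>x. f2 (F x)) x :> f3 (F x) * (1 / f1 (F x))"
      using DERIV_chain2[OF d(2)[OF Fx] dF] DERIV_chain2[OF d(3)[OF Fx] dF] by simp_all
    show "DERIV (\<lambda>x. 1 / f1 (F x)) x :> - f2 (F x) / (f1 (F x))^3"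
      using n by (auto intro!: derivative_eq_intros simp: field_simps power3_eq_cube)
    show "DERIV (\<lambda>x. - f2 (F x) / (f1 (F x))^3) x :> (3 * (f2 (F x))\<^sup>2 - f1 (F x) * f3 (F x)) / (f1 (F x))^5"
      using n by (auto intro!: derivative_eq_intros) (simp add: field_simps eval_nat_numeral)
    \<comment> \<open>With F'' = - f'' / f'^3 and F''' = (3 f''^2 - f' f''') / f'^5, the f's taken
      at \<open>F x\<close>, the difference F' F''' - 3/2 F''^2 equals - (f' f''' - 3/2 f''^2) /
      f'^6.\<close>
    have "3/2 * (- f2 (F x) / (f1 (F x))^3)\<^sup>2 = (3/2 * (f2 (F x))\<^sup>2) / (f1 (F x))^6"
      by (simp add: power_divide)
    also have "\<dots> \<le> (3 * (f2 (F x))\<^sup>2 - f1 (F x) * f3 (F x)) / (f1 (F x))^6"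
      using S'[OF Fx] by (intro divide_right_mono) auto
    also have "\<dots> = (1 / f1 (F x)) * ((3 * (f2 (F x))\<^sup>2 - f1 (F x) * f3 (F x)) / (f1 (F x))^5)"
      using n by (simp add: field_simps eval_nat_numeral)
    finally show "3/2 * (- f2 (F x) / (f1 (F x))^3)\<^sup>2 \<le>
      (1 / f1 (F x)) * ((3 * (f2 (F x))\<^sup>2 - f1 (F x) * f3 (F x)) / (f1 (F x))^5)" .
  qed
qed

section \<open>Averages, couplings and weak limits\<close>

text \<open>Weights that agree up to a factor \<open>r\<close> give probabilities that agree up to
  \<open>r\<^sup>2\<close>: one factor from the weight, one from the total mass. Changing the
  weights costs (r^2 - 1) B and changing the function costs e. Bounds on \<open>g\<close> are asked
  only where the weight is nonzero, because words leaving the truncated fibre will have weight 0 and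
  \<open>g\<close> is controlled on the fibre only.\<close>

lemma weighted_average_diff:
  fixes p p' g g' :: "'a \<Rightarrow> real"
  assumes V: "finite V" and r: "1 \<le> r" and B: "0 \<le> B"
    and p: "\<And>v. v \<in> V \<Longrightarrow> 0 \<le> p v" "\<And>v. v \<in> V \<Longrightarrow> 0 \<le> p' v"
    and c: "\<And>v. v \<in> V \<Longrightarrow> p v \<le> r * p' v" "\<And>v. v \<in> V \<Longrightarrow> p' v \<le> r * p v"
    and pos: "0 < sum p V" "0 < sum p' V"
    and g: "\<And>v. v \<in> V \<Longrightarrow> p v \<noteq> 0 \<Longrightarrow> \<bar>g v\<bar> \<le> B" "\<And>v. v \<in> V \<Longrightarrow> p v \<noteq> 0 \<Longrightarrow> \<bar>g v - g' v\<bar> \<le> e"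
  shows "\<bar>(\<Sum>v\<in>V. p v * g v) / sum p V - (\<Sum>v\<in>V. p' v * g' v) / sum p' V\<bar> \<le> (r\<^sup>2 - 1) * B + e"
proof -
  define u where "u v = p v / sum p V" for v
  define u' where "u' v = p' v / sum p' V" for v
  have S: "sum p V \<le> r * sum p' V" "sum p' V \<le> r * sum p V"
    using c by (auto simp: sum_distrib_left intro!: sum_mono)
  have u0: "0 \<le> u v" "0 \<le> u' v" if "v \<in> V" for v
    using p that pos by (auto simp: u_def u'_def)
  have u1: "u v \<le> r\<^sup>2 * u' v" "u' v \<le> r\<^sup>2 * u v" if v: "v \<in> V" for v
  proof -
    have "1 / sum p V \<le> r / sum p' V" "1 / sum p' V \<le> r / sum p V"
      using S pos by (simp_all add: divide_simps mult.commute)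
    then have "p v * (1 / sum p V) \<le> (r * p' v) * (r / sum p' V)"
      "p' v * (1 / sum p' V) \<le> (r * p v) * (r / sum p V)"
      by - (rule mult_mono; use c[OF v] p v pos r in simp)+
    then show "u v \<le> r\<^sup>2 * u' v" "u' v \<le> r\<^sup>2 * u v"
      by (simp_all add: u_def u'_def power2_eq_square mult_ac)
  qed
  have r2: "1 \<le> r\<^sup>2" using r by (simp add: one_le_power)
  have diff: "\<bar>u v - u' v\<bar> \<le> (r\<^sup>2 - 1) * u' v" if v: "v \<in> V" for v
  proof -
    have "u' v - u v \<le> (r\<^sup>2 - 1) * u v" using u1(2)[OF v] by (simp add: algebra_simps)
    moreover have "(r\<^sup>2 - 1) * u v \<le> (r\<^sup>2 - 1) * u' v" if "u v \<le> u' v" using r2 that by (intro mult_left_mono) auto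
    moreover have "0 \<le> (r\<^sup>2 - 1) * u' v" using r2 u0 v by auto
    moreover have "u v - u' v \<le> (r\<^sup>2 - 1) * u' v" using u1(1)[OF v] by (simp add: algebra_simps)
    ultimately show ?thesis by linarith
  qed
  have sum1: "sum u V = 1" "sum u' V = 1" using pos by (auto simp: u_def u'_def sum_divide_distrib[symmetric])
  have nz: "p' v \<noteq> 0 \<longleftrightarrow> p v \<noteq> 0" if "v \<in> V" for v
    using c[OF that] p[OF that] by (metis mult_zero_right order_antisym)
  have z: "u v = 0" "u' v = 0" if "v \<in> V" "p v = 0" for v
    using that nz by (auto simp: u_def u'_def)
  have "(\<Sum>v\<in>V. p v * g v) / sum p V - (\<Sum>v\<in>V. p' v * g' v) / sum p' V
      = (\<Sum>v\<in>V. (u v - u' v) * g v + u' v * (g v - g' v))"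
    by (simp add: u_def u'_def sum_divide_distrib sum_subtractf[symmetric])
       (auto intro!: sum.cong simp: algebra_simps diff_divide_distrib)
  also have "\<bar>\<dots>\<bar> \<le> (\<Sum>v\<in>V. \<bar>(u v - u' v) * g v + u' v * (g v - g' v)\<bar>)" by (rule sum_abs)
  also have "\<dots> \<le> (\<Sum>v\<in>V. (r\<^sup>2 - 1) * u' v * B + u' v * e)"
  proof (rule sum_mono)
    fix v assume v: "v \<in> V"
    show "\<bar>(u v - u' v) * g v + u' v * (g v - g' v)\<bar> \<le> (r\<^sup>2 - 1) * u' v * B + u' v * e"
    proof (cases "p v = 0")
      case False
      have "\<bar>u v - u' v\<bar> * \<bar>g v\<bar> \<le> ((r\<^sup>2 - 1) * u' v) * B"
        using diff[OF v] g(1)[OF v False] by (intro mult_mono) auto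
      moreover have "\<bar>u' v\<bar> * \<bar>g v - g' v\<bar> \<le> u' v * e"
        using g(2)[OF v False] u0[OF v] by (auto intro!: mult_mono)
      ultimately show ?thesis unfolding abs_mult[symmetric] by linarith
    qed (use z v in simp)
  qed
  also have "\<dots> = (r\<^sup>2 - 1) * B * sum u' V + e * sum u' V"
    by (simp add: sum.distrib sum_distrib_left sum_distrib_right mult_ac)
  finally show ?thesis by (simp add: sum1)
qed

text \<open>On \<open>E\<close> the two distributions share the mass \<open>c * P' v\<close>. The
  shared part contributes at most \<eta>, the remaining mass, at most 1 - c \<delta> on either side,
  at most hi - lo. This is the contraction of oscillation in Doeblin's method.\<close>

lemma coupling_bound:
  fixes P P' b b' :: "'a \<Rightarrow> real"
  assumes V: "finite V" and P: "\<And>v. v \<in> V \<Longrightarrow> 0 \<le> P v" "\<And>v. v \<in> V \<Longrightarrow> 0 \<le> P' v" "sum P V = 1" "sum P' V = 1"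
    and E: "E \<subseteq> V" "\<And>v. v \<in> E \<Longrightarrow> c * P' v \<le> P v" and c: "0 < c" "c \<le> 1" and \<delta>: "\<delta> \<le> sum P' E"
    and b: "\<And>v. v \<in> V \<Longrightarrow> P v \<noteq> 0 \<Longrightarrow> b v \<le> hi" "\<And>v. v \<in> V \<Longrightarrow> P' v \<noteq> 0 \<Longrightarrow> lo \<le> b' v"
    and \<eta>: "\<And>v. v \<in> E \<Longrightarrow> P' v \<noteq> 0 \<Longrightarrow> b v - b' v \<le> \<eta>" and \<eta>0: "0 \<le> \<eta>" and lohi: "lo \<le> hi"
  shows "(\<Sum>v\<in>V. P v * b v) - (\<Sum>v\<in>V. P' v * b' v) \<le> (1 - c * \<delta>) * (hi - lo) + \<eta>"
proof -
  define \<alpha> where "\<alpha> v = (if v \<in> E then c * P' v else 0)" for v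
  have fE: "finite E" using E(1) V finite_subset by blast
  have a: "0 \<le> \<alpha> v" "\<alpha> v \<le> P v" "\<alpha> v \<le> P' v" if "v \<in> V" for v
    using that P(1,2)[OF that] E(2)[of v] c by (auto simp: \<alpha>_def mult_left_le_one_le)
  have s: "sum \<alpha> V = c * sum P' E"
  proof -
    have "sum \<alpha> V = sum \<alpha> E"
      using E(1) V by (intro sum.mono_neutral_right) (auto simp: \<alpha>_def)
    then show ?thesis by (simp add: \<alpha>_def sum_distrib_left)
  qed
  have s1: "sum \<alpha> V \<le> 1" using sum_mono[of V \<alpha> P] a P(3) by auto
  have 1: "(\<Sum>v\<in>V. (P v - \<alpha> v) * b v) \<le> (\<Sum>v\<in>V. (P v - \<alpha> v) * hi)"
  proof (rule sum_mono)
    fix v assume v: "v \<in> V"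
    show "(P v - \<alpha> v) * b v \<le> (P v - \<alpha> v) * hi"
      using a[OF v] b(1)[OF v] by (cases "P v = 0") (auto intro: mult_left_mono)
  qed
  have 2: "(\<Sum>v\<in>V. (P' v - \<alpha> v) * lo) \<le> (\<Sum>v\<in>V. (P' v - \<alpha> v) * b' v)"
  proof (rule sum_mono)
    fix v assume v: "v \<in> V"
    show "(P' v - \<alpha> v) * lo \<le> (P' v - \<alpha> v) * b' v"
      using a[OF v] b(2)[OF v] by (cases "P' v = 0") (auto intro: mult_left_mono)
  qed
  have 3: "(\<Sum>v\<in>V. \<alpha> v * (b v - b' v)) \<le> (\<Sum>v\<in>V. \<alpha> v * \<eta>)"
  proof (rule sum_mono)
    fix v assume v: "v \<in> V"
    show "\<alpha> v * (b v - b' v) \<le> \<alpha> v * \<eta>"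
    proof (cases "\<alpha> v = 0")
      case False
      then have "v \<in> E" "P' v \<noteq> 0" by (auto simp: \<alpha>_def split: if_splits)
      then show ?thesis using \<eta> a[OF v] by (intro mult_left_mono) auto
    qed simp
  qed
  have "(\<Sum>v\<in>V. P v * b v) - (\<Sum>v\<in>V. P' v * b' v)
    = (\<Sum>v\<in>V. \<alpha> v * (b v - b' v)) + (\<Sum>v\<in>V. (P v - \<alpha> v) * b v) - (\<Sum>v\<in>V. (P' v - \<alpha> v) * b' v)"
    by (simp add: algebra_simps sum.distrib sum_subtractf)
  also have "\<dots> \<le> sum \<alpha> V * \<eta> + (1 - sum \<alpha> V) * hi - (1 - sum \<alpha> V) * lo"
    using 1 2 3 P(3,4) by (simp add: sum_distrib_right[symmetric] sum_subtractf)
  also have "\<dots> = sum \<alpha> V * \<eta> + (1 - sum \<alpha> V) * (hi - lo)" by (simp add: algebra_simps)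
  also have "\<dots> \<le> \<eta> + (1 - c * \<delta>) * (hi - lo)"
  proof (intro add_mono mult_right_mono)
    have "0 \<le> sum \<alpha> V" using a by (intro sum_nonneg) auto
    then show "sum \<alpha> V * \<eta> \<le> \<eta>" using s1 \<eta>0 by (intro mult_left_le_one_le) auto
    show "1 - sum \<alpha> V \<le> 1 - c * \<delta>" using s \<delta> c by auto
  qed (use lohi in auto)
  finally show ?thesis by simp
qed

text \<open>Turns a normalised sum over words into a measure on the line, the image of a probability
  mass function under \<open>X\<close>, so that weak limits can be taken.\<close>

lemma finite_weights_distribution:
  fixes X :: "'a \<Rightarrow> real"
  assumes V: "finite V" and p: "\<And>v. v \<in> V \<Longrightarrow> 0 \<le> p v" "sum p V = 1"
  shows "\<exists>\<mu>. real_distribution \<mu> \<and>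
    (\<forall>f::real \<Rightarrow> real. f \<in> borel_measurable borel \<longrightarrow> integral\<^sup>L \<mu> f = (\<Sum>v\<in>V. p v * f (X v)))"
proof -
  define p' where "p' v = (if v \<in> V then p v else 0)" for v
  have nn: "\<And>v. 0 \<le> p' v" using p by (auto simp: p'_def)
  have "(\<integral>\<^sup>+x. ennreal (p' x) \<partial>count_space UNIV) = (\<Sum>v\<in>V. ennreal (p' v))"
    by (rule nn_integral_count_space'[OF V]) (auto simp: p'_def)
  also have "\<dots> = ennreal (\<Sum>v\<in>V. p' v)" using nn by (simp add: sum_ennreal)
  also have "(\<Sum>v\<in>V. p' v) = 1" using p by (simp add: p'_def)
  finally have pmf: "pmf (embed_pmf p') v = p' v" for v
    using nn by (intro pmf_embed_pmf) auto
  define \<mu> where "\<mu> = distr (measure_pmf (embed_pmf p')) borel X"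
  have "real_distribution \<mu>" unfolding \<mu>_def
    by (intro prob_space.real_distribution_distr measure_pmf.prob_space_axioms) simp
  moreover have "integral\<^sup>L \<mu> f = (\<Sum>v\<in>V. p v * f (X v))" if "f \<in> borel_measurable borel" for f :: "real \<Rightarrow> real"
  proof -
    have "integral\<^sup>L \<mu> f = (\<integral>v. f (X v) \<partial>measure_pmf (embed_pmf p'))"
      unfolding \<mu>_def by (rule integral_distr[OF _ that]) simp
    also have "\<dots> = (\<Sum>v\<in>V. f (X v) * pmf (embed_pmf p') v)"
    proof (rule integral_measure_pmf_real[OF V])
      fix a assume "a \<in> set_pmf (embed_pmf p')"
      then have "p' a \<noteq> 0" by (simp add: set_pmf_iff pmf)
      then show "a \<in> V" by (simp add: p'_def split: if_splits)
    qed
    also have "\<dots> = (\<Sum>v\<in>V. p v * f (X v))" by (intro sum.cong) (simp_all add: pmf p'_def)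
    finally show ?thesis .
  qed
  ultimately show ?thesis by (intro exI[of _ \<mu>] conjI allI impI)
qed

text \<open>Measures living on one bounded set are tight, which gives a convergent subsequence. That
  the limit still lives on S is tested with the bounded continuous function min 1 (dist(x, S)): its
  integrals vanish along the sequence, hence for the limit, and S is closed.\<close>

lemma compact_support_weak_limit:
  fixes \<mu> :: "nat \<Rightarrow> real measure"
  assumes S: "compact S" and \<mu>: "\<And>n. real_distribution (\<mu> n)" "\<And>n. measure (\<mu> n) S = 1"
  shows "\<exists>r \<nu>. strict_mono (r :: nat \<Rightarrow> nat) \<and> real_distribution \<nu> \<and> measure \<nu> S = 1 \<and>
    (\<forall>f::real \<Rightarrow> real. continuous_on UNIV f \<longrightarrow> bounded (range f) \<longrightarrow>
       (\<lambda>n. integral\<^sup>L (\<mu> (r n)) f) \<longlonglongrightarrow> integral\<^sup>L \<nu> f)"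
proof -
  have Sm [measurable]: "S \<in> sets borel" by (rule borel_closed[OF compact_imp_closed[OF S]])
  obtain B where B: "\<forall>x\<in>S. norm x \<le> B"
    using compact_imp_bounded[OF S] unfolding bounded_iff by (rule exE)
  have "tight \<mu>" unfolding tight_def
  proof (intro conjI allI impI)
    show "real_distribution (\<mu> n)" for n by fact
    fix \<epsilon> :: real assume \<epsilon>: "0 < \<epsilon>"
    have "1 - \<epsilon> < measure (\<mu> n) {- \<bar>B\<bar> - 1<..\<bar>B\<bar>}" for n
    proof -
      interpret real_distribution "\<mu> n" by fact
      have "S \<subseteq> {- \<bar>B\<bar> - 1<..\<bar>B\<bar>}" using B by force
      then have "measure (\<mu> n) S \<le> measure (\<mu> n) {- \<bar>B\<bar> - 1<..\<bar>B\<bar>}" by (intro finite_measure_mono) auto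
      then show ?thesis using \<mu>(2)[of n] \<epsilon> by simp
    qed
    then show "\<exists>a b. a < b \<and> (\<forall>n. 1 - \<epsilon> < measure (\<mu> n) {a<..b})"
      by (intro exI[of _ "- \<bar>B\<bar> - 1"] exI[of _ "\<bar>B\<bar>"]) auto
  qed
  then obtain r \<nu> where r: "strict_mono (r :: nat \<Rightarrow> nat) \<and> real_distribution \<nu> \<and> weak_conv_m (\<mu> \<circ> id \<circ> r) \<nu>"
    using tight_imp_convergent_subsubsequence[OF _ strict_mono_id, of \<mu>] by - (elim meta_impE exE, assumption, rule that)
  have conv: "(\<lambda>n. integral\<^sup>L (\<mu> (r n)) f) \<longlonglongrightarrow> integral\<^sup>L \<nu> f"
    if f: "continuous_on UNIV f" "bounded (range f)" for f :: "real \<Rightarrow> real"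
  proof -
    obtain B where "\<And>x. norm (f x) \<le> B" using f(2) by (auto simp: bounded_iff)
    then show ?thesis
      using weak_conv_imp_integral_bdd_continuous_conv[of "\<lambda>n. \<mu> (r n)" \<nu> f B] \<mu>(1) r f(1)
      by (simp add: o_def continuous_on_eq_continuous_at)
  qed
  have "measure \<nu> S = 1"
  proof -
    interpret \<nu>: real_distribution \<nu> using r by simp
    have Sne: "S \<noteq> {}" using \<mu>(2)[of 0] by auto
    define f where "f x = min 1 (infdist x S)" for x :: real
    have fc: "continuous_on UNIV f" unfolding f_def by (intro continuous_intros)
    have f01: "0 \<le> f x" "f x \<le> 1" for x by (auto simp: f_def infdist_nonneg)
    have fb: "bounded (range f)" using f01 by (auto simp: bounded_iff intro!: exI[of _ 1])
    have fm [measurable]: "f \<in> borel_measurable borel" using fc by (rule borel_measurable_continuous_onI)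
    have "integral\<^sup>L (\<mu> n) f = 0" for n
    proof -
      interpret real_distribution "\<mu> n" by fact
      have "AE x in \<mu> n. x \<in> S" using \<mu>(2)[of n] by (intro AE_prob_1) auto
      then have "AE x in \<mu> n. f x = 0" by eventually_elim (simp add: f_def)
      then show ?thesis by (rule integral_eq_zero_AE)
    qed
    then have "(\<lambda>n. 0) \<longlonglongrightarrow> integral\<^sup>L \<nu> f" using conv[OF fc fb] by simp
    then have "integral\<^sup>L \<nu> f = 0" by (simp add: LIMSEQ_const_iff)
    moreover have "integrable \<nu> f"
      using f01 by (intro \<nu>.integrable_const_bound[of _ 1]) (auto simp: abs_le_iff)
    ultimately have "AE x in \<nu>. f x = 0"
      using integral_nonneg_eq_0_iff_AE[of \<nu> f] f01 by auto
    then have "AE x in \<nu>. x \<in> S"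
    proof eventually_elim
      case (elim x)
      then have "infdist x S = 0" by (auto simp: f_def min_def split: if_splits)
      then show "x \<in> S" using in_closed_iff_infdist_zero[OF compact_imp_closed[OF S] Sne] by simp
    qed
    then show ?thesis by (intro \<nu>.prob_eq_1[THEN iffD2]) auto
  qed
  then show ?thesis using r conv by (intro exI[of _ r] exI[of _ \<nu>] conjI allI impI) simp_all
qed

text \<open>This is how multiplicative constants disappear: growth rates compared over n steps with
  a bounded error are compared exactly.\<close>

lemma real_mult_le_imp_le:
  fixes x y c :: real
  assumes "\<And>n. real n * x \<le> real n * y + c"
  shows "x \<le> y"
proof (rule ccontr)
  assume "\<not> x \<le> y"
  then obtain n where "c < real n * (x - y)" using reals_Archimedean3[of "x - y"] by auto
  then show False using assms[of n] by (simp add: algebra_simps)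
qed

section \<open>Inverse branches and truncated fibres\<close>

locale random_cf =
  fixes M :: "'w measure" and \<theta> :: "'w \<Rightarrow> 'w"
    and G GC GE :: "real set set" and \<kappa> A :: real
    and \<gamma> :: "real set \<Rightarrow> nat" and c v :: "real set \<Rightarrow> real"
    and T :: "'w \<Rightarrow> real \<Rightarrow> real"
  assumes rcf: "random_critically_finite M \<theta> G GC GE \<kappa> A \<gamma> c v T"
begin

lemma rcf_conjs:
  "prob_space M" "ergodic_automorphism M \<theta>" "interval_system G" "G = GC \<union> GE" "GC \<inter> GE = {}"
  "1 < \<kappa>" "1 < A" "\<forall>\<omega>\<in>space M. T \<omega> \<in> critically_finite_maps G GC GE \<kappa> A \<gamma> c v"
  "\<forall>x\<in>\<Union>G. (\<lambda>\<omega>. T \<omega> x) \<in> borel_measurable M"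
  using rcf unfolding random_critically_finite_def by - (elim conjE, assumption)+

lemmas prob_space_M = rcf_conjs(1)
lemmas ergodic_\<theta> = rcf_conjs(2)
lemmas G_system = rcf_conjs(3)
lemmas G_split = rcf_conjs(4,5)
lemmas \<kappa>_gt = rcf_conjs(6)
lemmas A_gt = rcf_conjs(7)
lemmas T_class = rcf_conjs(8)[THEN bspec]
lemmas T_measurable = rcf_conjs(9)[THEN bspec]
lemma A_pos: "0 < A" using A_gt by simp

lemma \<theta>_measurable [measurable]: "\<theta> \<in> measurable M M"
  using ergodic_\<theta> unfolding ergodic_automorphism_def by (elim conjE)

lemma distr_\<theta>: "distr M M \<theta> = M"
  using ergodic_\<theta> unfolding ergodic_automorphism_def by (elim conjE)

lemma \<theta>_in [simp]: "\<omega> \<in> space M \<Longrightarrow> \<theta> \<omega> \<in> space M"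
  using \<theta>_measurable by (rule measurable_space)

lemma \<theta>n_in [simp]: "\<omega> \<in> space M \<Longrightarrow> (\<theta> ^^ n) \<omega> \<in> space M"
  by (induction n) auto

lemma \<theta>_shift: "(\<theta> ^^ n) (\<theta> \<omega>) = (\<theta> ^^ Suc n) \<omega>"
  by (simp add: funpow_swap1)

section \<open>Geometry of the interval system\<close>

lemma finite_G: "finite G"
  using G_system unfolding interval_system_def by (elim conjE)

lemma G_interval: "D \<in> G \<Longrightarrow> \<exists>a b. 0 \<le> a \<and> a < b \<and> b \<le> 1 \<and> D = {a..b}"
  using G_system unfolding interval_system_def by (elim conjE) (erule (1) bspec)

lemma G_separated:
  assumes "{a..b} \<in> G" "{a'..b'} \<in> G" "{a..b} \<noteq> {a'..b'}"
  shows "b \<le> a' \<or> b' \<le> a"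
proof (rule ccontr)
  assume *: "\<not> ?thesis"
  have ne: "l < r" if lr: "{l..r} \<in> G" for l r :: real
  proof -
    obtain l' r' where "l' < r'" "{l..r} = {l'..r'}" using G_interval[OF lr] by blast
    then show ?thesis by (simp add: Icc_eq_Icc)
  qed
  have "a < b" "a' < b'" using assms by (simp_all add: ne)
  then have "max a a' < min b b'" using * by auto
  then obtain z where "max a a' < z" "z < min b b'" using dense by blast
  then have "z \<in> {a<..<b} \<inter> {a'<..<b'}" by simp
  moreover have "interior {a..b} \<inter> interior {a'..b'} = {}"
  proof -
    have "\<forall>D\<in>G. \<forall>E\<in>G. D \<noteq> E \<longrightarrow> interior D \<inter> interior E = {}"
      using G_system unfolding interval_system_def by (elim conjE)
    from bspec[OF bspec[OF this assms(1)] assms(2)] assms(3) show ?thesis by (rule mp)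
  qed
  ultimately show False by (auto simp: interior_atLeastAtMost_real)
qed

lemma G_eqI:
  assumes "{a..b} \<in> G" "D \<in> G" "x \<in> {a<..<b}" "x \<in> D"
  shows "D = {a..b}"
proof (rule ccontr)
  assume "D \<noteq> {a..b}"
  moreover obtain a' b' where "a' < b'" "D = {a'..b'}" using G_interval[OF assms(2)] by blast
  ultimately show False using G_separated[of a b a' b'] assms by auto
qed

lemma Delta_ex:
  "\<exists>\<alpha> \<beta>. 0 < \<beta> \<and> \<beta> \<le> \<alpha> \<and> \<alpha> < 1 \<and> Delta0 G = {0..\<beta>} \<and> Delta1 G = {\<alpha>..1} \<and> Delta0 G \<in> G \<and> Delta1 G \<in> G"
proof -
  obtain D E where DE: "D \<in> G" "E \<in> G" "0 \<in> D" "1 \<in> E" "D \<noteq> E"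
  proof -
    have "\<exists>D\<in>G. \<exists>E\<in>G. 0 \<in> D \<and> 1 \<in> E \<and> D \<noteq> E"
      using G_system unfolding interval_system_def by (elim conjE)
    then show ?thesis using that by (elim bexE conjE)
  qed
  obtain a \<beta> where D: "0 \<le> a" "a < \<beta>" "\<beta> \<le> 1" "D = {a..\<beta>}" using G_interval[OF DE(1)] by blast
  obtain \<alpha> b where E: "0 \<le> \<alpha>" "\<alpha> < b" "b \<le> 1" "E = {\<alpha>..b}" using G_interval[OF DE(2)] by blast
  have a: "a = 0" and b: "b = 1" using D E DE by auto
  have \<beta>\<alpha>: "\<beta> \<le> \<alpha>" using G_separated[of a \<beta> \<alpha> b] DE D E a b by auto
  have D_unique: "D' = D" if D': "D' \<in> G" "0 \<in> D'" for D'
  proof (rule ccontr)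
    assume ne: "D' \<noteq> D"
    obtain a' b' where 1: "0 \<le> a'" "a' < b'" "D' = {a'..b'}" using G_interval[OF D'(1)] by blast
    have "b' \<le> a \<or> \<beta> \<le> a'"
      by (rule G_separated[OF D'(1)[unfolded 1(3)] DE(1)[unfolded D(4)] ne[unfolded 1(3) D(4)]])
    then show False using 1 D'(2) D(1,2) a by auto
  qed
  have "Delta0 G = D" unfolding Delta0_def
    by (rule the_equality, rule conjI[OF DE(1,3)], elim conjE, rule D_unique)
  moreover have E_unique: "E' = E" if E': "E' \<in> G" "1 \<in> E'" for E'
  proof (rule ccontr)
    assume ne: "E' \<noteq> E"
    obtain a' b' where 1: "a' < b'" "b' \<le> 1" "E' = {a'..b'}" using G_interval[OF E'(1)] by blast
    have "b' \<le> \<alpha> \<or> b \<le> a'"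
      by (rule G_separated[OF E'(1)[unfolded 1(3)] DE(2)[unfolded E(4)] ne[unfolded 1(3) E(4)]])
    then show False using 1 E'(2) E(2,3) b by auto
  qed
  have "Delta1 G = E" unfolding Delta1_def
    by (rule the_equality, rule conjI[OF DE(2,4)], elim conjE, rule E_unique)
  ultimately show ?thesis
    by (intro exI[of _ \<alpha>] exI[of _ \<beta>]) (use D E \<beta>\<alpha> a b DE(1,2) in simp)
qed

abbreviation "D0 \<equiv> Delta0 G"
abbreviation "D1 \<equiv> Delta1 G"

text \<open>The inner endpoint of the interval at 0, as \<alpha> is for the interval at 1. The other
  elements of \<open>G\<close> lie between \<beta> and \<alpha>; the two may coincide.\<close>

definition "\<beta> = Sup D0"
definition "\<alpha> = Inf D1"

lemma \<alpha>\<beta>: "0 < \<beta>" "\<beta> \<le> \<alpha>" "\<alpha> < 1" "D0 = {0..\<beta>}" "D1 = {\<alpha>..1}" "D0 \<in> G" "D1 \<in> G"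
proof -
  obtain a b where ab: "0 < b" "b \<le> a" "a < 1" "D0 = {0..b}" "D1 = {a..1}" "D0 \<in> G" "D1 \<in> G"
    using Delta_ex by blast
  then have "\<beta> = b" "\<alpha> = a" by (simp_all add: \<alpha>_def \<beta>_def)
  with ab show "0 < \<beta>" "\<beta> \<le> \<alpha>" "\<alpha> < 1" "D0 = {0..\<beta>}" "D1 = {\<alpha>..1}" "D0 \<in> G" "D1 \<in> G" by simp_all
qed

lemma D01_ne: "D0 \<noteq> D1"
proof -
  have "0 \<in> D0" "0 \<notin> D1" using \<alpha>\<beta>(1,2,4,5) by auto
  then show ?thesis by blast
qed

lemma G_ge_\<beta>:
  assumes "a \<in> G" "a \<noteq> D0" "x \<in> a" shows "\<beta> \<le> x"
proof -
  obtain l r where lr: "0 \<le> l" "l < r" "a = {l..r}" using G_interval[OF assms(1)] by blast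
  have "\<beta> \<le> l \<or> r \<le> 0" 
    by (rule G_separated[OF \<alpha>\<beta>(6)[unfolded \<alpha>\<beta>(4)] assms(1)[unfolded lr(3)] not_sym[OF assms(2)[unfolded lr(3) \<alpha>\<beta>(4)]]])
  then show ?thesis using lr assms(3) by auto
qed

lemma G_le_\<alpha>:
  assumes "a \<in> G" "a \<noteq> D1" "x \<in> a" shows "x \<le> \<alpha>"
proof -
  obtain l r where lr: "l < r" "r \<le> 1" "a = {l..r}" using G_interval[OF assms(1)] by blast
  have "1 \<le> l \<or> r \<le> \<alpha>" 
    by (rule G_separated[OF \<alpha>\<beta>(7)[unfolded \<alpha>\<beta>(5)] assms(1)[unfolded lr(3)] not_sym[OF assms(2)[unfolded lr(3) \<alpha>\<beta>(5)]]])
  then show ?thesis using lr assms(3) by auto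
qed

section \<open>Inverse branches of a single map\<close>

definition F :: "'w \<Rightarrow> real set \<Rightarrow> real \<Rightarrow> real" where
  "F \<omega> a = inv_into a (T \<omega>)"

text \<open>Meaningful on the open unit interval. Over 0 or 1 the branch may end in a critical
  point, and then division by zero gives the value 0.\<close>

definition F1 :: "'w \<Rightarrow> real set \<Rightarrow> real \<Rightarrow> real" where
  "F1 \<omega> a x = 1 / deriv_within a (T \<omega>) (F \<omega> a x)"

lemma T_branch:
  assumes "\<omega> \<in> space M" "D \<in> G"
  shows "Cn_on 3 D (T \<omega>)" "inj_on (T \<omega>) D" "T \<omega> ` D = {0..1}"
    "x \<in> D \<Longrightarrow> deriv_within D (T \<omega>) x \<noteq> 0 \<Longrightarrow> schwarzian D (T \<omega>) x < 0"
    "x \<in> interior D \<Longrightarrow> deriv_within D (T \<omega>) x \<noteq> 0"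
    "x \<in> D \<Longrightarrow> \<bar>deriv_within D (T \<omega>) x\<bar> \<le> A"
    "continuous_on (\<Union>G) (T \<omega>)" "T \<omega> 0 = 0" "T \<omega> 1 = 0" "\<kappa> \<le> deriv_within D0 (T \<omega>) 0"
proof -
  note T = T_class[OF assms(1), unfolded critically_finite_maps_def mem_Collect_eq]
  have 1: "\<forall>D\<in>G. Cn_on 3 D (T \<omega>) \<and> inj_on (T \<omega>) D \<and> T \<omega> ` D = {0..1} \<and>
        (\<forall>x\<in>D. deriv_within D (T \<omega>) x \<noteq> 0 \<longrightarrow> schwarzian D (T \<omega>) x < 0)"
    and 2: "\<forall>D\<in>G. \<forall>x\<in>D. \<bar>deriv_within D (T \<omega>) x\<bar> \<le> A"
    and 3: "\<forall>D\<in>GC. c D \<in> frontier D \<and> (\<forall>x\<in>D. deriv_within D (T \<omega>) x = 0 \<longleftrightarrow> x = c D)"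
    and 4: "\<forall>D\<in>GE. \<forall>x\<in>D. \<kappa> \<le> \<bar>deriv_within D (T \<omega>) x\<bar>"
    using T by - (elim conjE, assumption)+
  show "Cn_on 3 D (T \<omega>)" "inj_on (T \<omega>) D" "T \<omega> ` D = {0..1}"
    using bspec[OF 1 assms(2)] by simp_all
  show "x \<in> D \<Longrightarrow> deriv_within D (T \<omega>) x \<noteq> 0 \<Longrightarrow> schwarzian D (T \<omega>) x < 0"
    using bspec[OF 1 assms(2)] by simp
  show "x \<in> D \<Longrightarrow> \<bar>deriv_within D (T \<omega>) x\<bar> \<le> A" using 2 assms(2) by simp
  show "continuous_on (\<Union>G) (T \<omega>)" "T \<omega> 0 = 0" "T \<omega> 1 = 0" "\<kappa> \<le> deriv_within D0 (T \<omega>) 0"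
    using T by - (elim conjE, assumption)+
  assume x: "x \<in> interior D"
  then have xD: "x \<in> D" using interior_subset by blast
  consider "D \<in> GC" | "D \<in> GE" using assms(2) G_split by blast
  then show "deriv_within D (T \<omega>) x \<noteq> 0"
  proof cases
    case 1
    then have "c D \<in> frontier D" "deriv_within D (T \<omega>) x = 0 \<longleftrightarrow> x = c D"
      using conjunct1[OF bspec[OF 3 1]] bspec[OF conjunct2[OF bspec[OF 3 1]] xD] by auto
    then show ?thesis using x by (auto simp: frontier_def)
  next
    case 2
    have "\<kappa> \<le> \<bar>deriv_within D (T \<omega>) x\<bar>" using bspec[OF bspec[OF 4 2] xD] .
    then show ?thesis using \<kappa>_gt by auto
  qed
qed

lemma F_branch:
  assumes \<omega>: "\<omega> \<in> space M" and a: "a \<in> G"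
  shows F_cont: "continuous_on {0..1} (F \<omega> a)" and F_img: "F \<omega> a ` {0..1} = a"
    and T_F: "x \<in> {0..1} \<Longrightarrow> T \<omega> (F \<omega> a x) = x"
    and F_T: "x \<in> a \<Longrightarrow> F \<omega> a (T \<omega> x) = x"
    and F_int: "x \<in> {0<..<1} \<Longrightarrow> F \<omega> a x \<in> interior a"
    and F_schw: "expanding_schwarz (F \<omega> a) (F1 \<omega> a)"
proof -
  obtain l r where lr: "0 \<le> l" "l < r" "r \<le> 1" "a = {l..r}" using G_interval[OF a] by blast
  note T = T_branch[OF \<omega> a, unfolded lr(4)]
  note * = full_branch_inverse[OF lr(2) T(1,2,3,4) T(5)[unfolded interior_atLeastAtMost_real] lr(1,3), folded lr(4) F_def F1_def]
  show "continuous_on {0..1} (F \<omega> a)" "F \<omega> a ` {0..1} = a"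
    "x \<in> {0..1} \<Longrightarrow> T \<omega> (F \<omega> a x) = x" "x \<in> a \<Longrightarrow> F \<omega> a (T \<omega> x) = x"
    "x \<in> {0<..<1} \<Longrightarrow> F \<omega> a x \<in> interior a"
    using *(1-5) lr by (auto simp: interior_atLeastAtMost_real)
  show "expanding_schwarz (F \<omega> a) (F1 \<omega> a)"
    using *(6) unfolding F1_def[abs_def] .
qed

lemma G_sub: "a \<in> G \<Longrightarrow> a \<subseteq> {0..1}"
  using G_interval by fastforce

lemma F_mem: "\<lbrakk>\<omega> \<in> space M; a \<in> G; x \<in> {0..1}\<rbrakk> \<Longrightarrow> F \<omega> a x \<in> a"
  using F_img by blast

lemma F_mem01: "\<lbrakk>\<omega> \<in> space M; a \<in> G; x \<in> {0..1}\<rbrakk> \<Longrightarrow> F \<omega> a x \<in> {0..1}"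
  using F_mem G_sub by blast

lemma F_deriv: "\<lbrakk>\<omega> \<in> space M; a \<in> G; x \<in> {0<..<1}\<rbrakk> \<Longrightarrow> DERIV (F \<omega> a) x :> F1 \<omega> a x"
  using F_schw unfolding expanding_schwarz_def by blast

lemma F1_ge:
  assumes "\<omega> \<in> space M" "a \<in> G" "x \<in> {0<..<1}"
  shows "1 / A \<le> \<bar>F1 \<omega> a x\<bar>"
proof -
  have i: "F \<omega> a x \<in> interior a" using F_int assms by blast
  then have "F \<omega> a x \<in> a" using interior_subset by blast
  then have "\<bar>deriv_within a (T \<omega>) (F \<omega> a x)\<bar> \<le> A" "deriv_within a (T \<omega>) (F \<omega> a x) \<noteq> 0"
    using T_branch(5,6) assms i by blast+
  then show ?thesis unfolding F1_def using A_pos by (simp add: abs_divide frac_le)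
qed

lemma F_expand:
  assumes "\<omega> \<in> space M" "a \<in> G" "x \<in> {0..1}" "y \<in> {0..1}"
  shows "\<bar>x - y\<bar> / A \<le> \<bar>F \<omega> a x - F \<omega> a y\<bar>"
proof -
  have *: "\<bar>x - y\<bar> / A \<le> \<bar>F \<omega> a x - F \<omega> a y\<bar>" if "x \<in> {0..1}" "y \<in> {0..1}" "x < y" for x y
  proof -
    obtain z where z: "z \<in> {x<..<y}" "F \<omega> a y - F \<omega> a x = (y - x) * F1 \<omega> a z"
      using mvt_01[OF F_cont F_deriv, of \<omega> a x y] assms \<open>x \<in> {0..1}\<close> \<open>y \<in> {0..1}\<close> \<open>x < y\<close> by auto
    have "1 / A \<le> \<bar>F1 \<omega> a z\<bar>" using F1_ge[OF assms(1,2), of z] z that by auto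
    then have "(y - x) * (1 / A) \<le> (y - x) * \<bar>F1 \<omega> a z\<bar>" using that by (intro mult_left_mono) auto
    then show ?thesis using z that by (simp add: abs_mult abs_minus_commute)
  qed
  show ?thesis
    using *[of x y] *[of y x] assms by (cases x y rule: linorder_cases) (auto simp: abs_minus_commute)
qed

text \<open>Since T fixes 0, the branch on \<open>D0\<close> has the increasing one of the two
  possible orientations.\<close>

lemma F0_mono:
  assumes \<omega>: "\<omega> \<in> space M" and xy: "x \<in> {0..1}" "y \<in> {0..1}"
  shows "F \<omega> D0 x \<le> F \<omega> D0 y \<longleftrightarrow> x \<le> y" "F \<omega> D0 0 = 0" "F \<omega> D0 1 = \<beta>"
proof -
  note T = T_branch[OF \<omega> \<alpha>\<beta>(6)]
  have "continuous_on {0..\<beta>} (T \<omega>)" using full_branch_continuous[OF T(1)] by (simp add: \<alpha>\<beta>(4))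
  then have m: "strict_mono_on {0..\<beta>} (T \<omega>)" "T \<omega> \<beta> = 1"
    using full_branch_monotone[of 0 \<beta> "T \<omega>"] T \<alpha>\<beta>(1,4) by auto
  show "F \<omega> D0 x \<le> F \<omega> D0 y \<longleftrightarrow> x \<le> y"
    using strict_mono_on_less_eq[OF m(1), of "F \<omega> D0 x" "F \<omega> D0 y"]
      F_mem[OF \<omega> \<alpha>\<beta>(6) xy(1)] F_mem[OF \<omega> \<alpha>\<beta>(6) xy(2)] xy T_F[OF \<omega> \<alpha>\<beta>(6)]
    by (simp add: \<alpha>\<beta>(4))
  show "F \<omega> D0 0 = 0" "F \<omega> D0 1 = \<beta>"
    using F_T[OF \<omega> \<alpha>\<beta>(6), of 0] F_T[OF \<omega> \<alpha>\<beta>(6), of \<beta>] m T \<alpha>\<beta>(1,4) by auto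
qed

lemma F1_at_0: "\<omega> \<in> space M \<Longrightarrow> F \<omega> D1 0 = 1"
  using F_T[of \<omega> D1 1] T_branch(9)[of \<omega> D1] \<alpha>\<beta> by auto

lemma F0_ge: "\<omega> \<in> space M \<Longrightarrow> x \<in> {0..1} \<Longrightarrow> x / A \<le> F \<omega> D0 x"
  using F_expand[of \<omega> D0 x 0] F0_mono[of \<omega> x 0] F_mem01[of \<omega> D0 x] \<alpha>\<beta> by auto

text \<open>The branch into \<open>D1\<close> sends 0 to 1, and \<bar>T'\<bar> \<le> A keeps the
  image of x at distance at least x / A from 1. For x = 1 this says that \<open>D1\<close> has
  length at least 1 / A, which covers the other branches, as these end left of \<alpha>.\<close>

lemma F_le:
  assumes "\<omega> \<in> space M" "a \<in> G" "x \<in> {0..1}"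
  shows "F \<omega> a x \<le> 1 - x / A"
proof (cases "a = D1")
  case True
  then show ?thesis using F_expand[of \<omega> D1 x 0] F1_at_0 F_mem01[OF assms] assms by auto
next
  case False
  have "1 / A \<le> \<bar>F \<omega> D1 1 - 1\<bar>" using F_expand[of \<omega> D1 1 0] F1_at_0 assms \<alpha>\<beta> by auto
  moreover have "F \<omega> D1 1 \<in> {\<alpha>..1}" using F_mem[of \<omega> D1 1] assms \<alpha>\<beta> by auto
  ultimately have "1 / A \<le> 1 - \<alpha>" by auto
  moreover have "F \<omega> a x \<le> \<alpha>" using G_le_\<alpha> F_mem False assms by blast
  moreover have "x / A \<le> 1 / A" using assms A_pos by (intro divide_right_mono) auto
  ultimately show ?thesis by linarith
qed

section \<open>Inverse branches along words\<close>

text \<open>The first letter belongs to the map at \<omega> and is applied last; the letter in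
  position i, counted from 0, belongs to \<open>(\<theta> ^^ i) \<omega>\<close>. Appending letters
  at the end moves the base point further along the orbit.\<close>

primrec Fw :: "real set list \<Rightarrow> 'w \<Rightarrow> real \<Rightarrow> real" where
  "Fw [] = (\<lambda>\<omega> x. x)"
| "Fw (a # w) = (\<lambda>\<omega> x. F \<omega> a (Fw w (\<theta> \<omega>) x))"

primrec Dw :: "real set list \<Rightarrow> 'w \<Rightarrow> real \<Rightarrow> real" where
  "Dw [] = (\<lambda>\<omega> x. 1)"
| "Dw (a # w) = (\<lambda>\<omega> x. F1 \<omega> a (Fw w (\<theta> \<omega>) x) * Dw w (\<theta> \<omega>) x)"

lemma Fw_append: "Fw (w @ u) \<omega> x = Fw w \<omega> (Fw u ((\<theta> ^^ length w) \<omega>) x)"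
  by (induction w arbitrary: \<omega>) (auto simp: \<theta>_shift simp del: funpow.simps)

lemma Dw_append: "Dw (w @ u) \<omega> x = Dw w \<omega> (Fw u ((\<theta> ^^ length w) \<omega>) x) * Dw u ((\<theta> ^^ length w) \<omega>) x"
  by (induction w arbitrary: \<omega>) (auto simp: \<theta>_shift Fw_append simp del: funpow.simps)

lemma Fw_mem01: "\<lbrakk>\<omega> \<in> space M; set w \<subseteq> G; x \<in> {0..1}\<rbrakk> \<Longrightarrow> Fw w \<omega> x \<in> {0..1}"
  by (induction w arbitrary: \<omega>) (simp_all add: F_mem01 del: atLeastAtMost_iff)

lemma Fw_cont: "\<lbrakk>\<omega> \<in> space M; set w \<subseteq> G\<rbrakk> \<Longrightarrow> continuous_on {0..1} (Fw w \<omega>)"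
proof (induction w arbitrary: \<omega>)
  case (Cons a w)
  have "continuous_on {0..1} (Fw w (\<theta> \<omega>))" using Cons by simp
  moreover have "Fw w (\<theta> \<omega>) ` {0..1} \<subseteq> {0..1}" using Fw_mem01[of "\<theta> \<omega>" w] Cons.prems by auto
  ultimately show ?case using F_cont[of \<omega> a] Cons.prems by (auto intro: continuous_on_compose2)
qed auto

lemma Fw_schw: "\<lbrakk>\<omega> \<in> space M; set w \<subseteq> G\<rbrakk> \<Longrightarrow> expanding_schwarz (Fw w \<omega>) (Dw w \<omega>)"
proof (induction w arbitrary: \<omega>)
  case (Cons a w)
  then have "expanding_schwarz (Fw w (\<theta> \<omega>)) (Dw w (\<theta> \<omega>))" by simp
  then show ?case using expanding_schwarz_compose[OF F_schw] Cons.prems by simp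
qed (simp add: expanding_schwarz_ident)

lemma Fw_inner: "\<lbrakk>\<omega> \<in> space M; set w \<subseteq> G; x \<in> {0<..<1}\<rbrakk> \<Longrightarrow> Fw w \<omega> x \<in> {0<..<1}"
  using Fw_schw unfolding expanding_schwarz_def by blast

lemma Fw_deriv: "\<lbrakk>\<omega> \<in> space M; set w \<subseteq> G; x \<in> {0<..<1}\<rbrakk> \<Longrightarrow> DERIV (Fw w \<omega>) x :> Dw w \<omega> x"
  using Fw_schw unfolding expanding_schwarz_def by blast

lemma Dw_ge:
  "\<lbrakk>\<omega> \<in> space M; set w \<subseteq> G; x \<in> {0<..<1}\<rbrakk> \<Longrightarrow> (1 / A) ^ length w \<le> \<bar>Dw w \<omega> x\<bar>"
proof (induction w arbitrary: \<omega>)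
  case (Cons a w)
  then have "(1 / A) ^ length w \<le> \<bar>Dw w (\<theta> \<omega>) x\<bar>" by simp
  moreover have "1 / A \<le> \<bar>F1 \<omega> a (Fw w (\<theta> \<omega>) x)\<bar>"
    using Cons.prems Fw_inner[of "\<theta> \<omega>" w x] by (intro F1_ge) auto
  ultimately have "1 / A * (1 / A) ^ length w \<le> \<bar>F1 \<omega> a (Fw w (\<theta> \<omega>) x)\<bar> * \<bar>Dw w (\<theta> \<omega>) x\<bar>"
    using A_pos by (intro mult_mono) auto
  then show ?case by (simp add: abs_mult)
qed auto

lemma Dw_pos: "\<lbrakk>\<omega> \<in> space M; set w \<subseteq> G; x \<in> {0<..<1}\<rbrakk> \<Longrightarrow> 0 < \<bar>Dw w \<omega> x\<bar>"
  using Dw_ge[of \<omega> w x] A_pos by (smt (verit) zero_less_divide_1_iff zero_less_power)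

lemma iter_Fw:
  "\<lbrakk>\<omega> \<in> space M; set w \<subseteq> G; x \<in> {0..1}\<rbrakk> \<Longrightarrow> random_iter \<theta> T (length w) \<omega> (Fw w \<omega> x) = x"
proof (induction w arbitrary: x rule: rev_induct)
  case (snoc a w)
  have "F ((\<theta> ^^ length w) \<omega>) a x \<in> {0..1}" using snoc.prems by (intro F_mem01) auto
  then have "random_iter \<theta> T (length w) \<omega> (Fw (w @ [a]) \<omega> x) = F ((\<theta> ^^ length w) \<omega>) a x"
    using snoc by (simp add: Fw_append del: atLeastAtMost_iff)
  then show ?case using snoc.prems by (simp add: T_F del: atLeastAtMost_iff)
qed auto

lemma Fw_monotone:
  assumes "\<omega> \<in> space M" "set w \<subseteq> G"
  shows "mono_on {0..1} (Fw w \<omega>) \<or> antimono_on {0..1} (Fw w \<omega>)"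
proof -
  have "inj_on (Fw w \<omega>) {0..1}"
    by (rule inj_on_inverseI[where g="random_iter \<theta> T (length w) \<omega>"]) (use assms iter_Fw in blast)
  then have "strict_mono_on {0..1} (Fw w \<omega>) \<or> strict_antimono_on {0..1} (Fw w \<omega>)"
    using injective_eq_monotone_map[of "{0..1}" "Fw w \<omega>"] Fw_cont[OF assms] by (simp add: is_interval_cc)
  then show ?thesis by (auto simp: strict_antimono_iff_antimono intro: strict_mono_on_imp_mono_on)
qed

text \<open>Provides the hypothesis \<open>mono\<close> of
  \<open>expanding_schwarz_middle_le\<close>: a monotone map sends [0, \<tau>] and [\<tau>, 1] to
  ranges that do not overlap.\<close>

lemma Fw_diam:
  assumes "\<omega> \<in> space M" "set w \<subseteq> G" and \<tau>: "0 \<le> \<tau>" and xy: "x \<in> {\<tau>..1}" "y \<in> {\<tau>..1}"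
  shows "\<bar>Fw w \<omega> x - Fw w \<omega> y\<bar> + \<bar>Fw w \<omega> \<tau> - Fw w \<omega> 0\<bar> \<le> \<bar>Fw w \<omega> 1 - Fw w \<omega> 0\<bar>"
proof -
  from Fw_monotone[OF assms(1,2)] show ?thesis
  proof
    assume "mono_on {0..1} (Fw w \<omega>)"
    then have m: "Fw w \<omega> x \<le> Fw w \<omega> y" if "0 \<le> x" "x \<le> y" "y \<le> 1" for x y
      by (rule monotone_onD) (use that in simp_all)
    show ?thesis using m[of 0 \<tau>] m[of \<tau> x] m[of \<tau> y] m[of x 1] m[of y 1] \<tau> xy by auto
  next
    assume "antimono_on {0..1} (Fw w \<omega>)"
    then have m: "Fw w \<omega> y \<le> Fw w \<omega> x" if "0 \<le> x" "x \<le> y" "y \<le> 1" for x y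
      by (rule monotone_onD) (use that in simp_all)
    show ?thesis using m[of 0 \<tau>] m[of \<tau> x] m[of \<tau> y] m[of x 1] m[of y 1] \<tau> xy by auto
  qed
qed

lemma Fw_diff_le:
  assumes "\<omega> \<in> space M" "set w \<subseteq> G" "x \<in> {0..1}" "y \<in> {0..1}"
  shows "\<bar>Fw w \<omega> x - Fw w \<omega> y\<bar> \<le> \<bar>Fw w \<omega> 1 - Fw w \<omega> 0\<bar>"
  using Fw_diam[of \<omega> w 0 x y] assms by auto

lemma Fw_middle:
  assumes "\<omega> \<in> space M" "set w \<subseteq> G" "0 < \<tau>" "x \<in> {\<tau>..1-\<tau>}" "y \<in> {\<tau>..1-\<tau>}"
  shows "\<bar>Fw w \<omega> x - Fw w \<omega> y\<bar> * (1 + \<tau>^3) \<le> \<bar>Fw w \<omega> 1 - Fw w \<omega> 0\<bar>"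
  using assms Fw_diam[of \<omega> w \<tau> x y]
  by (intro expanding_schwarz_middle_le[OF Fw_schw[OF assms(1,2)] Fw_cont[OF assms(1,2)]]) auto

section \<open>Truncation levels and admissible words\<close>

definition q :: "nat \<Rightarrow> 'w \<Rightarrow> real" where
  "q k \<omega> = inverse_branch0 G \<theta> T k \<omega> 1"

lemma q_0 [simp]: "q 0 \<omega> = 1" and q_Suc: "q (Suc k) \<omega> = F \<omega> D0 (q k (\<theta> \<omega>))"
  by (simp_all add: q_def F_def)

lemma q_bounds: "\<omega> \<in> space M \<Longrightarrow> (1 / A) ^ k \<le> q k \<omega> \<and> q k \<omega> \<in> {0..1}"
proof (induction k arbitrary: \<omega>)
  case (Suc k)
  then have *: "(1 / A) ^ k \<le> q k (\<theta> \<omega>)" "q k (\<theta> \<omega>) \<in> {0..1}" by auto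
  then have "(1 / A) ^ k / A \<le> q k (\<theta> \<omega>) / A" using A_pos by (intro divide_right_mono) auto
  also have "\<dots> \<le> q (Suc k) \<omega>" using F0_ge[OF Suc.prems *(2)] by (simp add: q_Suc)
  finally show ?case using F_mem01[OF Suc.prems _ *(2)] \<alpha>\<beta> by (simp add: q_Suc mult.commute)
qed auto

lemma q_le_\<beta>: "\<omega> \<in> space M \<Longrightarrow> 0 < k \<Longrightarrow> q k \<omega> \<le> \<beta>"
  using F_mem[of \<omega> D0 "q (k - 1) (\<theta> \<omega>)"] q_bounds[of "\<theta> \<omega>" "k - 1"] q_Suc[of "k - 1" \<omega>] \<alpha>\<beta> by auto

text \<open>Whether \<open>Fw w \<omega> y\<close> lies above \<open>q j \<omega>\<close> is decided by the number of leading letters \<open>D0\<close> of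
  \<open>w\<close>, unless \<open>w\<close> consists of fewer than \<open>j\<close> letters, all equal to \<open>D0\<close>.\<close>

lemma dominance:
  assumes "\<omega> \<in> space M" "set w \<subseteq> G" "y \<in> {0<..<1}" "y' \<in> {0..1}"
    "q j \<omega> \<le> Fw w \<omega> y" "j \<le> length w \<or> \<beta> \<le> y'"
  shows "q j \<omega> \<le> Fw w \<omega> y'"
  using assms
proof (induction w arbitrary: \<omega> j)
  case Nil
  then have "0 < j" by (cases j) auto
  then show ?case using Nil q_le_\<beta>[of \<omega> j] by auto
next
  case (Cons a w)
  have "Fw (a # w) \<omega> y \<in> {0<..<1}" using Cons.prems by (intro Fw_inner) auto
  then obtain i where j: "j = Suc i" using Cons.prems(5) by (cases j) auto
  have in01: "Fw w (\<theta> \<omega>) y \<in> {0..1}" "Fw w (\<theta> \<omega>) y' \<in> {0..1}" "q i (\<theta> \<omega>) \<in> {0..1}"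
    using Fw_mem01[of "\<theta> \<omega>" w] Cons.prems(1-4) q_bounds by auto
  show ?case
  proof (cases "a = D0")
    case True
    have "q i (\<theta> \<omega>) \<le> Fw w (\<theta> \<omega>) y"
      using Cons.prems(5) F0_mono(1)[OF Cons.prems(1) in01(3,1)] by (simp add: j q_Suc True)
    then have "q i (\<theta> \<omega>) \<le> Fw w (\<theta> \<omega>) y'" using Cons.IH[of "\<theta> \<omega>" i] Cons.prems j by auto
    then show ?thesis using F0_mono(1)[OF Cons.prems(1) in01(3,2)] by (simp add: j q_Suc True)
  next
    case False
    have "F \<omega> a (Fw w (\<theta> \<omega>) y') \<in> a" using Cons.prems in01 by (intro F_mem) auto
    then have "\<beta> \<le> F \<omega> a (Fw w (\<theta> \<omega>) y')" using G_ge_\<beta> False Cons.prems by auto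
    then show ?thesis using q_le_\<beta>[OF Cons.prems(1), of j] j by auto
  qed
qed

abbreviation "J k \<omega> \<equiv> trunc_julia G \<theta> T k \<omega>"

lemma random_iter_Suc: "random_iter \<theta> T (Suc n) \<omega> x = random_iter \<theta> T n (\<theta> \<omega>) (T \<omega> x)"
  by (induction n) (simp_all add: funpow_swap1)

lemma J_iff: "x \<in> J k \<omega> \<longleftrightarrow> x \<in> \<Union>G \<and> q k \<omega> \<le> x \<and> x \<le> 1 \<and> T \<omega> x \<in> J k (\<theta> \<omega>)"
proof -
  have *: "(\<forall>n. P n) \<longleftrightarrow> P 0 \<and> (\<forall>n. P (Suc n))" for P :: "nat \<Rightarrow> bool"
    by (metis not0_implies_Suc)
  show ?thesis
    unfolding trunc_julia_def mem_Collect_eq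
    by (subst *) (simp add: random_iter_Suc \<theta>_shift trunc_domain_def q_def[symmetric] del: random_iter.simps(2) funpow.simps(2))
qed

lemma J_F_iff:
  assumes "\<omega> \<in> space M" "a \<in> G" "x \<in> {0..1}"
  shows "F \<omega> a x \<in> J k \<omega> \<longleftrightarrow> q k \<omega> \<le> F \<omega> a x \<and> x \<in> J k (\<theta> \<omega>)"
  using F_mem[OF assms] F_mem01[OF assms] T_F[OF assms] assms J_iff[of "F \<omega> a x" k \<omega>] by auto

text \<open>The letter \<open>D1\<close> may precede every admissible itinerary, because its points
  lie above \<beta> and thus above each threshold \<open>q k\<close> with k > 0.\<close>

lemma J_F1:
  assumes "\<omega> \<in> space M" "x \<in> J k (\<theta> \<omega>)" "x \<in> {0..1}" "0 < k"
  shows "F \<omega> D1 x \<in> J k \<omega>" "\<beta> \<le> F \<omega> D1 x"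
proof -
  have "F \<omega> D1 x \<in> {\<alpha>..1}" using F_mem[OF assms(1) \<alpha>\<beta>(7) assms(3)] \<alpha>\<beta> by simp
  then show "\<beta> \<le> F \<omega> D1 x" using \<alpha>\<beta> by auto
  then show "F \<omega> D1 x \<in> J k \<omega>" using J_F_iff[of \<omega> D1 x k] q_le_\<beta>[of \<omega> k] assms \<alpha>\<beta> by auto
qed

text \<open>A^(-k) bounds \<open>q k\<close> and hence the fibre from below; one further factor 1 /
  A is what \<open>F_le\<close> leaves as distance from 1.\<close>

definition \<tau> :: "nat \<Rightarrow> real" where "\<tau> k = (1 / A) ^ Suc k"

lemma \<tau>_pos: "0 < \<tau> k" and \<tau>_le: "\<tau> k \<le> (1 / A) ^ k"
  using A_gt power_decreasing[of k "Suc k" "1 / A"] unfolding \<tau>_def by simp_all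

text \<open>The distance from 0 comes from the point itself, the distance from 1 from its successor:
  a point too close to 1 would be mapped too close to 0.\<close>

lemma F_middle:
  assumes "\<omega> \<in> space M" "a \<in> G" "x \<in> {0..1}" "q k \<omega> \<le> F \<omega> a x" "q k (\<theta> \<omega>) \<le> x"
  shows "F \<omega> a x \<in> {\<tau> k..1 - \<tau> k}"
proof -
  have "(1 / A) ^ k \<le> x" "(1 / A) ^ k \<le> F \<omega> a x" using assms q_bounds[of \<omega> k] q_bounds[of "\<theta> \<omega>" k] by auto
  then have "(1 / A) ^ k / A \<le> x / A" using A_pos by (intro divide_right_mono) auto
  then have "\<tau> k \<le> x / A" by (simp add: \<tau>_def mult.commute)
  then show ?thesis using F_le[OF assms(1-3)] \<tau>_le[of k] \<open>(1 / A) ^ k \<le> F \<omega> a x\<close> by auto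
qed

lemma J_middle:
  assumes \<omega>: "\<omega> \<in> space M" and x: "x \<in> J k \<omega>"
  shows "x \<in> {\<tau> k..1 - \<tau> k}"
proof -
  obtain a where a: "a \<in> G" "x \<in> a" using x[unfolded J_iff[of x k \<omega>]] by blast
  have Tx: "T \<omega> x \<in> {0..1}" using T_branch(3)[OF \<omega> a(1)] a by blast
  have "F \<omega> a (T \<omega> x) = x" using F_T[OF \<omega> a] .
  moreover have "q k \<omega> \<le> x" "q k (\<theta> \<omega>) \<le> T \<omega> x" using x J_iff[of x k \<omega>] J_iff[of "T \<omega> x" k "\<theta> \<omega>"] by auto
  ultimately show ?thesis using F_middle[OF \<omega> a(1) Tx] by simp
qed

lemma J_inner: "\<lbrakk>\<omega> \<in> space M; x \<in> J k \<omega>\<rbrakk> \<Longrightarrow> x \<in> {0<..<1}"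
  using J_middle[of \<omega> x k] \<tau>_pos[of k] by auto

text \<open>A base point above \<beta> is the most permissive one, since it does not prolong a run
  of letters \<open>D0\<close> at the end of the word. A word that is admissible over some
  \<open>y\<close> therefore stays admissible over \<open>y'\<close>.\<close>

lemma J_Fw_transfer:
  assumes "\<omega> \<in> space M" "set w \<subseteq> G" "y \<in> {0<..<1}" "Fw w \<omega> y \<in> J k \<omega>"
    and y': "y' \<in> J k ((\<theta> ^^ length w) \<omega>)" "\<beta> \<le> y'"
  shows "Fw w \<omega> y' \<in> J k \<omega>"
  using assms
proof (induction w arbitrary: \<omega>)
  case (Cons a w)
  have y'01: "y' \<in> {0<..<1}" using J_inner Cons.prems(1,5) \<theta>n_in by blast
  have in01: "Fw w (\<theta> \<omega>) y \<in> {0..1}" "Fw w (\<theta> \<omega>) y' \<in> {0..1}"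
    using Fw_mem01[of "\<theta> \<omega>" w] Cons.prems(1-3) y'01 by auto
  have y: "q k \<omega> \<le> F \<omega> a (Fw w (\<theta> \<omega>) y)" "Fw w (\<theta> \<omega>) y \<in> J k (\<theta> \<omega>)"
    using J_F_iff[of \<omega> a "Fw w (\<theta> \<omega>) y" k] Cons.prems in01 by auto
  have "Fw w (\<theta> \<omega>) y' \<in> J k (\<theta> \<omega>)"
    using Cons.IH[of "\<theta> \<omega>"] Cons.prems y by (simp add: \<theta>_shift del: funpow.simps)
  moreover have "q k \<omega> \<le> Fw (a # w) \<omega> y'"
    by (rule dominance[of \<omega> "a # w" y]) (use Cons.prems y y'01 in auto)
  ultimately show ?case using J_F_iff[of \<omega> a "Fw w (\<theta> \<omega>) y'" k] Cons.prems in01 by auto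
qed simp

lemma J_Fw_base:
  "\<lbrakk>\<omega> \<in> space M; set w \<subseteq> G; y \<in> {0..1}; Fw w \<omega> y \<in> J k \<omega>\<rbrakk> \<Longrightarrow> y \<in> J k ((\<theta> ^^ length w) \<omega>)"
proof (induction w arbitrary: \<omega>)
  case (Cons a w)
  have "Fw w (\<theta> \<omega>) y \<in> {0..1}" using Fw_mem01[of "\<theta> \<omega>" w] Cons.prems(1-3) by auto
  then have "Fw w (\<theta> \<omega>) y \<in> J k (\<theta> \<omega>)" using J_F_iff[of \<omega> a] Cons.prems by auto
  then show ?case using Cons.IH[of "\<theta> \<omega>"] Cons.prems by (simp add: \<theta>_shift del: funpow.simps)
qed simp

text \<open>After k + 1 letters the base point no longer matters. \<open>F_middle\<close> asks for
  two thresholds, one for the block and one for the block without its first letter; both words have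
  at least k letters, so \<open>dominance\<close> transfers both thresholds from \<open>x\<close> to
  every \<open>y\<close>.\<close>

lemma Fw_block_middle:
  assumes \<omega>: "\<omega> \<in> space M" and u: "set u \<subseteq> G" "length u = Suc k" and x: "x \<in> {0<..<1}" "Fw u \<omega> x \<in> J k \<omega>"
    and y: "y \<in> {0..1}"
  shows "Fw u \<omega> y \<in> {\<tau> k..1 - \<tau> k}"
proof -
  obtain a u' where u': "u = a # u'" "length u' = k" using u(2) by (auto simp: length_Suc_conv)
  have in01: "Fw u' (\<theta> \<omega>) x \<in> {0..1}" "Fw u' (\<theta> \<omega>) y \<in> {0..1}"
    using Fw_mem01[of "\<theta> \<omega>" u'] \<omega> u x(1) y u' by auto
  have *: "q k \<omega> \<le> Fw u \<omega> x" "Fw u' (\<theta> \<omega>) x \<in> J k (\<theta> \<omega>)"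
    using J_F_iff[of \<omega> a "Fw u' (\<theta> \<omega>) x" k] x(2) \<omega> u in01 by (auto simp: u')
  have "q k \<omega> \<le> Fw u \<omega> y"
    by (rule dominance[of \<omega> u x]) (use * \<omega> u x y in auto)
  moreover have "q k (\<theta> \<omega>) \<le> Fw u' (\<theta> \<omega>) x" using *(2) J_iff[of "Fw u' (\<theta> \<omega>) x" k "\<theta> \<omega>"] by simp
  then have "q k (\<theta> \<omega>) \<le> Fw u' (\<theta> \<omega>) y"
    by - (rule dominance[of "\<theta> \<omega>" u' x]; use \<omega> u x y u' in auto)
  ultimately show ?thesis using F_middle[of \<omega> a "Fw u' (\<theta> \<omega>) y" k] \<omega> u in01 by (simp add: u')
qed

section \<open>Contraction and distortion on the truncated fibres\<close>

definition \<rho> :: "nat \<Rightarrow> real" where "\<rho> k = 1 / (1 + \<tau> k ^ 3)"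

lemma \<rho>_bounds: "0 < \<rho> k" "\<rho> k < 1"
  using \<tau>_pos[of k] unfolding \<rho>_def by (auto simp: add_pos_pos)

text \<open>The last k + 1 letters map the unit interval into [\<tau> k, 1 - \<tau> k], and on this
  part the earlier letters lose the factor \<rho> k compared with their full image. Blocks are
  removed from the end of the word; fewer than k + 1 letters remain at the front and are estimated
  by 1.\<close>

lemma Fw_contract:
  assumes "\<omega> \<in> space M" "set w \<subseteq> G" "x \<in> {0<..<1}" "Fw w \<omega> x \<in> J k \<omega>"
  shows "\<bar>Fw w \<omega> 1 - Fw w \<omega> 0\<bar> \<le> \<rho> k ^ (length w div Suc k)"
  using assms
proof (induction "length w" arbitrary: w x rule: less_induct)
  case less
  show ?case
  proof (cases "length w < Suc k")
    case True
    then show ?thesis using Fw_mem01[of \<omega> w 0] Fw_mem01[of \<omega> w 1] less.prems by auto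
  next
    case False
    define w' u where "w' = take (length w - Suc k) w" and "u = drop (length w - Suc k) w"
    have w: "w = w' @ u" "length u = Suc k" using False by (auto simp: w'_def u_def)
    then have lw: "length w = length w' + Suc k" by simp
    let ?\<omega> = "(\<theta> ^^ length w') \<omega>"
    have sub: "set w' \<subseteq> G" "set u \<subseteq> G" using less.prems(2) w by auto
    have ux: "Fw u ?\<omega> x \<in> {0<..<1}" using less.prems sub by (intro Fw_inner) auto
    have J: "Fw w' \<omega> (Fw u ?\<omega> x) \<in> J k \<omega>" using less.prems(4) by (simp add: w(1) Fw_append)
    have IH: "\<bar>Fw w' \<omega> 1 - Fw w' \<omega> 0\<bar> \<le> \<rho> k ^ (length w' div Suc k)"
      using less.hyps[of w' "Fw u ?\<omega> x"] lw less.prems(1) sub ux J by auto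
    have "Fw u ?\<omega> x \<in> J k ?\<omega>" by (rule J_Fw_base) (use less.prems(1) sub ux J in auto)
    then have mid: "Fw u ?\<omega> y \<in> {\<tau> k..1 - \<tau> k}" if "y \<in> {0..1}" for y
      using Fw_block_middle[of ?\<omega> u k x y] less.prems sub w that by auto
    have "\<bar>Fw w \<omega> 1 - Fw w \<omega> 0\<bar> * (1 + \<tau> k ^ 3) \<le> \<bar>Fw w' \<omega> 1 - Fw w' \<omega> 0\<bar>"
      unfolding w(1) Fw_append
      by (rule Fw_middle[OF less.prems(1) sub(1) \<tau>_pos]) (use mid in auto)
    then have "\<bar>Fw w \<omega> 1 - Fw w \<omega> 0\<bar> * (1 + \<tau> k ^ 3) \<le> \<rho> k ^ (length w' div Suc k)" using IH by linarith
    then have "\<bar>Fw w \<omega> 1 - Fw w \<omega> 0\<bar> \<le> \<rho> k * \<rho> k ^ (length w' div Suc k)"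
      using \<tau>_pos[of k] by (simp add: \<rho>_def pos_le_divide_eq add_pos_pos)
    also have "\<dots> = \<rho> k ^ (length w div Suc k)" 
      by (simp only: lw div_add_self2[OF nat.distinct(2)] power_add power_one_right mult.commute)
    finally show ?thesis .
  qed
qed

lemma Dw_le:
  assumes "\<omega> \<in> space M" "set w \<subseteq> G" "p \<in> {\<tau> k..1 - \<tau> k}"
  shows "\<bar>Dw w \<omega> p\<bar> \<le> 1 / (\<tau> k)\<^sup>2"
  using expanding_schwarz_deriv_le[OF Fw_schw[OF assms(1,2)] Fw_cont[OF assms(1,2)], of "\<tau> k" p]
    assms Fw_mem01[OF assms(1,2)] \<tau>_pos[of k] by (force simp: field_simps image_subset_iff)

lemma Dw_koebe:
  assumes "\<omega> \<in> space M" "set w \<subseteq> G" "p \<in> {\<tau> k..1 - \<tau> k}" "x \<in> {0<..<1}"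
  shows "\<bar>Dw w \<omega> p\<bar> \<le> \<bar>Dw w \<omega> x\<bar> * (1 + \<bar>p - x\<bar> / \<tau> k)\<^sup>2" "\<bar>Dw w \<omega> p\<bar> \<le> \<bar>Dw w \<omega> x\<bar> / (\<tau> k)\<^sup>2"
  using koebe[OF Fw_schw[OF assms(1,2)] assms(4), of "\<tau> k" p]
    koebe_unit[OF Fw_schw[OF assms(1,2)] assms(4), of "\<tau> k" p] assms \<tau>_pos[of k]
  by (auto simp: field_simps)

section \<open>Compactness of the fibres and a reference point\<close>

text \<open>\<open>T \<omega>\<close> is arbitrary off \<open>\<Union>G\<close>, so its iterates
  need not be continuous on the line. The sets of points surviving up to time n are therefore built
  backwards, as preimages inside the closed set \<open>\<Union>G\<close>.\<close>

lemma J_closed: "\<omega> \<in> space M \<Longrightarrow> closed (J k \<omega>)"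
proof -
  define Jn where "Jn n \<omega> = {x. \<forall>i\<le>n. random_iter \<theta> T i \<omega> x \<in> \<Union>G \<inter> {q k ((\<theta> ^^ i) \<omega>)..1}}" for n \<omega>
  have cG: "closed (\<Union>G)" using finite_G G_interval by (intro closed_Union) fastforce+
  have "closed (Jn n \<omega>)" if "\<omega> \<in> space M" for n \<omega>
    using that
  proof (induction n arbitrary: \<omega>)
    case 0
    have "Jn 0 \<omega> = \<Union>G \<inter> {q k \<omega>..1}" by (auto simp: Jn_def)
    then show ?case using cG by auto
  next
    case (Suc n)
    have *: "(\<forall>i\<le>Suc n. Q i) \<longleftrightarrow> Q 0 \<and> (\<forall>i\<le>n. Q (Suc i))" for Q
      by (metis Suc_le_mono le0 not0_implies_Suc)
    have "x \<in> Jn (Suc n) \<omega> \<longleftrightarrow> x \<in> {q k \<omega>..1} \<inter> (\<Union>G \<inter> T \<omega> -` Jn n (\<theta> \<omega>))" for x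
      unfolding Jn_def mem_Collect_eq Int_iff vimage_eq
      by (subst *) (simp only: random_iter_Suc \<theta>_shift random_iter.simps(1) funpow_0 conj_ac)
    then have "Jn (Suc n) \<omega> = {q k \<omega>..1} \<inter> (\<Union>G \<inter> T \<omega> -` Jn n (\<theta> \<omega>))" by blast
    moreover have "closed (\<Union>G \<inter> T \<omega> -` Jn n (\<theta> \<omega>))"
      using T_branch(7)[OF Suc.prems \<alpha>\<beta>(6)] cG Suc by (intro continuous_closed_preimage) auto
    ultimately show ?case by auto
  qed
  moreover have "J k \<omega> = (\<Inter>n. Jn n \<omega>)"
    unfolding Jn_def trunc_julia_def trunc_domain_def q_def by auto
  moreover assume "\<omega> \<in> space M"
  ultimately show ?thesis by auto
qed

lemma J_compact: "\<omega> \<in> space M \<Longrightarrow> compact (J k \<omega>)"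
  unfolding compact_eq_bounded_closed
proof
  assume \<omega>: "\<omega> \<in> space M"
  show "closed (J k \<omega>)" using J_closed[OF \<omega>] .
  have "J k \<omega> \<subseteq> {0<..<1}" using J_inner[OF \<omega>] by (rule subsetI)
  then show "bounded (J k \<omega>)" by (intro bounded_subset[OF compact_imp_bounded[OF compact_Icc[of 0 1]]]) auto
qed

text \<open>The point with itinerary \<open>D1, D1, \<dots>\<close>: a measurable choice of a point in every truncated fibre.\<close>

definition z :: "'w \<Rightarrow> real" where
  "z \<omega> = lim (\<lambda>n. Fw (replicate n D1) \<omega> (1/2))"

text \<open>The images of the unit interval along the words D1, ..., D1 are nested and compact,
  hence have a common point, and this point lies in the fibres of all levels k > 0 at once.
  Contraction at level 1, with blocks of two letters, makes the images of 1/2 converge to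
  it.\<close>

lemma z_props:
  assumes \<omega>: "\<omega> \<in> space M"
  shows z_in_J: "0 < k \<Longrightarrow> z \<omega> \<in> J k \<omega>" and z_limit: "(\<lambda>n. Fw (replicate n D1) \<omega> (1/2)) \<longlonglongrightarrow> z \<omega>"
proof -
  have set_D1s: "set (replicate n D1) \<subseteq> G" for n using \<alpha>\<beta>(7) by (simp add: set_replicate_conv_if)
  have ne: "\<exists>x. (\<forall>n. x \<in> Fw (replicate n D1) \<omega> ` {0..1}) \<and> (\<forall>k>0. x \<in> J k \<omega>)" if \<omega>: "\<omega> \<in> space M" for \<omega>
  proof -
    have "\<Inter> (range (\<lambda>n. Fw (replicate n D1) \<omega> ` {0..1})) \<noteq> {}"
    proof (rule compact_nest)
      fix n m :: nat assume "n \<le> m"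
      then have "replicate m D1 = replicate n D1 @ replicate (m - n) D1" by (simp flip: replicate_add)
      then show "Fw (replicate m D1) \<omega> ` {0..1} \<subseteq> Fw (replicate n D1) \<omega> ` {0..1}"
        using Fw_mem01[of "(\<theta> ^^ n) \<omega>" "replicate (m - n) D1"] \<omega> set_D1s
        by (auto simp: Fw_append simp del: atLeastAtMost_iff)
    qed (use Fw_cont[OF \<omega> set_D1s] in \<open>auto intro!: compact_continuous_image\<close>)
    then obtain x where "x \<in> \<Inter> (range (\<lambda>n. Fw (replicate n D1) \<omega> ` {0..1}))" by (meson all_not_in_conv)
    then have x: "\<And>n. x \<in> Fw (replicate n D1) \<omega> ` {0..1}" by simp
    have it: "random_iter \<theta> T n \<omega> x \<in> D1" for n
    proof -
      obtain y where y: "y \<in> {0..1}" "x = Fw (replicate (Suc n) D1) \<omega> y" using x[of "Suc n"] by blast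
      have "replicate (Suc n) D1 = replicate n D1 @ [D1]" by (simp add: replicate_append_same)
      then have "x = Fw (replicate n D1) \<omega> (F ((\<theta> ^^ n) \<omega>) D1 y)"
        using y(2) by (simp add: Fw_append)
      moreover have "F ((\<theta> ^^ n) \<omega>) D1 y \<in> {0..1}" "F ((\<theta> ^^ n) \<omega>) D1 y \<in> D1"
        using F_mem F_mem01 \<omega> y \<alpha>\<beta>(7) by (auto simp del: atLeastAtMost_iff)
      ultimately show ?thesis using iter_Fw[OF \<omega> set_D1s, of "F ((\<theta> ^^ n) \<omega>) D1 y" n] by simp
    qed
    have "x \<in> J k \<omega>" if "0 < k" for k
      unfolding trunc_julia_def trunc_domain_def mem_Collect_eq
    proof
      fix n
      have "q k ((\<theta> ^^ n) \<omega>) \<le> \<beta>" using \<omega> that by (intro q_le_\<beta>) auto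
      moreover have "random_iter \<theta> T n \<omega> x \<in> {\<alpha>..1}" using it[of n] \<alpha>\<beta>(5) by simp
      ultimately have "random_iter \<theta> T n \<omega> x \<in> {q k ((\<theta> ^^ n) \<omega>)..1}" using \<alpha>\<beta>(2) by auto
      then show "random_iter \<theta> T n \<omega> x \<in> \<Union> G \<inter> {inverse_branch0 G \<theta> T k ((\<theta> ^^ n) \<omega>) 1..1}"
        unfolding q_def by (intro IntI UnionI[OF \<alpha>\<beta>(7) it])
    qed
    with x show ?thesis by (intro exI[of _ x]) simp
  qed
  obtain p where p0: "(\<forall>n. p \<in> Fw (replicate n D1) \<omega> ` {0..1}) \<and> (\<forall>k>0. p \<in> J k \<omega>)"
    using ne[OF \<omega>] by (rule exE)
  have p: "\<And>n. p \<in> Fw (replicate n D1) \<omega> ` {0..1}" "\<And>k. 0 < k \<Longrightarrow> p \<in> J k \<omega>" using p0 by simp_all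
  have "(\<lambda>n. Fw (replicate n D1) \<omega> (1/2)) \<longlonglongrightarrow> p"
  proof (rule Lim_null[THEN iffD2], rule Lim_null_comparison)
    show "\<forall>\<^sub>F n in sequentially. norm (Fw (replicate n D1) \<omega> (1/2) - p) \<le> \<rho> 1 ^ (n div 2)"
    proof (rule always_eventually, rule allI)
      fix n
      obtain y where y: "y \<in> {0..1}" "p = Fw (replicate n D1) \<omega> y" using p(1) by blast
      have "y \<in> J 1 ((\<theta> ^^ n) \<omega>)"
        using J_Fw_base[OF \<omega> set_D1s, of y n 1] y p(2)[of 1] by simp
      then have yi: "y \<in> {0<..<1}" by (rule J_inner[OF \<theta>n_in[OF \<omega>]])
      have "\<bar>Fw (replicate n D1) \<omega> (1/2) - p\<bar> \<le> \<bar>Fw (replicate n D1) \<omega> 1 - Fw (replicate n D1) \<omega> 0\<bar>"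
        unfolding y(2) using y by (intro Fw_diff_le \<omega> set_D1s) auto
      also have "\<dots> \<le> \<rho> 1 ^ (n div 2)"
        using Fw_contract[OF \<omega> set_D1s yi, of n 1] y p(2)[of 1] by (simp add: numeral_2_eq_2)
      finally show "norm (Fw (replicate n D1) \<omega> (1/2) - p) \<le> \<rho> 1 ^ (n div 2)" by simp
    qed
    show "(\<lambda>n. \<rho> 1 ^ (n div 2)) \<longlonglongrightarrow> 0"
      using \<rho>_bounds[of 1]
      by (intro filterlim_compose[OF LIMSEQ_power_zero] filterlim_at_top_div_const_nat) auto
  qed
  moreover from this have "z \<omega> = p" unfolding z_def by (rule limI)
  ultimately show "0 < k \<Longrightarrow> z \<omega> \<in> J k \<omega>" "(\<lambda>n. Fw (replicate n D1) \<omega> (1/2)) \<longlonglongrightarrow> z \<omega>"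
    using p by auto
qed

section \<open>Measurability in the base point\<close>

lemma \<theta>n_measurable [measurable]: "(\<theta> ^^ n) \<in> measurable M M"
proof (induction n)
  case (Suc n)
  then have "(\<lambda>\<omega>. \<theta> ((\<theta> ^^ n) \<omega>)) \<in> measurable M M" by (rule measurable_compose) (rule \<theta>_measurable)
  then show ?case by (simp add: comp_def)
qed simp

lemma T_shift_measurable: "x \<in> \<Union>G \<Longrightarrow> (\<lambda>\<omega>. T ((\<theta> ^^ j) \<omega>) x) \<in> borel_measurable M"
  by (rule measurable_compose[OF \<theta>n_measurable T_measurable])

text \<open>What is given is measurability of \<omega> \<mapsto> T_\<omega>(x) for fixed x. Since
  branches are monotone, the event that the preimage of X lies left of \<open>s\<close> is a
  comparison of X with the values of T at two fixed points.\<close>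

lemma F_measurable:
  assumes a: "a \<in> G" and X: "X \<in> borel_measurable M" "\<And>\<omega>. \<omega> \<in> space M \<Longrightarrow> X \<omega> \<in> {0..1}"
  shows "(\<lambda>\<omega>. F ((\<theta> ^^ j) \<omega>) a (X \<omega>)) \<in> borel_measurable M"
  unfolding borel_measurable_iff_le
proof
  fix s :: real
  obtain l r where lr: "0 \<le> l" "l < r" "r \<le> 1" "a = {l..r}" using G_interval[OF a] by blast
  note [measurable] = X(1)
  have mem: "F ((\<theta> ^^ j) \<omega>) a (X \<omega>) \<in> {l..r}" if "\<omega> \<in> space M" for \<omega>
    using F_mem[OF \<theta>n_in[OF that] a X(2)[OF that]] lr(4) by simp
  consider "s < l" | "r < s" | "l \<le> s" "s \<le> r" by linarith
  then show "{\<omega> \<in> space M. F ((\<theta> ^^ j) \<omega>) a (X \<omega>) \<le> s} \<in> sets M"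
  proof cases
    case 1
    then have "{\<omega> \<in> space M. F ((\<theta> ^^ j) \<omega>) a (X \<omega>) \<le> s} = {}" using mem by fastforce
    then show ?thesis by (simp only: sets.empty_sets)
  next
    case 2
    then have "{\<omega> \<in> space M. F ((\<theta> ^^ j) \<omega>) a (X \<omega>) \<le> s} = space M" using mem by fastforce
    then show ?thesis by (simp only: sets.top)
  next
    case 3
    have ls: "l \<in> \<Union>G" "s \<in> \<Union>G" using a lr 3 by auto
    note [measurable] = T_shift_measurable[OF ls(1), of j] T_shift_measurable[OF ls(2), of j]
    \<comment> \<open>One formula for both orientations: on an increasing branch T is 0 at
      \<open>l\<close>, the minimum, on a decreasing one it is 1, the maximum. In each case one of
      the two inequalities holds trivially.\<close>
    have "F ((\<theta> ^^ j) \<omega>) a (X \<omega>) \<le> s \<longleftrightarrow>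
        min (T ((\<theta> ^^ j) \<omega>) l) (T ((\<theta> ^^ j) \<omega>) s) \<le> X \<omega> \<and> X \<omega> \<le> max (T ((\<theta> ^^ j) \<omega>) l) (T ((\<theta> ^^ j) \<omega>) s)"
      if \<omega>: "\<omega> \<in> space M" for \<omega>
    proof -
      let ?\<omega> = "(\<theta> ^^ j) \<omega>"
      let ?y = "F ?\<omega> a (X \<omega>)"
      note T = T_branch[OF \<theta>n_in[OF \<omega>] a, of j]
      have "T ?\<omega> ?y = X \<omega>" using T_F[OF \<theta>n_in[OF \<omega>] a X(2)[OF \<omega>]] .
      have y: "?y \<in> {l..r}" "s \<in> {l..r}" "l \<in> {l..r}" using mem[OF \<omega>] 3 lr by auto
      have x: "X \<omega> \<in> {0..1}" using X(2)[OF \<omega>] .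
      have c: "continuous_on {l..r} (T ?\<omega>)" using full_branch_continuous[OF T(1)] lr by simp
      consider "strict_mono_on {l..r} (T ?\<omega>)" "T ?\<omega> l = 0" | "strict_antimono_on {l..r} (T ?\<omega>)" "T ?\<omega> l = 1"
        using full_branch_monotone[OF lr(2) c T(2,3)[unfolded lr(4)]] by blast
      then show ?thesis
      proof cases
        case 1
        have "0 \<le> T ?\<omega> s" using strict_mono_on_less_eq[OF 1(1) y(3,2)] 1(2) y by auto
        moreover have "?y \<le> s \<longleftrightarrow> T ?\<omega> ?y \<le> T ?\<omega> s" using strict_mono_on_less_eq[OF 1(1) y(1,2)] by simp
        ultimately show ?thesis using \<open>T ?\<omega> ?y = X \<omega>\<close> 1(2) x by simp
      next
        case 2
        then have m: "strict_mono_on {l..r} (\<lambda>x. - T ?\<omega> x)" by (auto simp: monotone_on_def)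
        have "T ?\<omega> s \<le> 1" using strict_mono_on_less_eq[OF m y(3,2)] 2(2) y by auto
        moreover have "?y \<le> s \<longleftrightarrow> T ?\<omega> s \<le> T ?\<omega> ?y" using strict_mono_on_less_eq[OF m y(1,2)] by simp
        ultimately show ?thesis using \<open>T ?\<omega> ?y = X \<omega>\<close> 2(2) x by simp
      qed
    qed
    then have "{\<omega> \<in> space M. F ((\<theta> ^^ j) \<omega>) a (X \<omega>) \<le> s} = {\<omega> \<in> space M.
        min (T ((\<theta> ^^ j) \<omega>) l) (T ((\<theta> ^^ j) \<omega>) s) \<le> X \<omega> \<and> X \<omega> \<le> max (T ((\<theta> ^^ j) \<omega>) l) (T ((\<theta> ^^ j) \<omega>) s)}"
      by (intro Collect_cong conj_cong refl)
    also have "\<dots> \<in> sets M" by measurable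
    finally show ?thesis .
  qed
qed

lemma Fw_measurable:
  assumes "set w \<subseteq> G" "X \<in> borel_measurable M" "\<And>\<omega>. \<omega> \<in> space M \<Longrightarrow> X \<omega> \<in> {0..1}"
  shows "(\<lambda>\<omega>. Fw w ((\<theta> ^^ j) \<omega>) (X \<omega>)) \<in> borel_measurable M"
  using assms(1)
proof (induction w arbitrary: j)
  case (Cons a w)
  have IH: "(\<lambda>\<omega>. Fw w ((\<theta> ^^ Suc j) \<omega>) (X \<omega>)) \<in> borel_measurable M"
    by (rule Cons.IH) (use Cons.prems in simp)
  have "(\<lambda>\<omega>. F ((\<theta> ^^ j) \<omega>) a (Fw w ((\<theta> ^^ Suc j) \<omega>) (X \<omega>))) \<in> borel_measurable M"
  proof (rule F_measurable[OF _ IH])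
    show "a \<in> G" using Cons.prems by simp
    show "Fw w ((\<theta> ^^ Suc j) \<omega>) (X \<omega>) \<in> {0..1}" if "\<omega> \<in> space M" for \<omega>
      by (rule Fw_mem01[OF \<theta>n_in[OF that] _ assms(3)[OF that]]) (use Cons.prems in simp)
  qed
  then show ?case by simp
qed (use assms in simp)

lemma Dw_measurable:
  assumes "set w \<subseteq> G" and [measurable]: "X \<in> borel_measurable M" and X: "\<And>\<omega>. \<omega> \<in> space M \<Longrightarrow> X \<omega> \<in> {0<..<1}"
  shows "(\<lambda>\<omega>. Dw w \<omega> (X \<omega>)) \<in> borel_measurable M"
proof (rule borel_measurable_LIMSEQ_real)
  \<comment> \<open>A positive increment smaller than 1 - X, so that the shifted point stays in the
    unit interval.\<close>
  define h where "h n \<omega> = (1 - X \<omega>) / real (n + 2)" for n \<omega>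
  have [measurable]: "h n \<in> borel_measurable M" for n unfolding h_def[abs_def] by measurable
  have h: "0 < h n \<omega>" "X \<omega> + h n \<omega> \<in> {0..1}" if "\<omega> \<in> space M" for n \<omega>
  proof -
    show h0: "0 < h n \<omega>" using X[OF that] by (simp add: h_def)
    have "h n \<omega> \<le> (1 - X \<omega>) / 1" unfolding h_def using X[OF that] by (intro divide_left_mono) auto
    then show "X \<omega> + h n \<omega> \<in> {0..1}" using h0 X[OF that] by auto
  qed
  have "(\<lambda>\<omega>. Fw w ((\<theta> ^^ 0) \<omega>) (X \<omega> + h n \<omega>)) \<in> borel_measurable M" for n
    by (rule Fw_measurable[OF assms(1)]) (use h in auto)
  moreover have "(\<lambda>\<omega>. Fw w ((\<theta> ^^ 0) \<omega>) (X \<omega>)) \<in> borel_measurable M"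
    by (rule Fw_measurable[OF assms(1)]) (use X in \<open>auto simp: less_imp_le\<close>)
  ultimately show "(\<lambda>\<omega>. (Fw w \<omega> (X \<omega> + h n \<omega>) - Fw w \<omega> (X \<omega>)) / h n \<omega>) \<in> borel_measurable M" for n
    by simp
  show "(\<lambda>n. (Fw w \<omega> (X \<omega> + h n \<omega>) - Fw w \<omega> (X \<omega>)) / h n \<omega>) \<longlonglongrightarrow> Dw w \<omega> (X \<omega>)" if \<omega>: "\<omega> \<in> space M" for \<omega>
  proof -
    have "((\<lambda>e. (Fw w \<omega> (X \<omega> + e) - Fw w \<omega> (X \<omega>)) / e) \<longlongrightarrow> Dw w \<omega> (X \<omega>)) (at 0)"
      using Fw_deriv[OF \<omega> assms(1) X[OF \<omega>]] by (simp add: DERIV_def)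
    moreover have "filterlim (\<lambda>n. h n \<omega>) (at 0) sequentially"
    proof (rule filterlim_atI)
      show "(\<lambda>n. h n \<omega>) \<longlonglongrightarrow> 0" unfolding h_def by (rule LIMSEQ_ignore_initial_segment[OF lim_const_over_n])
      show "\<forall>\<^sub>F n in sequentially. h n \<omega> \<noteq> 0" using h(1)[OF \<omega>] by (intro always_eventually) (simp add: less_imp_neq[symmetric])
    qed
    ultimately show ?thesis by (rule filterlim_compose)
  qed
qed

lemma q_measurable: "(\<lambda>\<omega>. q k ((\<theta> ^^ j) \<omega>)) \<in> borel_measurable M"
proof (induction k arbitrary: j)
  case (Suc k)
  have "(\<lambda>\<omega>. F ((\<theta> ^^ j) \<omega>) D0 (q k ((\<theta> ^^ Suc j) \<omega>))) \<in> borel_measurable M"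
    by (rule F_measurable[OF \<alpha>\<beta>(6) Suc]) (use q_bounds[OF \<theta>n_in] in blast)
  then show ?case by (simp add: q_Suc)
qed simp

lemma z_measurable: "z \<in> borel_measurable M"
proof (rule borel_measurable_LIMSEQ_real)
  show "(\<lambda>n. Fw (replicate n D1) \<omega> (1/2)) \<longlonglongrightarrow> z \<omega>" if "\<omega> \<in> space M" for \<omega>
    using z_limit[OF that] .
  have "(\<lambda>\<omega>. Fw (replicate n D1) ((\<theta> ^^ 0) \<omega>) (1/2)) \<in> borel_measurable M" for n
    by (rule Fw_measurable) (use \<alpha>\<beta>(7) in \<open>auto simp: set_replicate_conv_if\<close>)
  then show "(\<lambda>\<omega>. Fw (replicate n D1) \<omega> (1/2)) \<in> borel_measurable M" for n by simp
qed

text \<open>Once the base point lies in its fibre, membership of its image reduces to one comparison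
  with \<open>q k\<close> for each letter. This avoids treating the fibre as a random set.\<close>

lemma J_Fw_measurable:
  assumes "set w \<subseteq> G" and X: "X \<in> borel_measurable M" "\<And>\<omega>. \<omega> \<in> space M \<Longrightarrow> X \<omega> \<in> J k ((\<theta> ^^ (j + length w)) \<omega>)"
  shows "{\<omega> \<in> space M. Fw w ((\<theta> ^^ j) \<omega>) (X \<omega>) \<in> J k ((\<theta> ^^ j) \<omega>)} \<in> sets M"
  using assms(1) X(2)
proof (induction w arbitrary: j)
  case Nil
  then have "{\<omega> \<in> space M. Fw [] ((\<theta> ^^ j) \<omega>) (X \<omega>) \<in> J k ((\<theta> ^^ j) \<omega>)} = space M" by auto
  then show ?case by simp
next
  case (Cons a w)
  have X01: "X \<omega> \<in> {0..1}" if "\<omega> \<in> space M" for \<omega>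
    using J_inner[OF \<theta>n_in[OF that] Cons.prems(2)[OF that]] by auto
  have 1: "(\<lambda>\<omega>. Fw (a # w) ((\<theta> ^^ j) \<omega>) (X \<omega>)) \<in> borel_measurable M"
    by (rule Fw_measurable[OF Cons.prems(1) X(1) X01])
  have 2: "{\<omega> \<in> space M. Fw w ((\<theta> ^^ Suc j) \<omega>) (X \<omega>) \<in> J k ((\<theta> ^^ Suc j) \<omega>)} \<in> sets M"
    by (rule Cons.IH) (use Cons.prems in auto)
  have "Fw (a # w) ((\<theta> ^^ j) \<omega>) (X \<omega>) \<in> J k ((\<theta> ^^ j) \<omega>) \<longleftrightarrow>
      q k ((\<theta> ^^ j) \<omega>) \<le> Fw (a # w) ((\<theta> ^^ j) \<omega>) (X \<omega>) \<and> Fw w ((\<theta> ^^ Suc j) \<omega>) (X \<omega>) \<in> J k ((\<theta> ^^ Suc j) \<omega>)"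
    if \<omega>: "\<omega> \<in> space M" for \<omega>
    using J_F_iff[OF \<theta>n_in[OF \<omega>], of a "Fw w ((\<theta> ^^ Suc j) \<omega>) (X \<omega>)" j k] Cons.prems(1)
      Fw_mem01[OF \<theta>n_in[OF \<omega>] _ X01[OF \<omega>], of w "Suc j"] by auto
  then have "{\<omega> \<in> space M. Fw (a # w) ((\<theta> ^^ j) \<omega>) (X \<omega>) \<in> J k ((\<theta> ^^ j) \<omega>)} =
     {\<omega> \<in> space M. q k ((\<theta> ^^ j) \<omega>) \<le> Fw (a # w) ((\<theta> ^^ j) \<omega>) (X \<omega>)} \<inter>
     {\<omega> \<in> space M. Fw w ((\<theta> ^^ Suc j) \<omega>) (X \<omega>) \<in> J k ((\<theta> ^^ Suc j) \<omega>)}" by auto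
  moreover have "{\<omega> \<in> space M. q k ((\<theta> ^^ j) \<omega>) \<le> Fw (a # w) ((\<theta> ^^ j) \<omega>) (X \<omega>)} \<in> sets M"
    using borel_measurable_le[OF q_measurable 1] .
  ultimately show ?case using 2 by auto
qed

lemma F1_continuous:
  assumes "\<omega> \<in> space M" "a \<in> G"
  shows "continuous_on {0<..<1} (F1 \<omega> a)"
proof -
  obtain F2 F3 where d: "\<forall>x\<in>{0<..<1}. F \<omega> a x \<in> {0<..<1} \<and> DERIV (F \<omega> a) x :> F1 \<omega> a x \<and>
        DERIV (F1 \<omega> a) x :> F2 x \<and> DERIV F2 x :> F3 x \<and> 3/2 * (F2 x)\<^sup>2 \<le> F1 \<omega> a x * F3 x"
    using F_schw[OF assms] unfolding expanding_schwarz_def by - (elim conjE exE, rule that)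
  show ?thesis
  proof (intro continuous_at_imp_continuous_on ballI)
    fix x :: real assume "x \<in> {0<..<1}"
    from bspec[OF d this] have "DERIV (F1 \<omega> a) x :> F2 x" by (elim conjE)
    then show "isCont (F1 \<omega> a) x" by (rule DERIV_isCont)
  qed
qed

text \<open>\<open>q k\<close> is the image of 1 along k letters \<open>D0\<close>, and 1 lies in no
  truncated fibre. The threshold thus never touches the fibre, which makes the truncated operator
  preserve continuity in \<open>L_cut_continuous\<close>.\<close>

lemma q_notin_J:
  assumes "\<omega> \<in> space M"
  shows "q k \<omega> \<notin> J k \<omega>"
proof
  assume *: "q k \<omega> \<in> J k \<omega>"
  have D0s: "set (replicate n D0) \<subseteq> G" for n using \<alpha>\<beta>(6) by (simp add: set_replicate_conv_if)
  have "q n \<omega> = Fw (replicate n D0) \<omega> 1" for n \<omega>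
    by (induction n arbitrary: \<omega>) (simp_all add: q_Suc)
  then have "1 \<in> J k ((\<theta> ^^ k) \<omega>)" using J_Fw_base[OF assms D0s[of k], of 1 k] * by simp
  then show False using J_inner[OF \<theta>n_in[OF assms]] by fastforce
qed

lemma J_F_interior:
  assumes "\<omega> \<in> space M" "a \<in> G" "x \<in> J k (\<theta> \<omega>)"
  shows "F \<omega> a x \<in> interior a"
  using F_int[OF assms(1,2)] J_inner[OF \<theta>_in[OF assms(1)] assms(3)] by simp

lemma interior_unique:
  assumes "a \<in> G" "b \<in> G" "y \<in> interior a" "y \<in> b"
  shows "b = a"
proof -
  obtain l r where "a = {l..r}" using G_interval[OF assms(1)] by blast
  then show ?thesis using G_eqI[of l r b y] assms by (simp add: interior_atLeastAtMost_real)
qed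

lemma deriv_within_interior:
  assumes "a \<in> G" "y \<in> interior a"
  shows "deriv_within (\<Union>G) f y = deriv_within a f y"
proof -
  have "interior a \<subseteq> interior (\<Union>G)" by (rule interior_mono) (use assms(1) in blast)
  then have "y \<in> interior (\<Union>G)" using assms(2) by (rule subsetD)
  then show ?thesis
    unfolding deriv_within_def by (simp only: at_within_interior[OF assms(2)] at_within_interior[of y "\<Union>G"])
qed

section \<open>Invariance under the base map\<close>

lemma AE_shift:
  assumes "AE \<omega> in M. Q \<omega>"
  shows "AE \<omega> in M. \<forall>i. Q ((\<theta> ^^ i) \<omega>)"
proof -
  have "AE \<omega> in M. Q ((\<theta> ^^ i) \<omega>)" for i
  proof (induction i)
    case (Suc i)
    then have "AE \<omega> in distr M M \<theta>. Q ((\<theta> ^^ i) \<omega>)" unfolding distr_\<theta> .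
    then have "AE \<omega> in M. Q ((\<theta> ^^ i) (\<theta> \<omega>))" by (rule AE_distrD[OF \<theta>_measurable])
    then show ?case by (simp add: \<theta>_shift del: funpow.simps)
  qed (use assms in simp)
  then show ?thesis by (simp add: AE_all_countable)
qed

lemma integral_shift:
  assumes [measurable]: "f \<in> borel_measurable M"
  shows "(\<integral>\<omega>. f ((\<theta> ^^ i) \<omega>) \<partial>M) = (\<integral>\<omega>. f \<omega> \<partial>M :: real)"
proof (induction i)
  case (Suc i)
  have "(\<integral>\<omega>. f ((\<theta> ^^ i) \<omega>) \<partial>M) = (\<integral>\<omega>. f ((\<theta> ^^ i) \<omega>) \<partial>distr M M \<theta>)" unfolding distr_\<theta> ..
  also have "\<dots> = (\<integral>\<omega>. f ((\<theta> ^^ i) (\<theta> \<omega>)) \<partial>M)" by (rule integral_distr) measurable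
  finally show ?case using Suc by (simp add: \<theta>_shift del: funpow.simps)
qed simp

end

section \<open>Truncated transfer operators and conformal measures\<close>

locale truncated_cf = random_cf M \<theta> G GC GE \<kappa> A \<gamma> c v T
  for M :: "'w measure" and \<theta> G GC GE \<kappa> A \<gamma> c v T +
  fixes k :: nat and t :: real
  assumes k_pos: "0 < k" and t_nonneg: "0 \<le> t"
begin

section \<open>Weighted sums over words\<close>

definition W :: "nat \<Rightarrow> real set list set" where "W n = {w. set w \<subseteq> G \<and> length w = n}"

lemma finite_W [simp]: "finite (W n)"
  unfolding W_def using finite_G by (rule finite_lists_length_eq)

lemma W_0: "W 0 = {[]}" by (auto simp: W_def)

lemma W_I [intro]: "set w \<subseteq> G \<Longrightarrow> length w = n \<Longrightarrow> w \<in> W n" by (simp add: W_def)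

lemma W_D: "w \<in> W n \<Longrightarrow> set w \<subseteq> G" "w \<in> W n \<Longrightarrow> length w = n" by (simp_all add: W_def)

lemma sum_W_Suc: "(\<Sum>w\<in>W (Suc n). f w) = (\<Sum>a\<in>G. \<Sum>w\<in>W n. f (a # w))"
proof -
  have "W (Suc n) = (\<lambda>(a, w). a # w) ` (G \<times> W n)"
    by (auto simp: W_def length_Suc_conv image_iff)
  then have "(\<Sum>w\<in>W (Suc n). f w) = (\<Sum>(a, w)\<in>G \<times> W n. f (a # w))"
    by (simp add: sum.reindex inj_on_def split_def)
  then show ?thesis by (simp add: sum.cartesian_product)
qed

lemma sum_W_add: "(\<Sum>w\<in>W (n + m). f w) = (\<Sum>w\<in>W n. \<Sum>v\<in>W m. f (w @ v))"
  by (induction n arbitrary: f) (simp_all add: W_0 sum_W_Suc)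

lemma sum_W_1: "(\<Sum>w\<in>W 1. f w) = (\<Sum>a\<in>G. f [a])"
  using sum_W_Suc[of f 0] by (simp add: W_0)

text \<open>The sums run over all words; summation over admissible words only is obtained by applying them
  to functions that vanish off the truncated fibre.\<close>

definition Z :: "nat \<Rightarrow> 'w \<Rightarrow> (real \<Rightarrow> real) \<Rightarrow> real \<Rightarrow> real" where
  "Z n \<omega> h x = (\<Sum>w\<in>W n. \<bar>Dw w \<omega> x\<bar> powr t * h (Fw w \<omega> x))"

text \<open>The operator of one step without truncation; applied to \<open>cut \<omega> g\<close> it
  is the truncated transfer operator on the next fibre (\<open>transfer_op_eq\<close>).\<close>

definition L :: "'w \<Rightarrow> (real \<Rightarrow> real) \<Rightarrow> real \<Rightarrow> real" where
  "L \<omega> h x = (\<Sum>a\<in>G. \<bar>F1 \<omega> a x\<bar> powr t * h (F \<omega> a x))"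

abbreviation one :: "'w \<Rightarrow> real \<Rightarrow> real" where "one \<omega> \<equiv> indicat_real (J k \<omega>)"

definition cut :: "'w \<Rightarrow> (real \<Rightarrow> real) \<Rightarrow> real \<Rightarrow> real" where "cut \<omega> g x = one \<omega> x * g x"

text \<open>The n-th partition sum over x, that is, the n-th iterate of the truncated operator
  applied to the constant 1.\<close>

definition N :: "nat \<Rightarrow> 'w \<Rightarrow> real \<Rightarrow> real" where "N n \<omega> x = Z n \<omega> (one \<omega>) x"

lemma Z_0 [simp]: "Z 0 \<omega> h x = h x" by (simp add: Z_def W_0)

lemma Z_add:
  "Z (n + m) \<omega> h x = (\<Sum>v\<in>W m. \<bar>Dw v ((\<theta> ^^ n) \<omega>) x\<bar> powr t * Z n \<omega> h (Fw v ((\<theta> ^^ n) \<omega>) x))"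
  unfolding Z_def sum_W_add
  by (subst sum.swap)
     (simp add: Fw_append Dw_append W_D abs_mult powr_mult sum_distrib_left mult_ac)

lemma Z_Suc: "Z (Suc n) \<omega> h x = Z n (\<theta> \<omega>) (L \<omega> h) x"
  unfolding Z_def sum_W_Suc L_def
  by (subst sum.swap) (simp add: abs_mult powr_mult sum_distrib_left mult_ac)

lemma Z_Suc_last:
  "Z (Suc n) \<omega> h x = (\<Sum>a\<in>G. \<bar>F1 ((\<theta> ^^ n) \<omega>) a x\<bar> powr t * Z n \<omega> h (F ((\<theta> ^^ n) \<omega>) a x))"
  using Z_add[of n 1 \<omega> h x] unfolding sum_W_1 by simp

lemma Z_nonneg: "(\<And>y. 0 \<le> h y) \<Longrightarrow> 0 \<le> Z n \<omega> h x"
  unfolding Z_def by (intro sum_nonneg mult_nonneg_nonneg) auto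

lemma N_nonneg: "0 \<le> N n \<omega> x"
  unfolding N_def by (rule Z_nonneg) auto

lemma Z_cut_mono: "(\<And>y. y \<in> J k \<omega> \<Longrightarrow> g y \<le> g' y) \<Longrightarrow> Z n \<omega> (cut \<omega> g) x \<le> Z n \<omega> (cut \<omega> g') x"
  unfolding Z_def cut_def by (intro sum_mono) (auto simp: indicator_def intro!: mult_left_mono)

lemma Z_cut_const: "Z n \<omega> (cut \<omega> (\<lambda>x. c0)) x = c0 * N n \<omega> x"
  unfolding Z_def N_def cut_def by (simp only: sum_distrib_left mult_ac)

lemma Z_cut_bound:
  assumes "\<And>y. y \<in> J k \<omega> \<Longrightarrow> \<bar>g y\<bar> \<le> B"
  shows "\<bar>Z n \<omega> (cut \<omega> g) x\<bar> \<le> B * N n \<omega> x"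
proof -
  have "Z n \<omega> (cut \<omega> g) x \<le> Z n \<omega> (cut \<omega> (\<lambda>x. B)) x" using assms by (intro Z_cut_mono) force
  moreover have "Z n \<omega> (cut \<omega> (\<lambda>x. - B)) x \<le> Z n \<omega> (cut \<omega> g) x" using assms by (intro Z_cut_mono) force
  ultimately show ?thesis unfolding Z_cut_const by auto
qed

lemma one_Fw_outside:
  "\<lbrakk>\<omega> \<in> space M; w \<in> W n; y \<in> {0..1}; y \<notin> J k ((\<theta> ^^ n) \<omega>)\<rbrakk> \<Longrightarrow> one \<omega> (Fw w \<omega> y) = 0"
  using J_Fw_base[of \<omega> w y k] W_D[of w n] by (auto simp: indicator_def)

lemma N_outside:
  "\<lbrakk>\<omega> \<in> space M; y \<in> {0..1}; y \<notin> J k ((\<theta> ^^ n) \<omega>)\<rbrakk> \<Longrightarrow> N n \<omega> y = 0"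
  unfolding N_def Z_def using one_Fw_outside by (intro sum.neutral) auto

lemma Fw_D1s:
  assumes "\<omega> \<in> space M" "x \<in> J k ((\<theta> ^^ n) \<omega>)"
  shows "Fw (replicate n D1) \<omega> x \<in> J k \<omega>"
  using assms
proof (induction n arbitrary: \<omega>)
  case (Suc n)
  have x: "x \<in> {0<..<1}" using J_inner Suc.prems \<theta>n_in by blast
  have *: "Fw (replicate n D1) (\<theta> \<omega>) x \<in> J k (\<theta> \<omega>)"
    using Suc.IH[of "\<theta> \<omega>"] Suc.prems by (simp add: \<theta>_shift del: funpow.simps)
  then have "Fw (replicate n D1) (\<theta> \<omega>) x \<in> {0<..<1}" using J_inner[of "\<theta> \<omega>"] Suc.prems by simp
  then show ?case using J_F1(1)[of \<omega> _ k] * Suc.prems k_pos by simp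
qed simp

lemma one_le_N:
  assumes \<omega>: "\<omega> \<in> space M" and w: "w \<in> W n" "Fw w \<omega> x \<in> J k \<omega>" and x: "x \<in> {0<..<1}"
  shows "((1 / A) ^ n) powr t \<le> N n \<omega> x"
proof -
  have "((1 / A) ^ n) powr t \<le> \<bar>Dw w \<omega> x\<bar> powr t"
    using Dw_ge[OF \<omega> W_D(1)[OF w(1)] x] W_D(2)[OF w(1)] t_nonneg A_pos by (intro powr_mono2) auto
  also have "\<dots> = \<bar>Dw w \<omega> x\<bar> powr t * one \<omega> (Fw w \<omega> x)" using w by simp
  also have "\<dots> \<le> N n \<omega> x" unfolding N_def Z_def by (intro member_le_sum) (use w in auto)
  finally show ?thesis .
qed

lemma N_ge: "\<lbrakk>\<omega> \<in> space M; x \<in> J k ((\<theta> ^^ n) \<omega>)\<rbrakk> \<Longrightarrow> ((1 / A) ^ n) powr t \<le> N n \<omega> x"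
proof -
  assume *: "\<omega> \<in> space M" "x \<in> J k ((\<theta> ^^ n) \<omega>)"
  have "replicate n D1 \<in> W n" using \<alpha>\<beta>(7) by (simp add: W_def set_replicate_conv_if)
  moreover have "x \<in> {0<..<1}" using J_inner *(2) \<theta>n_in[OF *(1)] by blast
  ultimately show ?thesis using one_le_N Fw_D1s[OF *] *(1) by blast
qed

lemma N_pos: "\<lbrakk>\<omega> \<in> space M; x \<in> J k ((\<theta> ^^ n) \<omega>)\<rbrakk> \<Longrightarrow> 0 < N n \<omega> x"
  using N_ge[of \<omega> x n] A_pos by (smt (verit) powr_gt_zero zero_less_divide_1_iff zero_less_power)

section \<open>Bounded distortion of the partition sums\<close>

text \<open>The Koebe constant for the margin \<tau> k, raised to the power t. It bounds the weight
  of a single word in the middle and also the ratio of its weights at two base points.\<close>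

definition K :: real where "K = (1 / (\<tau> k)\<^sup>2) powr t"

lemma \<tau>_lt_1: "\<tau> k < 1"
proof -
  have "\<tau> k \<le> 1 / A ^ 1" using A_gt power_decreasing[of 1 "Suc k" "1 / A"] unfolding \<tau>_def by simp
  also have "\<dots> < 1" using A_gt by simp
  finally show ?thesis .
qed

lemma K_ge_1: "1 \<le> K"
  unfolding K_def using \<tau>_lt_1 \<tau>_pos[of k] t_nonneg
  by (intro ge_one_powr_ge_zero) (auto simp: power_le_one)

lemma Dw_powr_le: "\<lbrakk>\<omega> \<in> space M; w \<in> W n; p \<in> {\<tau> k..1 - \<tau> k}\<rbrakk> \<Longrightarrow> \<bar>Dw w \<omega> p\<bar> powr t \<le> K"
  unfolding K_def using Dw_le[of \<omega> w p k] t_nonneg W_D[of w n] by (intro powr_mono2) auto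

lemma Dw_powr_compare:
  assumes "\<omega> \<in> space M" "w \<in> W n" "p \<in> {\<tau> k..1 - \<tau> k}" "x \<in> {0<..<1}"
  shows "\<bar>Dw w \<omega> p\<bar> powr t \<le> K * \<bar>Dw w \<omega> x\<bar> powr t"
proof -
  have "\<bar>Dw w \<omega> p\<bar> \<le> 1 / (\<tau> k)\<^sup>2 * \<bar>Dw w \<omega> x\<bar>"
    using Dw_koebe(2)[of \<omega> w p k x] W_D[OF assms(2)] assms by simp
  then have "\<bar>Dw w \<omega> p\<bar> powr t \<le> (1 / (\<tau> k)\<^sup>2 * \<bar>Dw w \<omega> x\<bar>) powr t" using t_nonneg by (intro powr_mono2) auto
  then show ?thesis unfolding K_def powr_mult .
qed

lemma F1_powr_le: "\<lbrakk>\<omega> \<in> space M; a \<in> G; p \<in> {\<tau> k..1 - \<tau> k}\<rbrakk> \<Longrightarrow> \<bar>F1 \<omega> a p\<bar> powr t \<le> K"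
  using Dw_powr_le[of \<omega> "[a]" 1 p] by (auto simp: W_def)

lemma F1_powr_ge: "\<lbrakk>\<omega> \<in> space M; a \<in> G; x \<in> {0<..<1}\<rbrakk> \<Longrightarrow> (1 / A) powr t \<le> \<bar>F1 \<omega> a x\<bar> powr t"
  using F1_ge[of \<omega> a x] A_pos t_nonneg by (intro powr_mono2) auto

lemma N_le: "\<lbrakk>\<omega> \<in> space M; x \<in> J k ((\<theta> ^^ n) \<omega>)\<rbrakk> \<Longrightarrow> N n \<omega> x \<le> card (W n) * K"
proof -
  assume *: "\<omega> \<in> space M" "x \<in> J k ((\<theta> ^^ n) \<omega>)"
  have "N n \<omega> x \<le> (\<Sum>w\<in>W n. K)"
    unfolding N_def Z_def
  proof (rule sum_mono)
    fix w assume "w \<in> W n"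
    then have "\<bar>Dw w \<omega> x\<bar> powr t \<le> K" using Dw_powr_le J_middle[of "(\<theta> ^^ n) \<omega>"] * by auto
    then show "\<bar>Dw w \<omega> x\<bar> powr t * one \<omega> (Fw w \<omega> x) \<le> K" using K_ge_1 by (auto simp: indicator_def)
  qed
  then show ?thesis by simp
qed

text \<open>The factors arise in \<open>N_compare\<close>: \<open>card G\<close> choices of the last
  letter, K for its weight, K for the distortion of the letters before it, and A^t for inserting
  \<open>D1\<close> over the other point.\<close>

definition C :: real where "C = card G * K * K * A powr t"

lemma C_ge_1: "1 \<le> C"
proof -
  have "1 \<le> real (card G)" using \<alpha>\<beta>(6) finite_G by (auto simp: Suc_le_eq card_gt_0_iff)
  moreover have "1 \<le> A powr t" using A_gt t_nonneg by (simp add: ge_one_powr_ge_zero)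
  ultimately have "1 * 1 * 1 * 1 \<le> card G * K * K * A powr t"
    using K_ge_1 by (intro mult_mono) auto
  then show ?thesis by (simp add: C_def)
qed

text \<open>The \<open>D1\<close>-preimage of \<open>x'\<close> lies above \<beta>, so
  \<open>J_Fw_transfer\<close> makes it admissible for every word that is admissible over some
  \<open>y\<close>.\<close>

lemma one_transfer:
  assumes "\<omega> \<in> space M" "w \<in> W n" "y \<in> {0<..<1}" "x' \<in> J k ((\<theta> ^^ Suc n) \<omega>)"
  shows "one \<omega> (Fw w \<omega> y) \<le> one \<omega> (Fw w \<omega> (F ((\<theta> ^^ n) \<omega>) D1 x'))"
proof -
  have "x' \<in> {0..1}" using J_inner[of "(\<theta> ^^ Suc n) \<omega>" x' k] assms(1,4) \<theta>n_in by auto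
  then have "F ((\<theta> ^^ n) \<omega>) D1 x' \<in> J k ((\<theta> ^^ n) \<omega>)" "\<beta> \<le> F ((\<theta> ^^ n) \<omega>) D1 x'"
    using J_F1[of "(\<theta> ^^ n) \<omega>" x' k] assms k_pos by auto
  then show ?thesis
    using J_Fw_transfer[of \<omega> w y k "F ((\<theta> ^^ n) \<omega>) D1 x'"] assms W_D[OF assms(2)] by (auto simp: indicator_def)
qed

lemma N_Suc_ge:
  assumes "\<omega> \<in> space M" "x \<in> J k ((\<theta> ^^ Suc n) \<omega>)"
  shows "(1 / A) powr t * N n \<omega> (F ((\<theta> ^^ n) \<omega>) D1 x) \<le> N (Suc n) \<omega> x"
proof -
  have x: "x \<in> {0<..<1}" using J_inner assms \<theta>n_in by blast
  let ?f = "\<lambda>a. \<bar>F1 ((\<theta> ^^ n) \<omega>) a x\<bar> powr t * N n \<omega> (F ((\<theta> ^^ n) \<omega>) a x)"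
  have "(1 / A) powr t * N n \<omega> (F ((\<theta> ^^ n) \<omega>) D1 x) \<le> ?f D1"
    using F1_powr_ge[of "(\<theta> ^^ n) \<omega>" D1 x] assms x \<alpha>\<beta> N_nonneg by (intro mult_right_mono) auto
  also have "\<dots> \<le> (\<Sum>a\<in>G. ?f a)"
    using N_nonneg finite_G \<alpha>\<beta> by (intro member_le_sum) auto
  finally show ?thesis unfolding N_def Z_Suc_last .
qed

text \<open>A word over x need not be admissible over x'. Replacing its last letter by
  \<open>D1\<close> over x' keeps the earlier letters admissible, and at most \<open>card G\<close>
  words have the same replacement.\<close>

lemma N_compare:
  assumes \<omega>: "\<omega> \<in> space M" and x: "x \<in> J k ((\<theta> ^^ n) \<omega>)" "x' \<in> J k ((\<theta> ^^ n) \<omega>)"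
  shows "N n \<omega> x \<le> C * N n \<omega> x'"
proof (cases n)
  case 0
  from C_ge_1 show ?thesis using x by (simp add: N_def 0)
next
  case (Suc m)
  let ?\<omega> = "(\<theta> ^^ m) \<omega>"
  have \<omega>': "?\<omega> \<in> space M" using \<omega> by simp
  have xm: "x \<in> {\<tau> k..1 - \<tau> k}" "x \<in> {0<..<1}" "x' \<in> {0<..<1}"
    using J_middle[OF \<theta>n_in[OF \<omega>]] J_inner[OF \<theta>n_in[OF \<omega>]] x by blast+
  let ?y' = "F ?\<omega> D1 x'"
  have y'01: "?y' \<in> {0<..<1}" using Fw_inner[of ?\<omega> "[D1]" x'] \<omega>' xm \<alpha>\<beta> by simp
  have *: "N m \<omega> (F ?\<omega> a x) \<le> K * N m \<omega> ?y'" if a: "a \<in> G" for a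
  proof (cases "F ?\<omega> a x \<in> J k ?\<omega>")
    case True
    have mid: "F ?\<omega> a x \<in> {\<tau> k..1 - \<tau> k}" "F ?\<omega> a x \<in> {0<..<1}"
      using J_middle[OF \<omega>' True] J_inner[OF \<omega>' True] by auto
    show ?thesis unfolding N_def Z_def sum_distrib_left
    proof (rule sum_mono)
      fix w assume w: "w \<in> W m"
      have "\<bar>Dw w \<omega> (F ?\<omega> a x)\<bar> powr t * one \<omega> (Fw w \<omega> (F ?\<omega> a x)) \<le>
        (K * \<bar>Dw w \<omega> ?y'\<bar> powr t) * one \<omega> (Fw w \<omega> ?y')"
        using Dw_powr_compare[OF \<omega> w mid(1) y'01] one_transfer[OF \<omega> w mid(2) x(2)[unfolded Suc]] K_ge_1
        by (intro mult_mono) auto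
      then show "\<bar>Dw w \<omega> (F ?\<omega> a x)\<bar> powr t * one \<omega> (Fw w \<omega> (F ?\<omega> a x)) \<le>
        K * (\<bar>Dw w \<omega> ?y'\<bar> powr t * one \<omega> (Fw w \<omega> ?y'))" by (simp add: mult_ac)
    qed
  next
    case False
    have "F ?\<omega> a x \<in> {0..1}" using F_mem01[OF \<omega>' a] xm by auto
    then have "N m \<omega> (F ?\<omega> a x) = 0" using N_outside[OF \<omega>] False by auto
    then show ?thesis using K_ge_1 N_nonneg[of m \<omega> ?y'] by simp
  qed
  have "N n \<omega> x = (\<Sum>a\<in>G. \<bar>F1 ?\<omega> a x\<bar> powr t * N m \<omega> (F ?\<omega> a x))"
    unfolding N_def Suc Z_Suc_last ..
  also have "\<dots> \<le> (\<Sum>a\<in>G. K * (K * N m \<omega> ?y'))"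
    using * F1_powr_le[OF \<omega>' _ xm(1)] K_ge_1 N_nonneg by (intro sum_mono mult_mono) auto
  also have "\<dots> = card G * K * K * N m \<omega> ?y'" by simp
  also have "\<dots> \<le> card G * K * K * (A powr t * N n \<omega> x')"
  proof (rule mult_left_mono)
    have "A powr t * ((1 / A) powr t * N m \<omega> ?y') \<le> A powr t * N n \<omega> x'"
      using N_Suc_ge[OF \<omega> x(2)[unfolded Suc]] unfolding Suc by (intro mult_left_mono) auto
    moreover have "A powr t * (1 / A) powr t = 1" using A_pos by (simp flip: powr_mult)
    ultimately show "N m \<omega> ?y' \<le> A powr t * N n \<omega> x'" by (simp flip: mult.assoc)
  qed (use K_ge_1 in auto)
  finally show ?thesis by (simp add: C_def mult_ac)
qed

section \<open>Normalised iterates as Markov averages\<close>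

definition R :: "nat \<Rightarrow> 'w \<Rightarrow> (real \<Rightarrow> real) \<Rightarrow> real \<Rightarrow> real" where
  "R n \<omega> g x = Z n \<omega> (cut \<omega> g) x / N n \<omega> x"

text \<open>Transition probabilities of a backward chain: starting from x over time n + m, the
  probability of passing down to time n along the letters \<open>u\<close>. The factor
  \<open>N n\<close> and the quotient are the normalisation that makes them sum to 1.\<close>

definition P :: "nat \<Rightarrow> nat \<Rightarrow> 'w \<Rightarrow> real \<Rightarrow> real set list \<Rightarrow> real" where
  "P n m \<omega> x u = \<bar>Dw u ((\<theta> ^^ n) \<omega>) x\<bar> powr t * N n \<omega> (Fw u ((\<theta> ^^ n) \<omega>) x) / N (n + m) \<omega> x"

lemma P_nonneg: "0 \<le> P n m \<omega> x u"
  unfolding P_def using N_nonneg by simp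

lemma sum_P:
  assumes "\<omega> \<in> space M" "x \<in> J k ((\<theta> ^^ (n + m)) \<omega>)"
  shows "sum (P n m \<omega> x) (W m) = 1"
proof -
  have "sum (P n m \<omega> x) (W m) = N (n + m) \<omega> x / N (n + m) \<omega> x"
    unfolding P_def sum_divide_distrib[symmetric] by (simp add: N_def Z_add)
  then show ?thesis using N_pos[OF assms] by simp
qed

lemma P_nonzero:
  assumes "\<omega> \<in> space M" "x \<in> J k ((\<theta> ^^ (n + m)) \<omega>)" "u \<in> W m" "P n m \<omega> x u \<noteq> 0"
  shows "Fw u ((\<theta> ^^ n) \<omega>) x \<in> J k ((\<theta> ^^ n) \<omega>)"
proof (rule ccontr)
  assume *: "\<not> ?thesis"
  have "x \<in> {0<..<1}" using J_inner \<theta>n_in assms(1,2) by blast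
  then have "Fw u ((\<theta> ^^ n) \<omega>) x \<in> {0..1}"
    using Fw_mem01[OF \<theta>n_in[OF assms(1)] W_D(1)[OF assms(3)], of x n] by auto
  then have "N n \<omega> (Fw u ((\<theta> ^^ n) \<omega>) x) = 0" using N_outside[OF assms(1) _ *] by auto
  then show False using assms(4) by (simp add: P_def)
qed

text \<open>Averaging over the letters between times n and n + m expresses a later normalised
  iterate as a convex combination of earlier ones, so its range over the fibre can only
  shrink.\<close>

lemma R_convex:
  assumes "\<omega> \<in> space M" "x \<in> J k ((\<theta> ^^ (n + m)) \<omega>)"
  shows "R (n + m) \<omega> g x = (\<Sum>u\<in>W m. P n m \<omega> x u * R n \<omega> g (Fw u ((\<theta> ^^ n) \<omega>) x))"
proof -
  have x01: "x \<in> {0..1}" using J_inner[OF \<theta>n_in[OF assms(1)] assms(2)] by auto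
  have "\<bar>Dw u ((\<theta> ^^ n) \<omega>) x\<bar> powr t * Z n \<omega> (cut \<omega> g) (Fw u ((\<theta> ^^ n) \<omega>) x) / N (n + m) \<omega> x
      = P n m \<omega> x u * R n \<omega> g (Fw u ((\<theta> ^^ n) \<omega>) x)" if u: "u \<in> W m" for u
  proof (cases "Fw u ((\<theta> ^^ n) \<omega>) x \<in> J k ((\<theta> ^^ n) \<omega>)")
    case True
    then show ?thesis using N_pos[OF assms(1) True] by (simp add: P_def R_def)
  next
    \<comment> \<open>Off the fibre \<open>N n\<close> vanishes and the quotient \<open>R n\<close>
      is 0 by division by zero; the left side is 0 as well.\<close>
    case False
    have y: "Fw u ((\<theta> ^^ n) \<omega>) x \<in> {0..1}"
      using Fw_mem01[OF \<theta>n_in[OF assms(1)] W_D(1)[OF u] x01] .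
    have "Z n \<omega> (cut \<omega> g) (Fw u ((\<theta> ^^ n) \<omega>) x) = 0"
      unfolding Z_def cut_def using one_Fw_outside[OF assms(1) _ y False] by (intro sum.neutral) auto
    then show ?thesis by (simp add: R_def)
  qed
  then show ?thesis
    unfolding R_def[of "n + m"] Z_add sum_divide_distrib by (intro sum.cong) auto
qed

lemma R_bound:
  assumes "\<omega> \<in> space M" "x \<in> J k ((\<theta> ^^ n) \<omega>)" "\<And>y. y \<in> J k \<omega> \<Longrightarrow> \<bar>g y\<bar> \<le> B"
  shows "\<bar>R n \<omega> g x\<bar> \<le> B"
  using Z_cut_bound[OF assms(3), where n=n and x=x] N_pos[OF assms(1,2)]
  by (simp add: R_def abs_divide divide_le_eq)

lemma Fw_D1_tail_close:
  assumes \<omega>: "\<omega> \<in> space M" and u: "u \<in> W m"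
    and x: "x \<in> J k ((\<theta> ^^ Suc m) \<omega>)" "x' \<in> J k ((\<theta> ^^ Suc m) \<omega>)"
    and J: "Fw (u @ [D1]) \<omega> x \<in> J k \<omega>"
  shows "\<bar>Fw (u @ [D1]) \<omega> x - Fw (u @ [D1]) \<omega> x'\<bar> \<le> \<rho> k ^ (Suc m div Suc k)"
proof -
  have s: "set (u @ [D1]) \<subseteq> G" "length (u @ [D1]) = Suc m" using W_D[OF u] \<alpha>\<beta>(7) by auto
  have x01: "x \<in> {0<..<1}" "x' \<in> {0<..<1}" using J_inner[OF \<theta>n_in[OF \<omega>]] x by blast+
  have "\<bar>Fw (u @ [D1]) \<omega> x - Fw (u @ [D1]) \<omega> x'\<bar> \<le> \<bar>Fw (u @ [D1]) \<omega> 1 - Fw (u @ [D1]) \<omega> 0\<bar>"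
    using x01 by (intro Fw_diff_le \<omega> s) auto
  also have "\<dots> \<le> \<rho> k ^ (Suc m div Suc k)"
    using Fw_contract[OF \<omega> s(1) x01(1) J] s(2) by simp
  finally show ?thesis .
qed

text \<open>A final letter \<open>D1\<close> ends every run of \<open>D0\<close>, so admissibility
  does not depend on the base point: \<open>one_transfer\<close> applies in both directions.\<close>

lemma one_D1_eq:
  assumes "\<omega> \<in> space M" "w \<in> W n" "x \<in> J k ((\<theta> ^^ Suc n) \<omega>)" "x' \<in> J k ((\<theta> ^^ Suc n) \<omega>)"
  shows "one \<omega> (Fw (w @ [D1]) \<omega> x) = one \<omega> (Fw (w @ [D1]) \<omega> x')"
proof -
  have x01: "x \<in> {0<..<1}" "x' \<in> {0<..<1}" using J_inner[OF \<theta>n_in[OF assms(1)]] assms(3,4) by blast+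
  have "F ((\<theta> ^^ n) \<omega>) D1 x \<in> {0<..<1}" "F ((\<theta> ^^ n) \<omega>) D1 x' \<in> {0<..<1}"
    using Fw_inner[of "(\<theta> ^^ n) \<omega>" "[D1]"] assms(1) x01 \<alpha>\<beta>(7) by simp_all
  then show ?thesis
    using one_transfer[OF assms(1,2) _ assms(4)] one_transfer[OF assms(1,2) _ assms(3)] W_D(2)[OF assms(2)]
    by (simp add: Fw_append order_antisym)
qed

text \<open>Two base points followed along the same tail \<open>u @ [D1]\<close> come within \<eta>
  of each other. The words before it are then admissible for both or for neither, their weights
  agree up to the factor \<open>r\<close>, which tends to 1 with \<eta>, and the values of
  \<open>g\<close> differ by at most e.\<close>

lemma R_close:
  fixes n m defines "\<eta> \<equiv> \<rho> k ^ (Suc m div Suc k)"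
  assumes \<omega>: "\<omega> \<in> space M" and u: "u \<in> W m"
    and x: "x \<in> J k ((\<theta> ^^ (n + Suc m)) \<omega>)" "x' \<in> J k ((\<theta> ^^ (n + Suc m)) \<omega>)"
    and J: "Fw (u @ [D1]) ((\<theta> ^^ n) \<omega>) x \<in> J k ((\<theta> ^^ n) \<omega>)"
    and g: "\<And>y. y \<in> J k \<omega> \<Longrightarrow> \<bar>g y\<bar> \<le> B"
    and e: "\<And>y y'. y \<in> J k \<omega> \<Longrightarrow> y' \<in> J k \<omega> \<Longrightarrow> \<bar>y - y'\<bar> \<le> \<eta> \<Longrightarrow> \<bar>g y - g y'\<bar> \<le> e"
  shows "\<bar>R n \<omega> g (Fw (u @ [D1]) ((\<theta> ^^ n) \<omega>) x) - R n \<omega> g (Fw (u @ [D1]) ((\<theta> ^^ n) \<omega>) x')\<bar>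
    \<le> ((((1 + \<eta> / \<tau> k)\<^sup>2) powr t)\<^sup>2 - 1) * B + e"
proof -
  let ?\<omega> = "(\<theta> ^^ n) \<omega>"
  define y where "y = Fw (u @ [D1]) ?\<omega> x"
  define y' where "y' = Fw (u @ [D1]) ?\<omega> x'"
  define r where "r = ((1 + \<eta> / \<tau> k)\<^sup>2) powr t"
  have \<omega>n: "?\<omega> \<in> space M" using \<omega> by simp
  have sh: "(\<theta> ^^ j) ((\<theta> ^^ n) \<omega>) = (\<theta> ^^ (n + j)) \<omega>" for j
    by (simp add: funpow_add add.commute[of n])
  have one_eq: "one \<omega> (Fw w \<omega> y) = one \<omega> (Fw w \<omega> y')" if w: "w \<in> W n" for w
  proof -
    have "w @ u \<in> W (n + m)" using w u by (auto simp: W_def)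
    then have "one \<omega> (Fw ((w @ u) @ [D1]) \<omega> x) = one \<omega> (Fw ((w @ u) @ [D1]) \<omega> x')"
      using \<omega> x by (intro one_D1_eq) auto
    then show ?thesis using W_D(2)[OF w] by (simp add: y_def y'_def Fw_append)
  qed
  have one_eq2: "one ?\<omega> y = one ?\<omega> y'"
    unfolding y_def y'_def using x \<omega>n u by (intro one_D1_eq) (auto simp: sh)
  have yJ: "y \<in> J k ?\<omega>" using J by (simp add: y_def)
  then have y'J: "y' \<in> J k ?\<omega>" using one_eq2 by (simp add: indicator_def split: if_splits)
  have yy': "\<bar>y - y'\<bar> \<le> \<eta>" unfolding y_def y'_def \<eta>_def
    by (rule Fw_D1_tail_close[OF \<omega>n u]) (use x J in \<open>simp_all add: sh\<close>)
  have \<eta>0: "0 \<le> \<eta>" unfolding \<eta>_def using \<rho>_bounds[of k] by simp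
  have Dr: "\<bar>Dw w \<omega> a\<bar> powr t \<le> r * \<bar>Dw w \<omega> b\<bar> powr t"
    if w: "w \<in> W n" and ab: "a \<in> J k ?\<omega>" "b \<in> J k ?\<omega>" "\<bar>a - b\<bar> \<le> \<eta>" for w a b
  proof -
    have "\<bar>Dw w \<omega> a\<bar> \<le> \<bar>Dw w \<omega> b\<bar> * (1 + \<bar>a - b\<bar> / \<tau> k)\<^sup>2"
      by (rule Dw_koebe(1)[OF \<omega> W_D(1)[OF w] J_middle[OF \<omega>n ab(1)] J_inner[OF \<omega>n ab(2)]])
    also have "\<dots> \<le> \<bar>Dw w \<omega> b\<bar> * (1 + \<eta> / \<tau> k)\<^sup>2"
      using ab(3) \<tau>_pos[of k] by (intro mult_left_mono power_mono add_left_mono divide_right_mono) auto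
    finally have "\<bar>Dw w \<omega> a\<bar> powr t \<le> (\<bar>Dw w \<omega> b\<bar> * (1 + \<eta> / \<tau> k)\<^sup>2) powr t"
      using t_nonneg by (intro powr_mono2) auto
    then show ?thesis by (simp add: powr_mult r_def mult.commute)
  qed
  \<comment> \<open>No sign is assumed for \<open>B\<close>; the fibre contains a point reached
    along letters \<open>D1\<close>, and there \<open>B\<close> bounds an absolute value.\<close>
  have Bnn: "0 \<le> B"
  proof -
    have "\<exists>w\<in>W n. Fw w \<omega> y \<in> J k \<omega>"
      using Fw_D1s[OF \<omega> yJ] \<alpha>\<beta>(7) by (intro bexI[of _ "replicate n D1"]) (auto simp: W_def)
    then show ?thesis using g by fastforce
  qed
  define p where "p w = \<bar>Dw w \<omega> y\<bar> powr t * one \<omega> (Fw w \<omega> y)" for w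
  define p' where "p' w = \<bar>Dw w \<omega> y'\<bar> powr t * one \<omega> (Fw w \<omega> y')" for w
  have Np: "N n \<omega> y = sum p (W n)" "N n \<omega> y' = sum p' (W n)" by (simp_all add: N_def Z_def p_def p'_def)
  have "\<bar>(\<Sum>w\<in>W n. p w * g (Fw w \<omega> y)) / sum p (W n) - (\<Sum>w\<in>W n. p' w * g (Fw w \<omega> y')) / sum p' (W n)\<bar>
    \<le> (r\<^sup>2 - 1) * B + e"
  proof (rule weighted_average_diff)
    have "1 powr t \<le> r" unfolding r_def using \<eta>0 \<tau>_pos[of k] t_nonneg by (intro powr_mono2) (auto simp: one_le_power)
    then show "1 \<le> r" by simp
    show "0 < sum p (W n)" "0 < sum p' (W n)" using N_pos[OF \<omega> yJ] N_pos[OF \<omega> y'J] Np by simp_all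
    fix w assume w: "w \<in> W n"
    show "0 \<le> p w" "0 \<le> p' w" by (simp_all add: p_def p'_def)
    have "\<bar>Dw w \<omega> y\<bar> powr t \<le> r * \<bar>Dw w \<omega> y'\<bar> powr t" "\<bar>Dw w \<omega> y'\<bar> powr t \<le> r * \<bar>Dw w \<omega> y\<bar> powr t"
      using Dr[OF w yJ y'J] Dr[OF w y'J yJ] yy' by (simp_all add: abs_minus_commute)
    then have "\<bar>Dw w \<omega> y\<bar> powr t * one \<omega> (Fw w \<omega> y') \<le> (r * \<bar>Dw w \<omega> y'\<bar> powr t) * one \<omega> (Fw w \<omega> y')"
      "\<bar>Dw w \<omega> y'\<bar> powr t * one \<omega> (Fw w \<omega> y') \<le> (r * \<bar>Dw w \<omega> y\<bar> powr t) * one \<omega> (Fw w \<omega> y')"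
      by (simp_all add: mult_right_mono)
    then show "p w \<le> r * p' w" "p' w \<le> r * p w"
      by (simp_all add: p_def p'_def one_eq[OF w] mult.assoc)
    assume "p w \<noteq> 0"
    then have wJ: "Fw w \<omega> y \<in> J k \<omega>" by (auto simp: p_def indicator_def split: if_splits)
    then have wJ': "Fw w \<omega> y' \<in> J k \<omega>" using one_eq[OF w] by (simp add: indicator_def split: if_splits)
    show "\<bar>g (Fw w \<omega> y)\<bar> \<le> B" using g wJ by simp
    have "\<bar>Fw w \<omega> y - Fw w \<omega> y'\<bar> \<le> \<rho> k ^ (Suc (n + m) div Suc k)"
    proof -
      have "w @ u \<in> W (n + m)" using w u by (auto simp: W_def)
      moreover have "Fw w \<omega> y = Fw ((w @ u) @ [D1]) \<omega> x" "Fw w \<omega> y' = Fw ((w @ u) @ [D1]) \<omega> x'"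
        using W_D(2)[OF w] by (simp_all add: y_def y'_def Fw_append)
      ultimately show ?thesis
        using Fw_D1_tail_close[OF \<omega>, of "w @ u" "n + m" x x'] x wJ by simp
    qed
    \<comment> \<open>Over \<omega> the word has n more letters than the tail, so the contraction is
      at least as strong.\<close>
    also have "\<dots> \<le> \<eta>" unfolding \<eta>_def using \<rho>_bounds[of k] by (intro power_decreasing div_le_mono) auto
    finally show "\<bar>g (Fw w \<omega> y) - g (Fw w \<omega> y')\<bar> \<le> e" using e wJ wJ' by blast
  qed (use Bnn in auto)
  moreover have "R n \<omega> g y = (\<Sum>w\<in>W n. p w * g (Fw w \<omega> y)) / sum p (W n)"
    "R n \<omega> g y' = (\<Sum>w\<in>W n. p' w * g (Fw w \<omega> y')) / sum p' (W n)"
    unfolding R_def Np by (simp_all add: Z_def cut_def p_def p'_def mult.assoc)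
  ultimately show ?thesis unfolding y_def y'_def r_def by simp
qed

text \<open>The factors c and \<delta> of \<open>coupling_bound\<close>, supplied by
  \<open>P_compare\<close> and \<open>P_mass_D1\<close>. Their product is the share of the
  oscillation removed by one coupling, uniformly in \<omega>, n and m.\<close>

definition gap :: real where
  "gap = 1 / (K * C * C) * ((1 / A) powr t / (card G * K * C))"

lemma gap_pos: "0 < gap"
proof -
  have "0 < card G" using \<alpha>\<beta>(6) finite_G by (auto simp: card_gt_0_iff)
  then show ?thesis unfolding gap_def using K_ge_1 C_ge_1 A_pos by simp
qed

text \<open>K accounts for the derivatives along the tail, one factor C for \<open>N n\<close> at
  the two images, the other C for the normalising sums.\<close>

lemma P_compare:
  assumes \<omega>: "\<omega> \<in> space M" and u: "u \<in> W m"
    and x: "x \<in> J k ((\<theta> ^^ (n + Suc m)) \<omega>)" "x' \<in> J k ((\<theta> ^^ (n + Suc m)) \<omega>)"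
  shows "1 / (K * C * C) * P n (Suc m) \<omega> x' (u @ [D1]) \<le> P n (Suc m) \<omega> x (u @ [D1])"
proof -
  let ?\<omega> = "(\<theta> ^^ n) \<omega>"
  define y where "y = Fw (u @ [D1]) ?\<omega> x"
  define y' where "y' = Fw (u @ [D1]) ?\<omega> x'"
  have \<omega>n: "?\<omega> \<in> space M" using \<omega> by simp
  have sh: "(\<theta> ^^ j) ((\<theta> ^^ n) \<omega>) = (\<theta> ^^ (n + j)) \<omega>" for j
    by (simp add: funpow_add add.commute[of n])
  have vW: "u @ [D1] \<in> W (Suc m)" using u \<alpha>\<beta>(7) by (auto simp: W_def)
  have x01: "x \<in> {0<..<1}" "x' \<in> {0<..<1}" using J_inner[OF \<theta>n_in[OF \<omega>]] x by blast+
  have xm: "x' \<in> {\<tau> k..1 - \<tau> k}" using J_middle[OF \<theta>n_in[OF \<omega>] x(2)] .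
  have y01: "y \<in> {0..1}" "y' \<in> {0..1}"
    unfolding y_def y'_def using x01 by (auto intro!: Fw_mem01[OF \<omega>n W_D(1)[OF vW]] simp del: atLeastAtMost_iff) auto
  have one_eq: "one ?\<omega> y = one ?\<omega> y'"
    unfolding y_def y'_def using x \<omega>n u by (intro one_D1_eq) (auto simp: sh)
  have Nc: "N n \<omega> y' \<le> C * N n \<omega> y"
  proof (cases "y' \<in> J k ?\<omega>")
    case True
    then have "y \<in> J k ?\<omega>" using one_eq by (simp add: indicator_def split: if_splits)
    then show ?thesis using N_compare[OF \<omega> True] by blast
  next
    case False
    then show ?thesis using N_outside[OF \<omega> y01(2)] N_nonneg C_ge_1 by simp
  qed
  have "P n (Suc m) \<omega> x' (u @ [D1]) = \<bar>Dw (u @ [D1]) ?\<omega> x'\<bar> powr t * N n \<omega> y' * (1 / N (n + Suc m) \<omega> x')"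
    by (simp add: P_def y'_def)
  also have "\<dots> \<le> (K * \<bar>Dw (u @ [D1]) ?\<omega> x\<bar> powr t) * (C * N n \<omega> y) * (C / N (n + Suc m) \<omega> x)"
  proof (intro mult_mono)
    show "\<bar>Dw (u @ [D1]) ?\<omega> x'\<bar> powr t \<le> K * \<bar>Dw (u @ [D1]) ?\<omega> x\<bar> powr t"
      by (rule Dw_powr_compare[OF \<omega>n vW xm x01(1)])
    have "N (n + Suc m) \<omega> x \<le> C * N (n + Suc m) \<omega> x'" using N_compare[OF \<omega> x] .
    then show "1 / N (n + Suc m) \<omega> x' \<le> C / N (n + Suc m) \<omega> x"
      using N_pos[OF \<omega> x(1)] N_pos[OF \<omega> x(2)] by (simp add: field_simps)
  qed (use Nc N_nonneg K_ge_1 C_ge_1 in auto)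
  also have "\<dots> = K * C * C * P n (Suc m) \<omega> x (u @ [D1])" by (simp add: P_def y_def)
  finally show ?thesis using K_ge_1 C_ge_1 by (simp add: field_simps)
qed

text \<open>All last letters together weigh at most \<open>card G * K * C\<close> times the
  partition sum over the \<open>D1\<close>-preimage of x, while the letter \<open>D1\<close> alone
  contributes at least A^(-t) times that sum.\<close>

lemma P_mass_D1:
  assumes \<omega>: "\<omega> \<in> space M" and x: "x \<in> J k ((\<theta> ^^ (n + Suc m)) \<omega>)"
  shows "(1 / A) powr t / (card G * K * C) \<le> (\<Sum>u\<in>W m. P n (Suc m) \<omega> x (u @ [D1]))"
proof -
  let ?\<omega> = "(\<theta> ^^ (n + m)) \<omega>"
  have \<omega>': "?\<omega> \<in> space M" using \<omega> by simp
  have x': "x \<in> J k (\<theta> ?\<omega>)" using x by simp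
  have xm: "x \<in> {\<tau> k..1 - \<tau> k}" "x \<in> {0<..<1}"
    using J_middle[OF _ x'] J_inner[OF _ x'] \<omega>' by auto
  let ?y = "F ?\<omega> D1 x"
  have yJ: "?y \<in> J k ?\<omega>" using J_F1[OF \<omega>' x'] xm k_pos by auto
  have sh: "(\<theta> ^^ m) ((\<theta> ^^ n) \<omega>) = ?\<omega>" by (simp add: funpow_add add.commute[of n])
  have "N (n + Suc m) \<omega> x = (\<Sum>a\<in>G. \<bar>F1 ?\<omega> a x\<bar> powr t * N (n + m) \<omega> (F ?\<omega> a x))"
    unfolding N_def add_Suc_right Z_Suc_last ..
  also have "\<dots> \<le> (\<Sum>a\<in>G. K * (C * N (n + m) \<omega> ?y))"
  proof (rule sum_mono)
    fix a assume a: "a \<in> G"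
    have "N (n + m) \<omega> (F ?\<omega> a x) \<le> C * N (n + m) \<omega> ?y"
    proof (cases "F ?\<omega> a x \<in> J k ?\<omega>")
      case True then show ?thesis using N_compare[OF \<omega> True yJ] by simp
    next
      case False
      have "F ?\<omega> a x \<in> {0..1}" using F_mem01[OF \<omega>' a] xm by auto
      then show ?thesis using N_outside[OF \<omega> _ False] N_nonneg C_ge_1 by simp
    qed
    then show "\<bar>F1 ?\<omega> a x\<bar> powr t * N (n + m) \<omega> (F ?\<omega> a x) \<le> K * (C * N (n + m) \<omega> ?y)"
      using F1_powr_le[OF \<omega>' a xm(1)] K_ge_1 N_nonneg by (intro mult_mono) auto
  qed
  also have "\<dots> = card G * K * C * N (n + m) \<omega> ?y" by simp
  finally have up: "N (n + Suc m) \<omega> x \<le> card G * K * C * N (n + m) \<omega> ?y" .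
  have "(\<Sum>u\<in>W m. P n (Suc m) \<omega> x (u @ [D1])) = \<bar>F1 ?\<omega> D1 x\<bar> powr t * N (n + m) \<omega> ?y / N (n + Suc m) \<omega> x"
    unfolding N_def Z_add P_def sum_divide_distrib sum_distrib_left
    by (intro sum.cong) (simp_all add: Fw_append Dw_append W_D sh abs_mult powr_mult)
  also have "\<dots> \<ge> (1 / A) powr t * N (n + m) \<omega> ?y / N (n + Suc m) \<omega> x"
    using F1_powr_ge[OF \<omega>' \<alpha>\<beta>(7) xm(2)] N_nonneg by (intro divide_right_mono mult_right_mono) auto
  moreover have "(1 / A) powr t * N (n + m) \<omega> ?y / N (n + Suc m) \<omega> x \<ge> (1 / A) powr t / (card G * K * C)"
  proof -
    have "0 < card G" using \<alpha>\<beta>(6) finite_G by (auto simp: card_gt_0_iff)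
    then have g: "0 < card G * K * C" using K_ge_1 C_ge_1 by simp
    have "(1 / A) powr t * N (n + Suc m) \<omega> x \<le> (1 / A) powr t * (card G * K * C * N (n + m) \<omega> ?y)"
      using up by (intro mult_left_mono) auto
    then show ?thesis using g N_pos[OF \<omega> x] by (simp add: divide_simps mult_ac)
  qed
  ultimately show ?thesis by linarith
qed

text \<open>Doeblin coupling: among the words leading to \<open>x\<close> and \<open>x'\<close>, those ending in \<open>D1\<close> are admissible
  for both points or for neither, and they carry a definite part of the mass.\<close>

lemma R_step:
  fixes n m defines "\<eta> \<equiv> \<rho> k ^ (Suc m div Suc k)"
  assumes \<omega>: "\<omega> \<in> space M"
    and x: "x \<in> J k ((\<theta> ^^ (n + Suc m)) \<omega>)" "x' \<in> J k ((\<theta> ^^ (n + Suc m)) \<omega>)"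
    and g: "\<And>y. y \<in> J k \<omega> \<Longrightarrow> \<bar>g y\<bar> \<le> B" and nn: "0 \<le> B" "0 \<le> e"
    and e: "\<And>y y'. y \<in> J k \<omega> \<Longrightarrow> y' \<in> J k \<omega> \<Longrightarrow> \<bar>y - y'\<bar> \<le> \<eta> \<Longrightarrow> \<bar>g y - g y'\<bar> \<le> e"
    and lohi: "\<And>y. y \<in> J k ((\<theta> ^^ n) \<omega>) \<Longrightarrow> lo \<le> R n \<omega> g y \<and> R n \<omega> g y \<le> hi" "lo \<le> hi"
  shows "R (n + Suc m) \<omega> g x - R (n + Suc m) \<omega> g x' \<le>
    (1 - gap) * (hi - lo) + (((((1 + \<eta> / \<tau> k)\<^sup>2) powr t)\<^sup>2 - 1) * B + e)"
  unfolding R_convex[OF \<omega> x(1)] R_convex[OF \<omega> x(2)] gap_def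
proof (rule coupling_bound)
  let ?E = "(\<lambda>u. u @ [D1]) ` W m"
  show "?E \<subseteq> W (Suc m)" using \<alpha>\<beta>(7) by (auto simp: W_def)
  show "1 / (K * C * C) * P n (Suc m) \<omega> x' u \<le> P n (Suc m) \<omega> x u" if "u \<in> ?E" for u
    using that P_compare[OF \<omega> _ x] by auto
  have "1 \<le> K * C * C" using K_ge_1 C_ge_1 mult_mono[of 1 K 1 C] mult_mono[of 1 "K * C" 1 C] by auto
  then show "0 < 1 / (K * C * C)" "1 / (K * C * C) \<le> 1" using K_ge_1 C_ge_1 by auto
  show "(1 / A) powr t / (real (card G) * K * C) \<le> sum (P n (Suc m) \<omega> x') ?E"
    using P_mass_D1[OF \<omega> x(2)] by (subst sum.reindex) (auto simp: inj_on_def)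
  show "sum (P n (Suc m) \<omega> x) (W (Suc m)) = 1" "sum (P n (Suc m) \<omega> x') (W (Suc m)) = 1"
    using sum_P[OF \<omega>] x by auto
  have \<eta>0: "0 \<le> \<eta>" unfolding \<eta>_def using \<rho>_bounds[of k] by simp
  have "1 powr t \<le> ((1 + \<eta> / \<tau> k)\<^sup>2) powr t" using \<eta>0 \<tau>_pos[of k] t_nonneg by (intro powr_mono2) (auto simp: one_le_power)
  then have "1 \<le> (((1 + \<eta> / \<tau> k)\<^sup>2) powr t)\<^sup>2" by (simp add: one_le_power)
  then show "0 \<le> ((((1 + \<eta> / \<tau> k)\<^sup>2) powr t)\<^sup>2 - 1) * B + e" using nn by simp
  fix u assume vE: "u \<in> ?E" and nz: "P n (Suc m) \<omega> x' u \<noteq> 0"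
  then obtain u0 where u0: "u0 \<in> W m" "u = u0 @ [D1]" by auto
  have "u \<in> W (Suc m)" using u0 \<alpha>\<beta>(7) by (auto simp: W_def)
  then have "Fw u ((\<theta> ^^ n) \<omega>) x' \<in> J k ((\<theta> ^^ n) \<omega>)" using P_nonzero[OF \<omega> x(2) _ nz] by simp
  then show "R n \<omega> g (Fw u ((\<theta> ^^ n) \<omega>) x) - R n \<omega> g (Fw u ((\<theta> ^^ n) \<omega>) x') \<le>
      ((((1 + \<eta> / \<tau> k)\<^sup>2) powr t)\<^sup>2 - 1) * B + e"
    using R_close[OF \<omega> u0(1) x(2,1), of g B e] g e unfolding \<eta>_def u0(2) by (simp add: abs_minus_commute abs_le_iff)
next
  fix u assume u: "u \<in> W (Suc m)"
  show "R n \<omega> g (Fw u ((\<theta> ^^ n) \<omega>) x) \<le> hi" if "P n (Suc m) \<omega> x u \<noteq> 0"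
    using lohi(1)[OF P_nonzero[OF \<omega> x(1) u that]] by simp
  show "lo \<le> R n \<omega> g (Fw u ((\<theta> ^^ n) \<omega>) x')" if "P n (Suc m) \<omega> x' u \<noteq> 0"
    using lohi(1)[OF P_nonzero[OF \<omega> x(2) u that]] by simp
qed (use P_nonneg lohi(2) in auto)

text \<open>The maximal and minimal values over the fibre are monotone in n. For every e > 0 there
  is a tail length m, independent of n, with D (n + m + 1) \<le> (1 - gap) D n + e, so the limit l
  of the oscillation satisfies gap * l \<le> e. All base points are squeezed to the same
  limit.\<close>

lemma R_tendsto:
  assumes \<omega>: "\<omega> \<in> space M" and cont: "continuous_on (J k \<omega>) g"
  shows "\<exists>l. \<forall>xs. (\<forall>n. xs n \<in> J k ((\<theta> ^^ n) \<omega>)) \<longrightarrow> (\<lambda>n. R n \<omega> g (xs n)) \<longlonglongrightarrow> l"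
proof -
  have comp: "compact (J k \<omega>)" using J_compact[OF \<omega>] .
  obtain B where B: "0 \<le> B" "\<And>y. y \<in> J k \<omega> \<Longrightarrow> \<bar>g y\<bar> \<le> B"
  proof -
    have "bounded (g ` J k \<omega>)" using compact_continuous_image[OF cont comp] compact_imp_bounded by blast
    then obtain b where "0 < b" "\<forall>y\<in>J k \<omega>. norm (g y) \<le> b" by (auto simp: bounded_pos)
    then show ?thesis by (intro that[of b]) auto
  qed
  define S where "S n = R n \<omega> g ` J k ((\<theta> ^^ n) \<omega>)" for n
  define hi where "hi n = Sup (S n)" for n
  define lo where "lo n = Inf (S n)" for n
  have ne: "S n \<noteq> {}" for n using z_in_J[OF \<theta>n_in[OF \<omega>] k_pos] by (auto simp: S_def)
  have RB: "\<bar>R n \<omega> g x\<bar> \<le> B" if "x \<in> J k ((\<theta> ^^ n) \<omega>)" for n x using R_bound[OF \<omega> that B(2)] .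
  then have SB: "\<bar>s\<bar> \<le> B" if "s \<in> S n" for s n using that by (auto simp: S_def)
  have bdd: "bdd_above (S n)" "bdd_below (S n)" for n
    using SB by (auto intro!: bdd_aboveI[of _ B] bdd_belowI[of _ "- B"] simp: abs_le_iff) (metis minus_le_iff)
  have lohi: "lo n \<le> R n \<omega> g x \<and> R n \<omega> g x \<le> hi n" if "x \<in> J k ((\<theta> ^^ n) \<omega>)" for n x
    unfolding lo_def hi_def using bdd that by (auto intro!: cInf_lower cSup_upper simp: S_def)
  have lo_le_hi: "lo n \<le> hi n" for n using lohi[OF z_in_J[OF \<theta>n_in[OF \<omega>] k_pos]] order_trans by blast
  have sandwich: "lo n \<le> R (n + m) \<omega> g x \<and> R (n + m) \<omega> g x \<le> hi n" if x: "x \<in> J k ((\<theta> ^^ (n + m)) \<omega>)" for n m x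
  proof -
    have "P n m \<omega> x u * lo n \<le> P n m \<omega> x u * R n \<omega> g (Fw u ((\<theta> ^^ n) \<omega>) x)"
      "P n m \<omega> x u * R n \<omega> g (Fw u ((\<theta> ^^ n) \<omega>) x) \<le> P n m \<omega> x u * hi n" if "u \<in> W m" for u
      using lohi[OF P_nonzero[OF \<omega> x that]] P_nonneg
      by (cases "P n m \<omega> x u = 0"; simp add: mult_left_mono)+
    then have "(\<Sum>u\<in>W m. P n m \<omega> x u * lo n) \<le> R (n + m) \<omega> g x" "R (n + m) \<omega> g x \<le> (\<Sum>u\<in>W m. P n m \<omega> x u * hi n)"
      unfolding R_convex[OF \<omega> x] by (auto intro: sum_mono)
    then show ?thesis using sum_P[OF \<omega> x] by (simp flip: sum_distrib_right)
  qed
  have hi_dec: "hi (n + m) \<le> hi n" and lo_inc: "lo n \<le> lo (n + m)" for n m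
    unfolding hi_def[of "n + m"] lo_def[of "n + m"]
    using sandwich ne by (auto intro!: cSup_least cInf_greatest simp: S_def simp del: funpow.simps)
  define D where "D n = hi n - lo n" for n
  \<comment> \<open>The tail is taken so long that the distortion term and the oscillation of
    \<open>g\<close> at distance \<eta> are each at most e / 2.\<close>
  have step: "\<exists>m. \<forall>n. D (n + Suc m) \<le> (1 - gap) * D n + e" if e: "0 < e" for e
  proof -
    have "uniformly_continuous_on (J k \<omega>) g" using compact_uniformly_continuous[OF cont comp] .
    then obtain d where d: "0 < d" "\<And>y y'. y \<in> J k \<omega> \<Longrightarrow> y' \<in> J k \<omega> \<Longrightarrow> dist y' y < d \<Longrightarrow> dist (g y') (g y) < e / 2"
      unfolding uniformly_continuous_on_def using e by (metis half_gt_zero)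
    have \<eta>: "(\<lambda>m. \<rho> k ^ (Suc m div Suc k)) \<longlonglongrightarrow> 0"
      using \<rho>_bounds[of k]
      by (intro filterlim_compose[OF LIMSEQ_power_zero] filterlim_compose[OF filterlim_at_top_div_const_nat filterlim_Suc]) auto
    then have "(\<lambda>m. ((((1 + \<rho> k ^ (Suc m div Suc k) / \<tau> k)\<^sup>2) powr t)\<^sup>2 - 1) * B)
        \<longlonglongrightarrow> ((((1 + 0 / \<tau> k)\<^sup>2) powr t)\<^sup>2 - 1) * B"
      using \<tau>_pos[of k] by (intro tendsto_intros) auto
    then have "\<forall>\<^sub>F m in sequentially. ((((1 + \<rho> k ^ (Suc m div Suc k) / \<tau> k)\<^sup>2) powr t)\<^sup>2 - 1) * B < e / 2"
      using e by (intro order_tendstoD) auto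
    moreover have "\<forall>\<^sub>F m in sequentially. \<rho> k ^ (Suc m div Suc k) < d" using \<eta> d by (intro order_tendstoD) auto
    ultimately have "\<forall>\<^sub>F m in sequentially. ((((1 + \<rho> k ^ (Suc m div Suc k) / \<tau> k)\<^sup>2) powr t)\<^sup>2 - 1) * B < e / 2 \<and>
        \<rho> k ^ (Suc m div Suc k) < d" by eventually_elim simp
    then obtain m where m: "((((1 + \<rho> k ^ (Suc m div Suc k) / \<tau> k)\<^sup>2) powr t)\<^sup>2 - 1) * B < e / 2"
      "\<rho> k ^ (Suc m div Suc k) < d" by (auto simp: eventually_sequentially)
    have "D (n + Suc m) \<le> (1 - gap) * D n + e" for n
    proof -
      have diff: "R (n + Suc m) \<omega> g x - R (n + Suc m) \<omega> g x' \<le> (1 - gap) * D n + e"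
        if x: "x \<in> J k ((\<theta> ^^ (n + Suc m)) \<omega>)" "x' \<in> J k ((\<theta> ^^ (n + Suc m)) \<omega>)" for x x'
      proof -
        have "R (n + Suc m) \<omega> g x - R (n + Suc m) \<omega> g x' \<le> (1 - gap) * (hi n - lo n) +
            (((((1 + \<rho> k ^ (Suc m div Suc k) / \<tau> k)\<^sup>2) powr t)\<^sup>2 - 1) * B + e / 2)"
        proof (rule R_step[OF \<omega> x B(2) B(1) _ _ lohi lo_le_hi])
          fix y y' assume "y \<in> J k \<omega>" "y' \<in> J k \<omega>" "\<bar>y - y'\<bar> \<le> \<rho> k ^ (Suc m div Suc k)"
          then have "dist (g y) (g y') < e / 2" using m d(2)[of y' y] by (auto simp: dist_real_def)
          then show "\<bar>g y - g y'\<bar> \<le> e / 2" by (simp add: dist_real_def)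
        qed (use e in auto)
        then show ?thesis using m(1) unfolding D_def by linarith
      qed
      have "hi (n + Suc m) \<le> R (n + Suc m) \<omega> g x' + ((1 - gap) * D n + e)"
        if "x' \<in> J k ((\<theta> ^^ (n + Suc m)) \<omega>)" for x'
        unfolding hi_def[of "n + Suc m"]
      proof (rule cSup_least[OF ne])
        fix s assume "s \<in> S (n + Suc m)"
        then obtain x where "x \<in> J k ((\<theta> ^^ (n + Suc m)) \<omega>)" "s = R (n + Suc m) \<omega> g x" unfolding S_def by blast
        then show "s \<le> R (n + Suc m) \<omega> g x' + ((1 - gap) * D n + e)" using diff[OF _ that] by fastforce
      qed
      then have "hi (n + Suc m) - ((1 - gap) * D n + e) \<le> s" if "s \<in> S (n + Suc m)" for s
        using that unfolding S_def by fastforce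
      then have "hi (n + Suc m) - ((1 - gap) * D n + e) \<le> lo (n + Suc m)"
        unfolding lo_def[of "n + Suc m"] by (intro cInf_greatest[OF ne])
      then show ?thesis unfolding D_def by linarith
    qed
    then show ?thesis by blast
  qed
  have D0: "0 \<le> D n" for n using lo_le_hi by (simp add: D_def)
  have "decseq D" unfolding decseq_Suc_iff D_def using hi_dec[of _ 1] lo_inc[of _ 1] by (auto intro: diff_mono)
  then obtain l where l: "D \<longlonglongrightarrow> l" using decseq_convergent[of D 0] D0 by blast
  have "gap * l \<le> e" if e: "0 < e" for e
  proof -
    obtain m where m: "\<And>n. D (n + Suc m) \<le> (1 - gap) * D n + e" using step[OF e] by blast
    have "l \<le> (1 - gap) * l + e"
    proof (rule LIMSEQ_le[OF LIMSEQ_ignore_initial_segment[OF l, of "Suc m"]])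
      show "(\<lambda>n. (1 - gap) * D n + e) \<longlonglongrightarrow> (1 - gap) * l + e" using l by (intro tendsto_intros)
    qed (use m in simp)
    then show ?thesis by (simp add: algebra_simps)
  qed
  then have "gap * l \<le> 0" by (rule field_le_epsilon[of _ 0, simplified])
  then have "l \<le> 0" using gap_pos by (simp add: mult_le_0_iff)
  moreover have "0 \<le> l" using l D0 by (intro LIMSEQ_le_const) auto
  ultimately have Dl: "D \<longlonglongrightarrow> 0" using l by simp
  have "incseq lo" unfolding incseq_Suc_iff using lo_inc[of _ 1] by simp
  moreover have "lo n \<le> B" for n
    using lohi[OF z_in_J[OF \<theta>n_in[OF \<omega>] k_pos], of n] RB[OF z_in_J[OF \<theta>n_in[OF \<omega>] k_pos], of n] by linarith
  ultimately obtain b where b: "lo \<longlonglongrightarrow> b" using incseq_convergent[of lo B] by blast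
  have "(\<lambda>n. lo n + D n) \<longlonglongrightarrow> b + 0" using b Dl by (intro tendsto_intros)
  then have hb: "hi \<longlonglongrightarrow> b" by (simp add: D_def)
  show ?thesis
  proof (intro exI[of _ b] allI impI)
    fix xs assume "\<forall>n. xs n \<in> J k ((\<theta> ^^ n) \<omega>)"
    then show "(\<lambda>n. R n \<omega> g (xs n)) \<longlonglongrightarrow> b"
      using lohi by (intro tendsto_sandwich[OF _ _ b hb] always_eventually) auto
  qed
qed

section \<open>The limit functional and its representing measure\<close>

abbreviation "zn n \<omega> \<equiv> z ((\<theta> ^^ n) \<omega>)"

lemma zn_in_J: "\<omega> \<in> space M \<Longrightarrow> zn n \<omega> \<in> J k ((\<theta> ^^ n) \<omega>)"
  using z_in_J k_pos by simp

text \<open>Evaluated along the points \<open>zn n \<omega>\<close> because these depend measurably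
  on \<omega>; by \<open>\<Lambda>_limit\<close> any other choice of points gives the same
  value.\<close>

definition \<Lambda> :: "'w \<Rightarrow> (real \<Rightarrow> real) \<Rightarrow> real" where
  "\<Lambda> \<omega> g = lim (\<lambda>n. R n \<omega> g (zn n \<omega>))"

lemma \<Lambda>_limit:
  assumes "\<omega> \<in> space M" "continuous_on (J k \<omega>) g" "\<And>n. xs n \<in> J k ((\<theta> ^^ n) \<omega>)"
  shows "(\<lambda>n. R n \<omega> g (xs n)) \<longlonglongrightarrow> \<Lambda> \<omega> g"
proof -
  obtain l where l: "\<And>xs. (\<forall>n. xs n \<in> J k ((\<theta> ^^ n) \<omega>)) \<Longrightarrow> (\<lambda>n. R n \<omega> g (xs n)) \<longlonglongrightarrow> l"
    using R_tendsto[OF assms(1,2)] by blast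
  have "\<Lambda> \<omega> g = l" unfolding \<Lambda>_def using l[of "\<lambda>n. zn n \<omega>"] zn_in_J[OF assms(1)] by (intro limI) auto
  then show ?thesis using l[of xs] assms(3) by simp
qed

text \<open>Normalised iterates are integrals against discrete probability measures on the fibre,
  and a weak limit of these represents \<Lambda>. The full sequence of integrals converges to
  \<Lambda>, so passing to a subsequence does no harm.\<close>

lemma \<Lambda>_representation:
  assumes \<omega>: "\<omega> \<in> space M"
  shows "\<exists>\<nu>. real_distribution \<nu> \<and> measure \<nu> (J k \<omega>) = 1 \<and>
    (\<forall>g. continuous_on (J k \<omega>) g \<longrightarrow> (LINT x : J k \<omega> | \<nu>. g x) = \<Lambda> \<omega> g)"
proof -
  define p where "p n w = \<bar>Dw w \<omega> (zn n \<omega>)\<bar> powr t * one \<omega> (Fw w \<omega> (zn n \<omega>)) / N n \<omega> (zn n \<omega>)" for n w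
  have Npos: "0 < N n \<omega> (zn n \<omega>)" for n using N_pos[OF \<omega> zn_in_J[OF \<omega>]] .
  have "sum (p n) (W n) = N n \<omega> (zn n \<omega>) / N n \<omega> (zn n \<omega>)" for n
    unfolding p_def sum_divide_distrib[symmetric] by (simp add: N_def Z_def)
  then have p1: "sum (p n) (W n) = 1" for n using Npos[of n] by simp
  have pnn: "0 \<le> p n w" for n w using Npos[of n] by (simp add: p_def)
  have "\<forall>n. \<exists>\<mu>. real_distribution \<mu> \<and>
    (\<forall>f::real \<Rightarrow> real. f \<in> borel_measurable borel \<longrightarrow> integral\<^sup>L \<mu> f = (\<Sum>w\<in>W n. p n w * f (Fw w \<omega> (zn n \<omega>))))"
    by (rule allI, rule finite_weights_distribution[OF finite_W pnn p1])
  then obtain \<mu> where \<mu>: "\<And>n. real_distribution (\<mu> n)" and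
    int: "\<And>n f. f \<in> borel_measurable borel \<Longrightarrow> integral\<^sup>L (\<mu> n) f = (\<Sum>w\<in>W n. p n w * f (Fw w \<omega> (zn n \<omega>)))"
    by metis
  have comp: "compact (J k \<omega>)" using J_compact[OF \<omega>] .
  then have cl: "closed (J k \<omega>)" by (rule compact_imp_closed)
  have Jm [measurable]: "J k \<omega> \<in> sets borel" using cl by auto
  have p_out: "p n w * h (Fw w \<omega> (zn n \<omega>)) = p n w * h' (Fw w \<omega> (zn n \<omega>))"
    if "\<And>y. y \<in> J k \<omega> \<Longrightarrow> h y = h' y" for n w and h h' :: "real \<Rightarrow> real"
    using that by (cases "Fw w \<omega> (zn n \<omega>) \<in> J k \<omega>") (auto simp: p_def)
  have J1: "measure (\<mu> n) (J k \<omega>) = 1" for n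
  proof -
    interpret real_distribution "\<mu> n" by fact
    have "measure (\<mu> n) (J k \<omega>) = integral\<^sup>L (\<mu> n) (one \<omega>)" by simp
    also have "\<dots> = (\<Sum>w\<in>W n. p n w * one \<omega> (Fw w \<omega> (zn n \<omega>)))" by (rule int) measurable
    also have "\<dots> = (\<Sum>w\<in>W n. p n w * 1)" by (intro sum.cong refl p_out) auto
    finally show ?thesis using p1 by simp
  qed
  obtain r \<nu> where r0: "strict_mono (r :: nat \<Rightarrow> nat) \<and> real_distribution \<nu> \<and> measure \<nu> (J k \<omega>) = 1 \<and>
    (\<forall>f::real \<Rightarrow> real. continuous_on UNIV f \<longrightarrow> bounded (range f) \<longrightarrow>
       (\<lambda>n. integral\<^sup>L (\<mu> (r n)) f) \<longlonglongrightarrow> integral\<^sup>L \<nu> f)"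
    using compact_support_weak_limit[of "J k \<omega>" \<mu>, OF comp \<mu> J1] by - (elim exE, rule that)
  note r = r0[THEN conjunct1] r0[THEN conjunct2, THEN conjunct1] r0[THEN conjunct2, THEN conjunct2, THEN conjunct1]
    and conv = r0[THEN conjunct2, THEN conjunct2, THEN conjunct2, rule_format]
  interpret \<nu>: real_distribution \<nu> by fact
  have "(LINT x : J k \<omega> | \<nu>. g x) = \<Lambda> \<omega> g" if g: "continuous_on (J k \<omega>) g" for g :: "real \<Rightarrow> real"
  proof -
    have "bounded (g ` J k \<omega>)" using compact_continuous_image[OF g comp] compact_imp_bounded by blast
    then obtain B where B: "0 < B" "\<And>y. y \<in> J k \<omega> \<Longrightarrow> norm (g y) \<le> B" by (auto simp: bounded_pos)
    \<comment> \<open>\<open>g\<close> is known to be continuous on the fibre only; weak convergence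
      is tested on a bounded extension to the line.\<close>
    obtain h where h: "continuous_on UNIV h" "\<And>x. x \<in> J k \<omega> \<Longrightarrow> h x = g x" "\<And>x. norm (h x) \<le> B"
      using Tietze[OF g, of UNIV B] cl B by auto
    have hm [measurable]: "h \<in> borel_measurable borel" using h(1) by (rule borel_measurable_continuous_onI)
    have hb: "bounded (range h)" using h(3) by (auto simp: bounded_iff)
    have "integral\<^sup>L (\<mu> n) h = R n \<omega> g (zn n \<omega>)" for n
    proof -
      have "integral\<^sup>L (\<mu> n) h = (\<Sum>w\<in>W n. p n w * h (Fw w \<omega> (zn n \<omega>)))" by (rule int) measurable
      also have "\<dots> = (\<Sum>w\<in>W n. p n w * g (Fw w \<omega> (zn n \<omega>)))" by (intro sum.cong refl p_out h)
      also have "\<dots> = R n \<omega> g (zn n \<omega>)"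
        unfolding R_def Z_def sum_divide_distrib cut_def p_def by (simp add: mult.assoc)
      finally show ?thesis .
    qed
    then have "(\<lambda>n. R (r n) \<omega> g (zn (r n) \<omega>)) \<longlonglongrightarrow> integral\<^sup>L \<nu> h" using conv[OF h(1) hb] by simp
    moreover have "(\<lambda>n. R (r n) \<omega> g (zn (r n) \<omega>)) \<longlonglongrightarrow> \<Lambda> \<omega> g"
      using LIMSEQ_subseq_LIMSEQ[OF \<Lambda>_limit[OF \<omega> g, of "\<lambda>n. zn n \<omega>"] r(1)] zn_in_J[OF \<omega>] by (simp add: o_def)
    ultimately have "integral\<^sup>L \<nu> h = \<Lambda> \<omega> g" by (rule LIMSEQ_unique)
    moreover have "integral\<^sup>L \<nu> h = (\<integral>x. indicat_real (J k \<omega>) x *\<^sub>R g x \<partial>\<nu>)"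
    proof -
      have "AE x in \<nu>. x \<in> J k \<omega>" using r(3) by (intro \<nu>.AE_prob_1) auto
      then have "AE x in \<nu>. h x = indicat_real (J k \<omega>) x *\<^sub>R h x" by eventually_elim simp
      then have "integral\<^sup>L \<nu> h = (\<integral>x. indicat_real (J k \<omega>) x *\<^sub>R h x \<partial>\<nu>)"
        by (intro integral_cong_AE) auto
      also have "\<dots> = (\<integral>x. indicat_real (J k \<omega>) x *\<^sub>R g x \<partial>\<nu>)"
        by (intro Bochner_Integration.integral_cong) (auto simp: indicator_def h)
      finally show ?thesis .
    qed
    ultimately show ?thesis by (simp add: set_lebesgue_integral_def)
  qed
  then show ?thesis using r(2,3) by (intro exI[of _ \<nu>] conjI allI impI)
qed

lemma zn_measurable: "(\<lambda>\<omega>. zn n \<omega>) \<in> borel_measurable M"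
  by (rule measurable_compose[OF \<theta>n_measurable z_measurable])

lemma Z_measurable:
  assumes g: "g \<in> borel_measurable borel"
  shows "(\<lambda>\<omega>. Z n \<omega> (cut \<omega> g) (zn n \<omega>)) \<in> borel_measurable M"
  unfolding Z_def cut_def
proof (intro borel_measurable_sum borel_measurable_times)
  fix w assume w: "w \<in> W n"
  have zn01: "zn n \<omega> \<in> {0<..<1}" if "\<omega> \<in> space M" for \<omega>
    using J_inner[OF \<theta>n_in[OF that] zn_in_J[OF that]] .
  have [measurable]: "(\<lambda>\<omega>. Dw w \<omega> (zn n \<omega>)) \<in> borel_measurable M"
    by (rule Dw_measurable[OF W_D(1)[OF w] zn_measurable zn01])
  show "(\<lambda>\<omega>. \<bar>Dw w \<omega> (zn n \<omega>)\<bar> powr t) \<in> borel_measurable M" by measurable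
  have "(\<lambda>\<omega>. Fw w ((\<theta> ^^ 0) \<omega>) (zn n \<omega>)) \<in> borel_measurable M"
    by (rule Fw_measurable[OF W_D(1)[OF w] zn_measurable]) (use zn01 in \<open>auto simp: less_imp_le\<close>)
  then show "(\<lambda>\<omega>. g (Fw w \<omega> (zn n \<omega>))) \<in> borel_measurable M"
    using g by (simp add: measurable_compose[of _ _ borel])
  have "{\<omega> \<in> space M. Fw w ((\<theta> ^^ 0) \<omega>) (zn n \<omega>) \<in> J k ((\<theta> ^^ 0) \<omega>)} \<in> sets M"
    by (rule J_Fw_measurable[OF W_D(1)[OF w] zn_measurable]) (use zn_in_J W_D(2)[OF w] in auto)
  then have [measurable]: "{\<omega> \<in> space M. Fw w \<omega> (zn n \<omega>) \<in> J k \<omega>} \<in> sets M" by simp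
  have "(\<lambda>\<omega>. indicat_real {\<omega> \<in> space M. Fw w \<omega> (zn n \<omega>) \<in> J k \<omega>} \<omega>) \<in> borel_measurable M" by measurable
  then show "(\<lambda>\<omega>. one \<omega> (Fw w \<omega> (zn n \<omega>))) \<in> borel_measurable M"
    by (rule measurable_cong[THEN iffD1, rotated]) (auto simp: indicator_def)
qed

lemma cut_one [simp]: "cut \<omega> (\<lambda>x. 1) = one \<omega>" "cut \<omega> (one \<omega>) = one \<omega>"
  by (auto simp: cut_def indicator_def)

lemma N_measurable: "(\<lambda>\<omega>. N n \<omega> (zn n \<omega>)) \<in> borel_measurable M"
  using Z_measurable[of "\<lambda>x. 1" n] unfolding N_def by simp

lemma R_measurable: "g \<in> borel_measurable borel \<Longrightarrow> (\<lambda>\<omega>. R n \<omega> g (zn n \<omega>)) \<in> borel_measurable M"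
  unfolding R_def by (intro borel_measurable_divide Z_measurable N_measurable)

lemma \<Lambda>_measurable:
  assumes g: "continuous_on UNIV g"
  shows "(\<lambda>\<omega>. \<Lambda> \<omega> g) \<in> borel_measurable M"
proof (rule borel_measurable_LIMSEQ_real)
  show "(\<lambda>n. R n \<omega> g (zn n \<omega>)) \<longlonglongrightarrow> \<Lambda> \<omega> g" if "\<omega> \<in> space M" for \<omega>
    using g zn_in_J[OF that] by (intro \<Lambda>_limit that) (auto intro: continuous_on_subset)
  show "(\<lambda>\<omega>. R n \<omega> g (zn n \<omega>)) \<in> borel_measurable M" for n
    by (rule R_measurable[OF borel_measurable_continuous_onI[OF g]])
qed

section \<open>The truncated operator and the eigenvalue equation\<close>

text \<open>For each branch the fibre over \<theta> \<omega> is the union of two closed sets, where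
  the branch lies above or below \<open>q k\<close>. They are disjoint by \<open>q_notin_J\<close>,
  so the indicator of the fibre over \<omega> causes no jump.\<close>

lemma L_cut_continuous:
  assumes \<omega>: "\<omega> \<in> space M" and g: "continuous_on (J k \<omega>) g"
  shows "continuous_on (J k (\<theta> \<omega>)) (L \<omega> (cut \<omega> g))"
  unfolding L_def
proof (rule continuous_on_sum)
  fix a assume a: "a \<in> G"
  have \<omega>': "\<theta> \<omega> \<in> space M" using \<omega> by simp
  have J01: "J k (\<theta> \<omega>) \<subseteq> {0<..<1}" using J_inner[OF \<omega>'] by (rule subsetI)
  then have J01': "J k (\<theta> \<omega>) \<subseteq> {0..1}" by auto
  define Sa where "Sa = J k (\<theta> \<omega>) \<inter> F \<omega> a -` {q k \<omega>..}"
  define Ra where "Ra = J k (\<theta> \<omega>) \<inter> F \<omega> a -` {..q k \<omega>}"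
  have Fc: "continuous_on (J k (\<theta> \<omega>)) (F \<omega> a)" using F_cont[OF \<omega> a] J01' by (rule continuous_on_subset)
  have cl: "closed Sa" "closed Ra" unfolding Sa_def Ra_def
    using Fc J_closed[OF \<omega>'] by (auto intro: continuous_closed_preimage)
  have F_iff: "F \<omega> a x \<in> J k \<omega> \<longleftrightarrow> q k \<omega> \<le> F \<omega> a x" if "x \<in> J k (\<theta> \<omega>)" for x
    using J_F_iff[OF \<omega> a subsetD[OF J01' that], of k] that by simp
  have S: "F \<omega> a x \<in> J k \<omega>" if "x \<in> Sa" for x using that F_iff[of x] by (simp add: Sa_def)
  have R: "F \<omega> a x \<notin> J k \<omega>" if "x \<in> Ra" for x
  proof
    assume *: "F \<omega> a x \<in> J k \<omega>"
    then have "F \<omega> a x = q k \<omega>" using that F_iff[of x] by (simp add: Ra_def)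
    then show False using * q_notin_J[OF \<omega>] by simp
  qed
  let ?f = "\<lambda>x. \<bar>F1 \<omega> a x\<bar> powr t * cut \<omega> g (F \<omega> a x)"
  have SR: "Sa \<union> Ra = J k (\<theta> \<omega>)" by (auto simp: Sa_def Ra_def)
  have "continuous_on Sa ?f"
  proof -
    have sub: "Sa \<subseteq> J k (\<theta> \<omega>)" by (auto simp: Sa_def)
    have "continuous_on Sa (\<lambda>x. g (F \<omega> a x))"
      using continuous_on_compose2[OF g continuous_on_subset[OF Fc sub]] S by auto
    moreover have "continuous_on Sa (\<lambda>x. \<bar>F1 \<omega> a x\<bar> powr t)"
    proof (intro continuous_intros)
      show "continuous_on Sa (F1 \<omega> a)"
        using F1_continuous[OF \<omega> a] by (rule continuous_on_subset) (use sub J01 in blast)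
      show "\<forall>x\<in>Sa. \<bar>F1 \<omega> a x\<bar> \<noteq> 0"
      proof
        fix x assume "x \<in> Sa"
        then have "1 / A \<le> \<bar>F1 \<omega> a x\<bar>" by (intro F1_ge[OF \<omega> a] subsetD[OF J01] subsetD[OF sub])
        moreover have "0 < 1 / A" using A_pos by simp
        ultimately show "\<bar>F1 \<omega> a x\<bar> \<noteq> 0" by linarith
      qed
    qed
    ultimately have "continuous_on Sa (\<lambda>x. \<bar>F1 \<omega> a x\<bar> powr t * g (F \<omega> a x))" by (rule continuous_on_mult[rotated])
    then show ?thesis by (rule continuous_on_eq) (simp add: cut_def S)
  qed
  moreover have "continuous_on Ra ?f"
    by (rule continuous_on_eq[of _ "\<lambda>x. 0"]) (simp_all add: cut_def R)
  ultimately have "continuous_on (Sa \<union> Ra) ?f" by (rule continuous_on_closed_Un[OF cl])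
  then show "continuous_on (J k (\<theta> \<omega>)) ?f" unfolding SR .
qed

text \<open>Preimages in the fibre correspond to branches. Different branches yield different points
  because these lie in the interiors of their intervals, and the exponent changes sign since
  \<open>F1\<close> is the reciprocal of the derivative of T.\<close>

lemma transfer_op_eq:
  assumes \<omega>: "\<omega> \<in> space M" and x: "x \<in> J k (\<theta> \<omega>)"
  shows "transfer_op G \<theta> T t k \<omega> g x = L \<omega> (cut \<omega> g) x"
proof -
  have x01: "x \<in> {0..1}" using J_inner[OF \<theta>_in[OF \<omega>] x] by auto
  let ?S = "{a \<in> G. F \<omega> a x \<in> J k \<omega>}"
  have eq: "{y. y \<in> J k \<omega> \<and> T \<omega> y = x} = (\<lambda>a. F \<omega> a x) ` ?S"
  proof (intro equalityI subsetI)
    fix y assume "y \<in> {y. y \<in> J k \<omega> \<and> T \<omega> y = x}"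
    then have y: "y \<in> J k \<omega>" "T \<omega> y = x" by auto
    then obtain a where a: "a \<in> G" "y \<in> a" using J_iff[of y k \<omega>] by auto
    then have "F \<omega> a x = y" using F_T[OF \<omega> a] y by simp
    then show "y \<in> (\<lambda>a. F \<omega> a x) ` ?S" using a y by (intro image_eqI[of _ _ a]) auto
  next
    fix y assume "y \<in> (\<lambda>a. F \<omega> a x) ` ?S"
    then show "y \<in> {y. y \<in> J k \<omega> \<and> T \<omega> y = x}" using T_F[OF \<omega> _ x01] by auto
  qed
  have inj: "inj_on (\<lambda>a. F \<omega> a x) ?S"
  proof (rule inj_onI)
    fix a b assume ab: "a \<in> ?S" "b \<in> ?S" "F \<omega> a x = F \<omega> b x"
    have abG: "a \<in> G" "b \<in> G" using ab by simp_all
    have "F \<omega> a x \<in> b" using F_mem[OF \<omega> abG(2) x01] ab(3) by simp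
    then have "b = a" by (rule interior_unique[OF abG J_F_interior[OF \<omega> abG(1) x]])
    then show "a = b" by (rule sym)
  qed
  have d: "\<bar>deriv_within (\<Union>G) (T \<omega>) (F \<omega> a x)\<bar> powr (- t) = \<bar>F1 \<omega> a x\<bar> powr t" if "a \<in> G" for a
    using deriv_within_interior[OF that J_F_interior[OF \<omega> that x], of "T \<omega>"]
    by (simp add: F1_def powr_minus_divide powr_divide)
  have "transfer_op G \<theta> T t k \<omega> g x = (\<Sum>a\<in>?S. g (F \<omega> a x) * \<bar>deriv_within (\<Union>G) (T \<omega>) (F \<omega> a x)\<bar> powr (- t))"
    unfolding transfer_op_def eq by (simp add: sum.reindex[OF inj])
  also have "\<dots> = (\<Sum>a\<in>?S. \<bar>F1 \<omega> a x\<bar> powr t * cut \<omega> g (F \<omega> a x))"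
    by (intro sum.cong refl) (simp add: d cut_def)
  also have "\<dots> = L \<omega> (cut \<omega> g) x"
    unfolding L_def by (intro sum.mono_neutral_left) (auto simp: cut_def finite_G)
  finally show ?thesis .
qed

text \<open>The second cut changes nothing: a point off the fibre over \<theta> \<omega> has no
  branch preimage in the fibre over \<omega>.\<close>

lemma Z_cut_L:
  assumes \<omega>: "\<omega> \<in> space M" and x: "x \<in> {0..1}"
  shows "Z n (\<theta> \<omega>) (cut (\<theta> \<omega>) (L \<omega> (cut \<omega> g))) x = Z (Suc n) \<omega> (cut \<omega> g) x"
proof -
  have "cut (\<theta> \<omega>) (L \<omega> (cut \<omega> g)) y = L \<omega> (cut \<omega> g) y" if y: "y \<in> {0..1}" for y
  proof (cases "y \<in> J k (\<theta> \<omega>)")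
    case False
    have "L \<omega> (cut \<omega> g) y = 0" unfolding L_def
    proof (intro sum.neutral ballI)
      fix a assume a: "a \<in> G"
      have "F \<omega> a y \<notin> J k \<omega>" using J_F_iff[OF \<omega> a y, of k] False by simp
      then show "\<bar>F1 \<omega> a y\<bar> powr t * cut \<omega> g (F \<omega> a y) = 0" by (simp add: cut_def)
    qed
    then show ?thesis using False by (simp add: cut_def)
  qed (simp add: cut_def)
  then show ?thesis
    unfolding Z_Suc Z_def[of n] using Fw_mem01[OF \<theta>_in[OF \<omega>] W_D(1) x] by (intro sum.cong refl) auto
qed

lemma Z_L_one:
  assumes "\<omega> \<in> space M" "x \<in> {0..1}"
  shows "Z n (\<theta> \<omega>) (cut (\<theta> \<omega>) (L \<omega> (one \<omega>))) x = N (Suc n) \<omega> x"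
  using Z_cut_L[OF assms, of n "\<lambda>x. 1"] by (simp add: N_def)

lemma zn_Suc_in_J: "\<omega> \<in> space M \<Longrightarrow> zn (Suc n) \<omega> \<in> J k ((\<theta> ^^ n) (\<theta> \<omega>))"
  using zn_in_J[of \<omega> "Suc n"] by (simp add: \<theta>_shift del: funpow.simps)

lemma zn_mem01: "\<omega> \<in> space M \<Longrightarrow> zn n \<omega> \<in> {0..1}"
  using J_inner[OF \<theta>n_in zn_in_J, of \<omega> n] by (simp add: less_imp_le)

text \<open>Forced by the eigenmeasure equation tested on g = 1, whose left side is the integral of
  L 1 over the next fibre.\<close>

definition eigenvalue :: "'w \<Rightarrow> real" where
  "eigenvalue \<omega> = \<Lambda> (\<theta> \<omega>) (L \<omega> (one \<omega>))"

lemma eigenvalue_limit: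
  assumes \<omega>: "\<omega> \<in> space M"
  shows "(\<lambda>n. N (Suc n) \<omega> (zn (Suc n) \<omega>) / N n (\<theta> \<omega>) (zn (Suc n) \<omega>)) \<longlonglongrightarrow> eigenvalue \<omega>"
proof -
  have \<omega>': "\<theta> \<omega> \<in> space M" using \<omega> by simp
  have c: "continuous_on (J k (\<theta> \<omega>)) (L \<omega> (one \<omega>))"
    using L_cut_continuous[OF \<omega>, of "\<lambda>x. 1"] by simp
  note z = zn_Suc_in_J[OF \<omega>] and z01 = zn_mem01[OF \<omega>, of "Suc _"]
  have "(\<lambda>n. R n (\<theta> \<omega>) (L \<omega> (one \<omega>)) (zn (Suc n) \<omega>)) \<longlonglongrightarrow> eigenvalue \<omega>"
    unfolding eigenvalue_def by (rule \<Lambda>_limit[OF \<omega>' c z])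
  then show ?thesis unfolding R_def Z_L_one[OF \<omega> z01] .
qed

text \<open>The n-th sum over \<theta> \<omega> of the operator image of g is the sum of order n + 1
  over \<omega> of g. The two are normalised by different partition sums, whose ratio converges to
  the eigenvalue.\<close>

lemma eigenvalue_equation:
  assumes \<omega>: "\<omega> \<in> space M" and g: "continuous_on (J k \<omega>) g"
  shows "\<Lambda> (\<theta> \<omega>) (L \<omega> (cut \<omega> g)) = eigenvalue \<omega> * \<Lambda> \<omega> g"
proof -
  have \<omega>': "\<theta> \<omega> \<in> space M" using \<omega> by simp
  note z = zn_Suc_in_J[OF \<omega>] and z01 = zn_mem01[OF \<omega>, of "Suc _"]
  have "(\<lambda>n. R n (\<theta> \<omega>) (L \<omega> (cut \<omega> g)) (zn (Suc n) \<omega>)) \<longlonglongrightarrow> \<Lambda> (\<theta> \<omega>) (L \<omega> (cut \<omega> g))"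
    by (rule \<Lambda>_limit[OF \<omega>' L_cut_continuous[OF \<omega> g] z])
  moreover have "(\<lambda>n. R n (\<theta> \<omega>) (L \<omega> (cut \<omega> g)) (zn (Suc n) \<omega>)) \<longlonglongrightarrow> eigenvalue \<omega> * \<Lambda> \<omega> g"
  proof -
    have "R n (\<theta> \<omega>) (L \<omega> (cut \<omega> g)) (zn (Suc n) \<omega>) =
        N (Suc n) \<omega> (zn (Suc n) \<omega>) / N n (\<theta> \<omega>) (zn (Suc n) \<omega>) * R (Suc n) \<omega> g (zn (Suc n) \<omega>)" for n
      using N_pos[OF \<omega> zn_in_J[OF \<omega>, of "Suc n"]] unfolding R_def Z_cut_L[OF \<omega> z01] by simp
    moreover have "(\<lambda>n. R (Suc n) \<omega> g (zn (Suc n) \<omega>)) \<longlonglongrightarrow> \<Lambda> \<omega> g"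
      by (rule LIMSEQ_Suc[OF \<Lambda>_limit[OF \<omega> g zn_in_J[OF \<omega>]]])
    note tendsto_mult[OF eigenvalue_limit[OF \<omega>] this]
    ultimately show ?thesis by (simp only:)
  qed
  ultimately show ?thesis by (rule LIMSEQ_unique)
qed

text \<open>Every fibre point has an admissible \<open>D1\<close>-preimage of weight at least
  A^(-t), and this lower bound for the ratios of partition sums passes to the limit.\<close>

lemma eigenvalue_pos:
  assumes \<omega>: "\<omega> \<in> space M"
  shows "0 < eigenvalue \<omega>"
proof -
  have "(1 / A) powr t \<le> eigenvalue \<omega>"
  proof (rule LIMSEQ_le_const[OF eigenvalue_limit[OF \<omega>]], intro exI allI impI)
    fix n
    let ?z = "zn (Suc n) \<omega>"
    have zJ: "?z \<in> J k ((\<theta> ^^ Suc n) \<omega>)" by (rule zn_in_J[OF \<omega>])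
    have z': "?z \<in> J k ((\<theta> ^^ n) (\<theta> \<omega>))" by (rule zn_Suc_in_J[OF \<omega>])
    have zi: "?z \<in> {0<..<1}" by (rule J_inner[OF \<theta>n_in[OF \<omega>] zJ])
    have "(1 / A) powr t * one (\<theta> \<omega>) y \<le> L \<omega> (one \<omega>) y" if "y \<in> {0<..<1}" for y
    proof (cases "y \<in> J k (\<theta> \<omega>)")
      case True
      have "F \<omega> D1 y \<in> J k \<omega>" using J_F1[OF \<omega> True] that k_pos by auto
      then have "(1 / A) powr t * one (\<theta> \<omega>) y \<le> \<bar>F1 \<omega> D1 y\<bar> powr t * one \<omega> (F \<omega> D1 y)"
        using F1_powr_ge[OF \<omega> \<alpha>\<beta>(7) that] True by simp
      also have "\<dots> \<le> L \<omega> (one \<omega>) y"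
        unfolding L_def by (intro member_le_sum) (use \<alpha>\<beta>(7) finite_G in auto)
      finally show ?thesis .
    next
      case False
      then show ?thesis unfolding L_def by (auto intro: sum_nonneg)
    qed
    then have "(\<Sum>w\<in>W n. \<bar>Dw w (\<theta> \<omega>) ?z\<bar> powr t * ((1 / A) powr t * one (\<theta> \<omega>) (Fw w (\<theta> \<omega>) ?z))) \<le> N (Suc n) \<omega> ?z"
      unfolding N_def Z_Suc Z_def[of n]
      using Fw_inner[OF \<theta>_in[OF \<omega>] W_D(1) zi] by (intro sum_mono mult_left_mono) auto
    moreover have "(\<Sum>w\<in>W n. \<bar>Dw w (\<theta> \<omega>) ?z\<bar> powr t * ((1 / A) powr t * one (\<theta> \<omega>) (Fw w (\<theta> \<omega>) ?z)))
        = (1 / A) powr t * N n (\<theta> \<omega>) ?z"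
      unfolding N_def Z_def by (simp only: sum_distrib_left mult_ac)
    ultimately show "(1 / A) powr t \<le> N (Suc n) \<omega> ?z / N n (\<theta> \<omega>) ?z"
      using N_pos[OF \<theta>_in[OF \<omega>] z'] by (simp add: le_divide_eq)
  qed
  moreover have "0 < (1 / A) powr t" using A_pos by simp
  ultimately show ?thesis by linarith
qed

lemma eigenvalue_measurable: "eigenvalue \<in> borel_measurable M"
proof (rule borel_measurable_LIMSEQ_real[OF eigenvalue_limit])
  fix n
  have "(\<lambda>\<omega>. N n (\<theta> \<omega>) (zn n (\<theta> \<omega>))) \<in> borel_measurable M"
    by (rule measurable_compose[OF \<theta>_measurable N_measurable])
  then have "(\<lambda>\<omega>. N n (\<theta> \<omega>) (zn (Suc n) \<omega>)) \<in> borel_measurable M"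
    by (simp add: \<theta>_shift del: funpow.simps)
  then show "(\<lambda>\<omega>. N (Suc n) \<omega> (zn (Suc n) \<omega>) / N n (\<theta> \<omega>) (zn (Suc n) \<omega>)) \<in> borel_measurable M"
    by (intro borel_measurable_divide N_measurable)
qed

section \<open>Existence of conformal pairs\<close>

text \<open>Chosen for each \<omega> separately. Measurability is still available, because \<Lambda>
  prescribes the integrals of continuous functions.\<close>

definition conformal_measure :: "'w \<Rightarrow> real measure" where
  "conformal_measure \<omega> = (SOME \<nu>. real_distribution \<nu> \<and> measure \<nu> (J k \<omega>) = 1 \<and>
    (\<forall>g. continuous_on (J k \<omega>) g \<longrightarrow> (LINT x : J k \<omega> | \<nu>. g x) = \<Lambda> \<omega> g))"

lemma conformal_measure_props:
  assumes \<omega>: "\<omega> \<in> space M"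
  shows "real_distribution (conformal_measure \<omega>)" "measure (conformal_measure \<omega>) (J k \<omega>) = 1"
    "continuous_on (J k \<omega>) g \<Longrightarrow> (LINT x : J k \<omega> | conformal_measure \<omega>. g x) = \<Lambda> \<omega> g"
proof -
  note * = someI_ex[OF \<Lambda>_representation[OF \<omega>], folded conformal_measure_def]
  show "real_distribution (conformal_measure \<omega>)" by (rule *[THEN conjunct1])
  show "measure (conformal_measure \<omega>) (J k \<omega>) = 1" by (rule *[THEN conjunct2, THEN conjunct1])
  show "continuous_on (J k \<omega>) g \<Longrightarrow> (LINT x : J k \<omega> | conformal_measure \<omega>. g x) = \<Lambda> \<omega> g"
    by (rule *[THEN conjunct2, THEN conjunct2, rule_format])
qed

lemma conformal_measure_integral:
  assumes \<omega>: "\<omega> \<in> space M" and g: "continuous_on UNIV g"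
  shows "(\<integral>x. g x \<partial>conformal_measure \<omega>) = \<Lambda> \<omega> g"
proof -
  interpret \<nu>: real_distribution "conformal_measure \<omega>" by (rule conformal_measure_props[OF \<omega>])
  have [measurable]: "J k \<omega> \<in> sets borel" by (rule borel_closed[OF J_closed[OF \<omega>]])
  have [measurable]: "g \<in> borel_measurable borel" by (rule borel_measurable_continuous_onI[OF g])
  have "AE x in conformal_measure \<omega>. x \<in> J k \<omega>" using conformal_measure_props(2)[OF \<omega>] by (intro \<nu>.AE_prob_1) auto
  then have "AE x in conformal_measure \<omega>. g x = indicat_real (J k \<omega>) x *\<^sub>R g x" by eventually_elim simp
  then have "(\<integral>x. g x \<partial>conformal_measure \<omega>) = (LINT x : J k \<omega> | conformal_measure \<omega>. g x)"
    unfolding set_lebesgue_integral_def by (intro integral_cong_AE) auto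
  also have "\<dots> = \<Lambda> \<omega> g" by (rule conformal_measure_props(3)[OF \<omega> continuous_on_subset[OF g subset_UNIV]])
  finally show ?thesis .
qed

text \<open>Half-lines generate the Borel sets, and the measure of a half-line is a limit of
  integrals of continuous functions, hence of measurable functions
  \<open>\<Lambda> \<omega> (f n)\<close>.\<close>

lemma conformal_measure_measurable: "conformal_measure \<in> measurable M (prob_algebra borel)"
proof (rule measurable_prob_algebra_generated[where G="range atMost" and \<Omega>=UNIV])
  show "sets (borel :: real measure) = sigma_sets UNIV (range atMost)"
    by (subst borel_eq_atMost) simp
  show "Int_stable (range atMost :: real set set)"
    by (auto simp: Int_stable_def)
  show "prob_space (conformal_measure \<omega>)" "sets (conformal_measure \<omega>) = sets borel" if "\<omega> \<in> space M" for \<omega>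
    using conformal_measure_props(1)[OF that] by (auto simp: real_distribution_def real_distribution_axioms_def)
  fix S :: "real set" assume "S \<in> range atMost"
  then obtain s where S: "S = {..s}" by auto
  \<comment> \<open>For n > 0 a continuous ramp that is 1 up to s and 0 from s + 1/n on.\<close>
  define f where "f n x = max 0 (min 1 (1 - real n * (x - s)))" for n x
  have fc: "continuous_on UNIV (f n)" for n unfolding f_def by (intro continuous_intros)
  have lim: "(\<lambda>n. f n x) \<longlonglongrightarrow> indicat_real {..s} x" for x
  proof (cases "x \<le> s")
    case True
    have "f n x = 1" for n
    proof -
      have "real n * (x - s) \<le> 0" using True by (intro mult_nonneg_nonpos) auto
      then show ?thesis by (simp add: f_def)
    qed
    then show ?thesis using True by simp
  next
    case False
    obtain m where m: "1 / (x - s) \<le> real m" using real_arch_simple by blast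
    have "f n x = 0" if "m \<le> n" for n
    proof -
      have "1 / (x - s) \<le> real n" using m that by linarith
      then have "1 \<le> real n * (x - s)" using False by (simp add: divide_le_eq)
      then show ?thesis by (simp add: f_def)
    qed
    then have "\<forall>\<^sub>F n in sequentially. f n x = indicat_real {..s} x"
      using False by (auto simp: eventually_sequentially)
    then show ?thesis by (rule tendsto_eventually)
  qed
  have "(\<lambda>\<omega>. measure (conformal_measure \<omega>) {..s}) \<in> borel_measurable M"
  proof (rule borel_measurable_LIMSEQ_real)
    show "(\<lambda>\<omega>. \<Lambda> \<omega> (f n)) \<in> borel_measurable M" for n by (rule \<Lambda>_measurable[OF fc])
    show "(\<lambda>n. \<Lambda> \<omega> (f n)) \<longlonglongrightarrow> measure (conformal_measure \<omega>) {..s}" if \<omega>: "\<omega> \<in> space M" for \<omega>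
    proof -
      interpret \<nu>: real_distribution "conformal_measure \<omega>" by (rule conformal_measure_props[OF \<omega>])
      have [measurable]: "f n \<in> borel_measurable borel" for n by (rule borel_measurable_continuous_onI[OF fc])
      have "(\<lambda>n. \<integral>x. f n x \<partial>conformal_measure \<omega>) \<longlonglongrightarrow> (\<integral>x. indicat_real {..s} x \<partial>conformal_measure \<omega>)"
        by (rule integral_dominated_convergence[where w="\<lambda>x. 1"]) (use lim in \<open>auto simp: f_def\<close>)
      then show ?thesis using conformal_measure_integral[OF \<omega> fc] by simp
    qed
  qed
  then have "(\<lambda>\<omega>. ennreal (measure (conformal_measure \<omega>) {..s})) \<in> borel_measurable M" by measurable
  then show "(\<lambda>\<omega>. emeasure (conformal_measure \<omega>) S) \<in> borel_measurable M"
  proof (rule measurable_cong[THEN iffD1, rotated])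
    fix \<omega> assume \<omega>: "\<omega> \<in> space M"
    interpret \<nu>: real_distribution "conformal_measure \<omega>" by (rule conformal_measure_props[OF \<omega>])
    show "ennreal (measure (conformal_measure \<omega>) {..s}) = emeasure (conformal_measure \<omega>) S"
      unfolding S by (simp add: \<nu>.emeasure_eq_measure)
  qed
qed auto

lemma conformal_pair_ex: "conformal_pair M G \<theta> T t k conformal_measure eigenvalue"
  unfolding conformal_pair_def
proof (intro conjI ballI AE_I2 allI impI)
  fix \<omega> and g :: "real \<Rightarrow> real" assume \<omega>: "\<omega> \<in> space M" and g: "continuous_on (J k \<omega>) g"
  have \<omega>': "\<theta> \<omega> \<in> space M" using \<omega> by simp
  have "(LINT x : J k (\<theta> \<omega>) | conformal_measure (\<theta> \<omega>). transfer_op G \<theta> T t k \<omega> g x) =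
      (LINT x : J k (\<theta> \<omega>) | conformal_measure (\<theta> \<omega>). L \<omega> (cut \<omega> g) x)"
    unfolding set_lebesgue_integral_def
    by (intro Bochner_Integration.integral_cong refl) (auto simp: indicator_def transfer_op_eq[OF \<omega>])
  also have "\<dots> = \<Lambda> (\<theta> \<omega>) (L \<omega> (cut \<omega> g))" by (rule conformal_measure_props(3)[OF \<omega>' L_cut_continuous[OF \<omega> g]])
  also have "\<dots> = eigenvalue \<omega> * \<Lambda> \<omega> g" by (rule eigenvalue_equation[OF \<omega> g])
  also have "\<Lambda> \<omega> g = (LINT x : J k \<omega> | conformal_measure \<omega>. g x)" by (rule conformal_measure_props(3)[OF \<omega> g, symmetric])
  finally show "(LINT x : J k (\<theta> \<omega>) | conformal_measure (\<theta> \<omega>). transfer_op G \<theta> T t k \<omega> g x) =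
      eigenvalue \<omega> * (LINT x : J k \<omega> | conformal_measure \<omega>. g x)" .
qed (simp_all add: conformal_measure_measurable conformal_measure_props eigenvalue_measurable eigenvalue_pos)

section \<open>Growth rate of an arbitrary conformal pair\<close>

text \<open>The induction passes from \<omega> to \<theta> \<omega>, so the one-step equation is
  assumed along the whole forward orbit; by invariance of the measure it holds there almost
  surely.\<close>

lemma conformal_iterate:
  assumes step: "\<And>i g. continuous_on (J k ((\<theta> ^^ i) \<omega>)) g \<Longrightarrow>
      (LINT x : J k ((\<theta> ^^ Suc i) \<omega>) | \<nu> ((\<theta> ^^ Suc i) \<omega>). transfer_op G \<theta> T t k ((\<theta> ^^ i) \<omega>) g x) =
      lam ((\<theta> ^^ i) \<omega>) * (LINT x : J k ((\<theta> ^^ i) \<omega>) | \<nu> ((\<theta> ^^ i) \<omega>). g x)"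
    and \<omega>: "\<omega> \<in> space M" and g: "continuous_on (J k \<omega>) g"
  shows "(LINT x : J k ((\<theta> ^^ n) \<omega>) | \<nu> ((\<theta> ^^ n) \<omega>). Z n \<omega> (cut \<omega> g) x) =
      (\<Prod>i<n. lam ((\<theta> ^^ i) \<omega>)) * (LINT x : J k \<omega> | \<nu> \<omega>. g x)"
  using assms
proof (induction n arbitrary: \<omega> g)
  case 0
  have "(LINT x : J k \<omega> | \<nu> \<omega>. cut \<omega> g x) = (LINT x : J k \<omega> | \<nu> \<omega>. g x)"
    unfolding set_lebesgue_integral_def
    by (intro Bochner_Integration.integral_cong refl) (auto simp: cut_def indicator_def)
  then show ?case by simp
next
  case (Suc n)
  note step = Suc.prems(1) and \<omega> = Suc.prems(2) and g = Suc.prems(3)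
  have \<omega>': "\<theta> \<omega> \<in> space M" using \<omega> by simp
  have "(LINT x : J k ((\<theta> ^^ Suc n) \<omega>) | \<nu> ((\<theta> ^^ Suc n) \<omega>). Z (Suc n) \<omega> (cut \<omega> g) x) =
      (LINT x : J k ((\<theta> ^^ Suc n) \<omega>) | \<nu> ((\<theta> ^^ Suc n) \<omega>). Z n (\<theta> \<omega>) (cut (\<theta> \<omega>) (L \<omega> (cut \<omega> g))) x)"
    unfolding set_lebesgue_integral_def
  proof (intro Bochner_Integration.integral_cong refl)
    fix x
    show "indicat_real (J k ((\<theta> ^^ Suc n) \<omega>)) x *\<^sub>R Z (Suc n) \<omega> (cut \<omega> g) x =
      indicat_real (J k ((\<theta> ^^ Suc n) \<omega>)) x *\<^sub>R Z n (\<theta> \<omega>) (cut (\<theta> \<omega>) (L \<omega> (cut \<omega> g))) x"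
    proof (cases "x \<in> J k ((\<theta> ^^ Suc n) \<omega>)")
      case True
      then have "x \<in> {0<..<1}" by (rule J_inner[OF \<theta>n_in[OF \<omega>]])
      then have "Z n (\<theta> \<omega>) (cut (\<theta> \<omega>) (L \<omega> (cut \<omega> g))) x = Z (Suc n) \<omega> (cut \<omega> g) x"
        by (intro Z_cut_L[OF \<omega>]) simp
      then show ?thesis by (simp only:)
    qed (simp del: funpow.simps)
  qed
  also have "\<dots> = (\<Prod>i<n. lam ((\<theta> ^^ i) (\<theta> \<omega>))) * (LINT x : J k (\<theta> \<omega>) | \<nu> (\<theta> \<omega>). L \<omega> (cut \<omega> g) x)"
    unfolding \<theta>_shift[symmetric]
    by (rule Suc.IH[OF _ \<omega>' L_cut_continuous[OF \<omega> g]]) (use step[of "Suc _"] in \<open>simp only: \<theta>_shift\<close>)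
  also have "(LINT x : J k (\<theta> \<omega>) | \<nu> (\<theta> \<omega>). L \<omega> (cut \<omega> g) x) =
      (LINT x : J k (\<theta> \<omega>) | \<nu> (\<theta> \<omega>). transfer_op G \<theta> T t k \<omega> g x)"
    unfolding set_lebesgue_integral_def
    by (intro Bochner_Integration.integral_cong refl) (auto simp: indicator_def transfer_op_eq[OF \<omega>])
  also have "\<dots> = lam \<omega> * (LINT x : J k \<omega> | \<nu> \<omega>. g x)" using step[of 0 g] g by simp
  also have "(\<Prod>i<n. lam ((\<theta> ^^ i) (\<theta> \<omega>))) * (lam \<omega> * (LINT x : J k \<omega> | \<nu> \<omega>. g x)) =
      (\<Prod>i<Suc n. lam ((\<theta> ^^ i) \<omega>)) * (LINT x : J k \<omega> | \<nu> \<omega>. g x)"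
    by (simp add: prod.lessThan_Suc_shift \<theta>_shift mult_ac del: funpow.simps(2) prod.lessThan_Suc)
  finally show ?case .
qed

text \<open>An arbitrary conformal pair has the same exponential growth as the partition sums, which makes
  the truncated pressure well defined.\<close>

lemma lam_product_bounds:
  assumes cp: "conformal_pair M G \<theta> T t k \<nu> lam"
  shows "AE \<omega> in M. \<forall>n. \<bar>(\<Sum>i<n. ln (lam ((\<theta> ^^ i) \<omega>))) - ln (N n \<omega> (zn n \<omega>))\<bar> \<le> ln C"
proof -
  note cp' = cp[unfolded conformal_pair_def]
  have \<nu>: "\<nu> \<in> measurable M (prob_algebra borel)" and lam: "\<forall>\<omega>\<in>space M. 0 < lam \<omega>"
    and ae1: "AE \<omega> in M. measure (\<nu> \<omega>) (J k \<omega>) = 1"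
    and ae2: "AE \<omega> in M. \<forall>g. continuous_on (J k \<omega>) g \<longrightarrow>
        (LINT x : J k (\<theta> \<omega>) | \<nu> (\<theta> \<omega>). transfer_op G \<theta> T t k \<omega> g x) = lam \<omega> * (LINT x : J k \<omega> | \<nu> \<omega>. g x)"
    using cp' by - (elim conjE, assumption)+
  show ?thesis
    using AE_space AE_shift[OF ae1] AE_shift[OF ae2]
  proof eventually_elim
    fix \<omega> assume \<omega>: "\<omega> \<in> space M" and m1: "\<forall>i. measure (\<nu> ((\<theta> ^^ i) \<omega>)) (J k ((\<theta> ^^ i) \<omega>)) = 1"
      and m2: "\<forall>i. \<forall>g. continuous_on (J k ((\<theta> ^^ i) \<omega>)) g \<longrightarrow>
        (LINT x : J k (\<theta> ((\<theta> ^^ i) \<omega>)) | \<nu> (\<theta> ((\<theta> ^^ i) \<omega>)). transfer_op G \<theta> T t k ((\<theta> ^^ i) \<omega>) g x) =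
        lam ((\<theta> ^^ i) \<omega>) * (LINT x : J k ((\<theta> ^^ i) \<omega>) | \<nu> ((\<theta> ^^ i) \<omega>). g x)"
    have prob: "prob_space (\<nu> \<omega>)" "sets (\<nu> \<omega>) = sets borel" if "\<omega> \<in> space M" for \<omega>
      using measurable_space[OF \<nu> that] by (simp_all add: space_prob_algebra)
    have Jm: "J k \<omega> \<in> sets (\<nu> \<omega>)" if "\<omega> \<in> space M" for \<omega>
      using prob(2)[OF that] borel_closed[OF J_closed[OF that, of k]] by simp
    have const: "(LINT x : J k ((\<theta> ^^ i) \<omega>) | \<nu> ((\<theta> ^^ i) \<omega>). c0) = c0" for i and c0 :: real
    proof -
      interpret prob_space "\<nu> ((\<theta> ^^ i) \<omega>)" by (rule prob(1)[OF \<theta>n_in[OF \<omega>]])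
      show ?thesis using m1 Jm[OF \<theta>n_in[OF \<omega>], of i] by (simp add: set_lebesgue_integral_def)
    qed
    show "\<forall>n. \<bar>(\<Sum>i<n. ln (lam ((\<theta> ^^ i) \<omega>))) - ln (N n \<omega> (zn n \<omega>))\<bar> \<le> ln C"
    proof
      fix n
      let ?\<omega> = "(\<theta> ^^ n) \<omega>"
      have \<omega>n: "?\<omega> \<in> space M" using \<omega> by simp
      define Pi where "Pi = (\<Prod>i<n. lam ((\<theta> ^^ i) \<omega>))"
      have lp: "0 < lam ((\<theta> ^^ i) \<omega>)" for i using lam \<omega> by simp
      then have Pi0: "0 < Pi" unfolding Pi_def by (intro prod_pos) simp
      have "(LINT x : J k ?\<omega> | \<nu> ?\<omega>. Z n \<omega> (cut \<omega> (\<lambda>x. 1)) x) = Pi * (LINT x : J k \<omega> | \<nu> \<omega>. 1)"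
        unfolding Pi_def by (rule conformal_iterate) (use m2 \<omega> in simp_all)
      then have int: "(LINT x : J k ?\<omega> | \<nu> ?\<omega>. N n \<omega> x) = Pi"
        using const[of 0 1] by (simp add: N_def)
      interpret \<nu>n: prob_space "\<nu> ?\<omega>" by (rule prob(1)[OF \<omega>n])
      define z0 where "z0 = zn n \<omega>"
      have z0: "z0 \<in> J k ?\<omega>" unfolding z0_def by (rule zn_in_J[OF \<omega>])
      have Nz: "0 < N n \<omega> z0" by (rule N_pos[OF \<omega> z0])
      \<comment> \<open>A function that is not integrable would have integral 0, whereas this
        integral is the positive number \<open>Pi\<close>.\<close>
      have intg: "set_integrable (\<nu> ?\<omega>) (J k ?\<omega>) (N n \<omega>)"
        using int Pi0 not_integrable_integral_eq unfolding set_lebesgue_integral_def set_integrable_def by force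
      have intc: "set_integrable (\<nu> ?\<omega>) (J k ?\<omega>) (\<lambda>x. c0)" for c0 :: real
        unfolding set_integrable_def
        by (intro integrable_scaleR_left integrable_real_indicator Jm[OF \<omega>n]) (simp add: \<nu>n.emeasure_eq_measure)
      have "Pi \<le> C * N n \<omega> z0"
      proof -
        have "(LINT x : J k ?\<omega> | \<nu> ?\<omega>. N n \<omega> x) \<le> (LINT x : J k ?\<omega> | \<nu> ?\<omega>. C * N n \<omega> z0)"
          by (rule set_integral_mono[OF intg intc]) (rule N_compare[OF \<omega> _ z0])
        then show ?thesis unfolding int const .
      qed
      moreover have "N n \<omega> z0 / C \<le> Pi"
      proof -
        have "(LINT x : J k ?\<omega> | \<nu> ?\<omega>. N n \<omega> z0 / C) \<le> (LINT x : J k ?\<omega> | \<nu> ?\<omega>. N n \<omega> x)"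
        proof (rule set_integral_mono[OF intc intg])
          fix x assume "x \<in> J k ?\<omega>"
          then have "N n \<omega> z0 \<le> C * N n \<omega> x" by (rule N_compare[OF \<omega> z0])
          then show "N n \<omega> z0 / C \<le> N n \<omega> x" using C_ge_1 by (simp add: divide_le_eq mult.commute)
        qed
        then show ?thesis unfolding int const .
      qed
      ultimately have "ln Pi \<le> ln (C * N n \<omega> z0)" "ln (N n \<omega> z0 / C) \<le> ln Pi"
        using Pi0 Nz C_ge_1 by (simp_all add: ln_le_cancel_iff)
      moreover have "ln (C * N n \<omega> z0) = ln C + ln (N n \<omega> z0)" "ln (N n \<omega> z0 / C) = ln (N n \<omega> z0) - ln C"
        using Nz C_ge_1 by (simp_all add: ln_mult ln_div)
      moreover have "ln Pi = (\<Sum>i<n. ln (lam ((\<theta> ^^ i) \<omega>)))"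
        unfolding Pi_def by (intro ln_prod finite_lessThan) (metis lp less_irrefl)
      ultimately show "\<bar>(\<Sum>i<n. ln (lam ((\<theta> ^^ i) \<omega>))) - ln (N n \<omega> (zn n \<omega>))\<bar> \<le> ln C"
        unfolding z0_def by linarith
    qed
  qed
qed

lemma ln_N_bounded:
  "\<exists>B. \<forall>\<omega>\<in>space M. \<bar>ln (N n \<omega> (zn n \<omega>))\<bar> \<le> B"
proof (intro exI ballI)
  fix \<omega> assume \<omega>: "\<omega> \<in> space M"
  define lo hi where "lo = ((1 / A) ^ n) powr t" and "hi = card (W n) * K"
  have "lo \<le> N n \<omega> (zn n \<omega>)" "N n \<omega> (zn n \<omega>) \<le> hi" "0 < lo"
    using N_ge[OF \<omega> zn_in_J[OF \<omega>]] N_le[OF \<omega> zn_in_J[OF \<omega>]] A_pos by (simp_all add: lo_def hi_def)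
  then have "ln lo \<le> ln (N n \<omega> (zn n \<omega>))" "ln (N n \<omega> (zn n \<omega>)) \<le> ln hi" by (simp_all add: ln_le_cancel_iff)
  then show "\<bar>ln (N n \<omega> (zn n \<omega>))\<bar> \<le> \<bar>ln (((1 / A) ^ n) powr t)\<bar> + \<bar>ln (card (W n) * K)\<bar>"
    unfolding lo_def hi_def by linarith
qed

lemma ln_N_integrable: "integrable M (\<lambda>\<omega>. ln (N n \<omega> (zn n \<omega>)))"
proof -
  interpret prob_space M by (rule prob_space_M)
  obtain B where B: "\<forall>\<omega>\<in>space M. \<bar>ln (N n \<omega> (zn n \<omega>))\<bar> \<le> B" using ln_N_bounded by (rule exE)
  note [measurable] = N_measurable
  show ?thesis by (rule integrable_const_bound[of _ B]) (use B in auto)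
qed

text \<open>By invariance the Birkhoff sum of \<open>ln (lam \<omega>)\<close> integrates to n times
  a single integral. Its integrability is read off from \<open>lam_product_bounds\<close> with n =
  1.\<close>

lemma conformal_pair_integral:
  assumes cp: "conformal_pair M G \<theta> T t k \<nu> lam"
  shows "\<bar>real n * (\<integral>\<omega>. ln (lam \<omega>) \<partial>M) - (\<integral>\<omega>. ln (N n \<omega> (zn n \<omega>)) \<partial>M)\<bar> \<le> ln C"
proof -
  interpret prob_space M by (rule prob_space_M)
  have [measurable]: "lam \<in> borel_measurable M"
    using cp[unfolded conformal_pair_def] by (elim conjE)
  note ae = lam_product_bounds[OF cp]
  obtain B where B: "\<forall>\<omega>\<in>space M. \<bar>ln (N 1 \<omega> (zn 1 \<omega>))\<bar> \<le> B" using ln_N_bounded by (rule exE)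
  have "AE \<omega> in M. norm (ln (lam \<omega>)) \<le> B + ln C"
    using ae AE_space
  proof eventually_elim
    case (elim \<omega>)
    then have "\<bar>ln (lam \<omega>) - ln (N 1 \<omega> (zn 1 \<omega>))\<bar> \<le> ln C" by (auto dest: spec[of _ 1])
    moreover have "\<bar>ln (N 1 \<omega> (zn 1 \<omega>))\<bar> \<le> B" using B elim by blast
    ultimately show ?case unfolding real_norm_def by linarith
  qed
  then have int: "integrable M (\<lambda>\<omega>. ln (lam \<omega>))" by (rule integrable_const_bound) measurable
  have inti: "integrable M (\<lambda>\<omega>. ln (lam ((\<theta> ^^ i) \<omega>)))" for i
  proof (rule integrable_const_bound)
    show "AE \<omega> in M. norm (ln (lam ((\<theta> ^^ i) \<omega>))) \<le> B + ln C"
      using AE_shift[OF \<open>AE \<omega> in M. norm (ln (lam \<omega>)) \<le> B + ln C\<close>] by eventually_elim (rule spec)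
  qed measurable
  define D where "D \<omega> = (\<Sum>i<n. ln (lam ((\<theta> ^^ i) \<omega>))) - ln (N n \<omega> (zn n \<omega>))" for \<omega>
  have "(\<integral>\<omega>. D \<omega> \<partial>M) = (\<Sum>i<n. \<integral>\<omega>. ln (lam ((\<theta> ^^ i) \<omega>)) \<partial>M) - (\<integral>\<omega>. ln (N n \<omega> (zn n \<omega>)) \<partial>M)"
    unfolding D_def using inti ln_N_integrable
    by (simp add: Bochner_Integration.integral_diff Bochner_Integration.integral_sum)
  also have "(\<Sum>i<n. \<integral>\<omega>. ln (lam ((\<theta> ^^ i) \<omega>)) \<partial>M) = real n * (\<integral>\<omega>. ln (lam \<omega>) \<partial>M)"
    using integral_shift[of "\<lambda>\<omega>. ln (lam \<omega>)"] by simp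
  finally have eq: "(\<integral>\<omega>. D \<omega> \<partial>M) = real n * (\<integral>\<omega>. ln (lam \<omega>) \<partial>M) - (\<integral>\<omega>. ln (N n \<omega> (zn n \<omega>)) \<partial>M)" .
  have Dint: "integrable M D" unfolding D_def using inti ln_N_integrable by auto
  have b: "AE \<omega> in M. \<bar>D \<omega>\<bar> \<le> ln C" using ae unfolding D_def by eventually_elim (rule spec)
  have "(\<integral>\<omega>. D \<omega> \<partial>M) \<le> ln C"
    by (rule integral_le_const[OF Dint]) (use b in \<open>eventually_elim; linarith\<close>)
  moreover have "- ln C \<le> (\<integral>\<omega>. D \<omega> \<partial>M)"
    by (rule integral_ge_const[OF Dint]) (use b in \<open>eventually_elim; linarith\<close>)
  ultimately show ?thesis unfolding eq by linarith
qed

text \<open>For two conformal pairs n times the difference of the integrals is bounded by 2 ln C, so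
  the integrals agree and the defining description denotes the value of the constructed
  pair.\<close>

lemma trunc_pressure_approx:
  "\<bar>real n * trunc_pressure M G \<theta> T k t - (\<integral>\<omega>. ln (N n \<omega> (zn n \<omega>)) \<partial>M)\<bar> \<le> ln C"
proof -
  have *: "(\<integral>\<omega>. ln (lam \<omega>) \<partial>M) \<le> (\<integral>\<omega>. ln (lam' \<omega>) \<partial>M)"
    if "conformal_pair M G \<theta> T t k \<nu> lam" "conformal_pair M G \<theta> T t k \<nu>' lam'" for \<nu> \<nu>' lam lam'
  proof (rule real_mult_le_imp_le)
    fix n
    show "real n * (\<integral>\<omega>. ln (lam \<omega>) \<partial>M) \<le> real n * (\<integral>\<omega>. ln (lam' \<omega>) \<partial>M) + 2 * ln C"
      using conformal_pair_integral[OF that(1), of n] conformal_pair_integral[OF that(2), of n] by linarith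
  qed
  have "trunc_pressure M G \<theta> T k t = (\<integral>\<omega>. ln (eigenvalue \<omega>) \<partial>M)"
    unfolding trunc_pressure_def
  proof (rule the_equality)
    show "\<exists>\<nu> lam. conformal_pair M G \<theta> T t k \<nu> lam \<and> (\<integral>\<omega>. ln (eigenvalue \<omega>) \<partial>M) = (\<integral>\<omega>. ln (lam \<omega>) \<partial>M)"
      by (intro exI[of _ conformal_measure] exI[of _ eigenvalue] conjI conformal_pair_ex refl)
    fix p assume "\<exists>\<nu> lam. conformal_pair M G \<theta> T t k \<nu> lam \<and> p = (\<integral>\<omega>. ln (lam \<omega>) \<partial>M)"
    then show "p = (\<integral>\<omega>. ln (eigenvalue \<omega>) \<partial>M)"
      by (elim exE conjE) (simp add: order_antisym[OF *[OF _ conformal_pair_ex] *[OF conformal_pair_ex]])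
  qed
  then show ?thesis using conformal_pair_integral[OF conformal_pair_ex, of n] by simp
qed

end

section \<open>The pressure function\<close>

context random_cf
begin

section \<open>Comparison of partition sums\<close>

text \<open>The partition sum over the reference point with level and exponent as explicit
  arguments, so that different levels and exponents can be compared; the locale
  \<open>truncated_cf\<close> fixes both.\<close>

definition partition_sum :: "nat \<Rightarrow> real \<Rightarrow> nat \<Rightarrow> 'w \<Rightarrow> real" where
  "partition_sum k t n \<omega> = (\<Sum>w | set w \<subseteq> G \<and> length w = n.
     \<bar>Dw w \<omega> (z ((\<theta> ^^ n) \<omega>))\<bar> powr t * indicat_real (J k \<omega>) (Fw w \<omega> (z ((\<theta> ^^ n) \<omega>))))"

abbreviation "TP k t \<equiv> trunc_pressure M G \<theta> T k t"

lemma finite_words: "finite {w. set w \<subseteq> G \<and> length w = n}"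
  using finite_G by (rule finite_lists_length_eq)

lemma truncated: "0 < k \<Longrightarrow> 0 \<le> t \<Longrightarrow> truncated_cf M \<theta> G GC GE \<kappa> A \<gamma> c v T k t"
  by unfold_locales

lemma partition_sum_pos:
  assumes "0 < k" "0 \<le> t" "\<omega> \<in> space M" shows "0 < partition_sum k t n \<omega>"
proof -
  interpret truncated_cf M \<theta> G GC GE \<kappa> A \<gamma> c v T k t using assms(1,2) by (rule truncated)
  show ?thesis using N_pos[OF assms(3) zn_in_J[OF assms(3)], of n]
    unfolding N_def Z_def W_def partition_sum_def .
qed

lemma partition_sum_integrable:
  assumes "0 < k" "0 \<le> t" shows "integrable M (\<lambda>\<omega>. ln (partition_sum k t n \<omega>))"
proof -
  interpret truncated_cf M \<theta> G GC GE \<kappa> A \<gamma> c v T k t using assms by (rule truncated)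
  show ?thesis using ln_N_integrable[of n] unfolding N_def Z_def W_def partition_sum_def .
qed

lemma TP_approx:
  assumes "0 < k" "0 \<le> t"
  shows "\<exists>B. \<forall>n. \<bar>real n * TP k t - (\<integral>\<omega>. ln (partition_sum k t n \<omega>) \<partial>M)\<bar> \<le> B"
proof -
  interpret truncated_cf M \<theta> G GC GE \<kappa> A \<gamma> c v T k t using assms by (rule truncated)
  show ?thesis
    using trunc_pressure_approx unfolding N_def Z_def W_def partition_sum_def by (intro exI allI)
qed

text \<open>The factor \<open>b\<close> is a bounded error in the logarithm and disappears in the
  growth rate; the factor exp(n a) shifts the rate by a.\<close>

lemma TP_mono_of_sums:
  assumes k: "0 < k" "0 \<le> t" "0 < k'" "0 \<le> t'" and b: "0 < b"
    and le: "\<And>n \<omega>. \<omega> \<in> space M \<Longrightarrow> partition_sum k t n \<omega> \<le> b * exp (real n * a) * partition_sum k' t' n \<omega>"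
  shows "TP k t \<le> TP k' t' + a"
proof -
  interpret prob_space M by (rule prob_space_M)
  obtain B where B: "\<forall>n. \<bar>real n * TP k t - (\<integral>\<omega>. ln (partition_sum k t n \<omega>) \<partial>M)\<bar> \<le> B"
    using TP_approx[OF k(1,2)] by (rule exE)
  obtain B' where B': "\<forall>n. \<bar>real n * TP k' t' - (\<integral>\<omega>. ln (partition_sum k' t' n \<omega>) \<partial>M)\<bar> \<le> B'"
    using TP_approx[OF k(3,4)] by (rule exE)
  show ?thesis
  proof (rule real_mult_le_imp_le)
    fix n
    have "(\<integral>\<omega>. ln (partition_sum k t n \<omega>) \<partial>M) \<le> (\<integral>\<omega>. ln b + real n * a + ln (partition_sum k' t' n \<omega>) \<partial>M)"
    proof (rule integral_mono)
      show "integrable M (\<lambda>\<omega>. ln (partition_sum k t n \<omega>))" by (rule partition_sum_integrable[OF k(1,2)])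
      show "integrable M (\<lambda>\<omega>. ln b + real n * a + ln (partition_sum k' t' n \<omega>))"
        using partition_sum_integrable[OF k(3,4)] by simp
      fix \<omega> assume \<omega>: "\<omega> \<in> space M"
      have p: "0 < partition_sum k t n \<omega>" "0 < partition_sum k' t' n \<omega>"
        using partition_sum_pos[OF k(1,2) \<omega>] partition_sum_pos[OF k(3,4) \<omega>] by simp_all
      then have "ln (partition_sum k t n \<omega>) \<le> ln (b * exp (real n * a) * partition_sum k' t' n \<omega>)"
        using le[OF \<omega>, of n] by (simp add: ln_le_cancel_iff b)
      also have "\<dots> = ln b + real n * a + ln (partition_sum k' t' n \<omega>)"
        using b p by (simp add: ln_mult)
      finally show "ln (partition_sum k t n \<omega>) \<le> ln b + real n * a + ln (partition_sum k' t' n \<omega>)" .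
    qed
    also have "\<dots> = ln b + real n * a + (\<integral>\<omega>. ln (partition_sum k' t' n \<omega>) \<partial>M)"
      using partition_sum_integrable[OF k(3,4)] by (simp add: prob_space)
    finally have "(\<integral>\<omega>. ln (partition_sum k t n \<omega>) \<partial>M) \<le> ln b + real n * a + (\<integral>\<omega>. ln (partition_sum k' t' n \<omega>) \<partial>M)" .
    then show "real n * TP k t \<le> real n * (TP k' t' + a) + (ln b + B + B')"
      using B[rule_format, of n] B'[rule_format, of n] by (simp add: distrib_left)
  qed
qed

lemma J_Suc: "\<omega> \<in> space M \<Longrightarrow> x \<in> J k \<omega> \<Longrightarrow> x \<in> J (Suc k) \<omega>"
proof -
  \<comment> \<open>Starts from q 1 \<le> 1 = q 0 and is propagated by the increasing branch on
    \<open>D0\<close>.\<close>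
  have q_dec: "q (Suc k) \<omega> \<le> q k \<omega>" if "\<omega> \<in> space M" for k \<omega>
    using that
  proof (induction k arbitrary: \<omega>)
    case (Suc k)
    have b: "q (Suc k) (\<theta> \<omega>) \<in> {0..1}" "q k (\<theta> \<omega>) \<in> {0..1}" using q_bounds[OF \<theta>_in[OF Suc.prems]] by simp_all
    have "q (Suc k) (\<theta> \<omega>) \<le> q k (\<theta> \<omega>)" by (rule Suc.IH[OF \<theta>_in[OF Suc.prems]])
    then show ?case using F0_mono(1)[OF Suc.prems b] by (simp add: q_Suc)
  qed (use q_bounds in simp)
  assume \<omega>: "\<omega> \<in> space M" and x: "x \<in> J k \<omega>"
  show "x \<in> J (Suc k) \<omega>"
    unfolding trunc_julia_def trunc_domain_def mem_Collect_eq q_def[symmetric]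
  proof
    fix n
    have "random_iter \<theta> T n \<omega> x \<in> \<Union>G \<inter> {q k ((\<theta> ^^ n) \<omega>)..1}"
      using x unfolding trunc_julia_def trunc_domain_def mem_Collect_eq q_def[symmetric] by (rule spec)
    then show "random_iter \<theta> T n \<omega> x \<in> \<Union>G \<inter> {q (Suc k) ((\<theta> ^^ n) \<omega>)..1}"
      using q_dec[OF \<theta>n_in[OF \<omega>], of k n] by simp
  qed
qed

lemma TP_Suc:
  assumes "0 < k" "0 \<le> t" shows "TP k t \<le> TP (Suc k) t"
proof -
  have "TP k t \<le> TP (Suc k) t + 0"
  proof (rule TP_mono_of_sums[OF assms _ assms(2), where b=1])
    fix n \<omega> assume \<omega>: "\<omega> \<in> space M"
    show "partition_sum k t n \<omega> \<le> 1 * exp (real n * 0) * partition_sum (Suc k) t n \<omega>"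
      unfolding partition_sum_def
      using J_Suc[OF \<omega>] by (simp, intro sum_mono mult_left_mono) (auto simp: indicator_def)
  qed simp_all
  then show ?thesis by simp
qed

lemma z_inner: "\<omega> \<in> space M \<Longrightarrow> z ((\<theta> ^^ n) \<omega>) \<in> {0<..<1}"
  using J_inner[OF \<theta>n_in z_in_J[OF \<theta>n_in], of \<omega> 1 n] by simp

text \<open>An inverse branch contracts at most by A in each step, so \<open>\<bar>Dw\<bar>\<close>
  is at least A^(-n), and lowering the exponent from t to s multiplies the weight by at most A^(n (t
  - s)).\<close>

lemma TP_decay:
  assumes "0 < k" "0 \<le> s" "s \<le> t" shows "TP k s \<le> TP k t + (t - s) * ln A"
proof (rule TP_mono_of_sums[where b=1])
  fix n \<omega> assume \<omega>: "\<omega> \<in> space M"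
  show "partition_sum k s n \<omega> \<le> 1 * exp (real n * ((t - s) * ln A)) * partition_sum k t n \<omega>"
    unfolding partition_sum_def sum_distrib_left
  proof (rule sum_mono)
    fix w assume "w \<in> {w. set w \<subseteq> G \<and> length w = n}"
    then have w: "set w \<subseteq> G" "length w = n" by auto
    let ?d = "\<bar>Dw w \<omega> (z ((\<theta> ^^ n) \<omega>))\<bar>"
    have d: "(1 / A) ^ n \<le> ?d" "0 < ?d" using Dw_ge[OF \<omega> w(1) z_inner[OF \<omega>]] Dw_pos[OF \<omega> w(1) z_inner[OF \<omega>]] w by auto
    have "1 = (A ^ n * (1 / A) ^ n) powr (t - s)" using A_pos by (simp add: power_one_over)
    also have "\<dots> \<le> (A ^ n * ?d) powr (t - s)"
      using d assms A_pos by (intro powr_mono2 mult_left_mono) auto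
    also have "\<dots> = exp (real n * ((t - s) * ln A)) * ?d powr (t - s)"
      using A_pos by (simp add: powr_mult) (simp add: powr_def ln_realpow mult_ac)
    finally have "?d powr s * 1 \<le> ?d powr s * (exp (real n * ((t - s) * ln A)) * ?d powr (t - s))"
      by (intro mult_left_mono) auto
    also have "\<dots> = exp (real n * ((t - s) * ln A)) * ?d powr t"
      by (simp add: powr_add[symmetric])
    finally have "?d powr s \<le> exp (real n * ((t - s) * ln A)) * ?d powr t" by simp
    then have "?d powr s * indicat_real (J k \<omega>) (Fw w \<omega> (z ((\<theta> ^^ n) \<omega>))) \<le>
      (exp (real n * ((t - s) * ln A)) * ?d powr t) * indicat_real (J k \<omega>) (Fw w \<omega> (z ((\<theta> ^^ n) \<omega>)))"
      by (intro mult_right_mono) auto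
    then show "?d powr s * indicat_real (J k \<omega>) (Fw w \<omega> (z ((\<theta> ^^ n) \<omega>))) \<le>
      1 * exp (real n * ((t - s) * ln A)) * (?d powr t * indicat_real (J k \<omega>) (Fw w \<omega> (z ((\<theta> ^^ n) \<omega>))))"
      by (simp add: mult_ac)
  qed
qed (use assms in simp_all)

text \<open>By the Koebe estimate the derivatives of inverse branches of all orders are bounded on the
  truncated fibres.\<close>

lemma TP_antimono:
  assumes "0 < k" "0 \<le> s" "s \<le> t" shows "TP k t \<le> TP k s"
proof -
  have "TP k t \<le> TP k s + 0"
  proof (rule TP_mono_of_sums[where b="(1 / (\<tau> k)\<^sup>2) powr (t - s)"])
    show "0 < (1 / (\<tau> k)\<^sup>2) powr (t - s)" using \<tau>_pos[of k] by simp
    fix n \<omega> assume \<omega>: "\<omega> \<in> space M"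
    show "partition_sum k t n \<omega> \<le> (1 / (\<tau> k)\<^sup>2) powr (t - s) * exp (real n * 0) * partition_sum k s n \<omega>"
      unfolding partition_sum_def sum_distrib_left
    proof (rule sum_mono)
      fix w assume "w \<in> {w. set w \<subseteq> G \<and> length w = n}"
      then have w: "set w \<subseteq> G" "length w = n" by auto
      let ?d = "\<bar>Dw w \<omega> (z ((\<theta> ^^ n) \<omega>))\<bar>"
      have "?d \<le> 1 / (\<tau> k)\<^sup>2"
        by (rule Dw_le[OF \<omega> w(1) J_middle[OF \<theta>n_in[OF \<omega>] z_in_J[OF \<theta>n_in[OF \<omega>] assms(1)]]])
      then have "?d powr (t - s) \<le> (1 / (\<tau> k)\<^sup>2) powr (t - s)" using assms by (intro powr_mono2) auto
      then have "?d powr s * ?d powr (t - s) \<le> ?d powr s * (1 / (\<tau> k)\<^sup>2) powr (t - s)" by (intro mult_left_mono) auto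
      then have "?d powr t \<le> (1 / (\<tau> k)\<^sup>2) powr (t - s) * ?d powr s"
        by (simp add: powr_add[symmetric] mult.commute)
      then have "?d powr t * indicat_real (J k \<omega>) (Fw w \<omega> (z ((\<theta> ^^ n) \<omega>))) \<le>
        ((1 / (\<tau> k)\<^sup>2) powr (t - s) * ?d powr s) * indicat_real (J k \<omega>) (Fw w \<omega> (z ((\<theta> ^^ n) \<omega>)))"
        by (intro mult_right_mono) auto
      then show "?d powr t * indicat_real (J k \<omega>) (Fw w \<omega> (z ((\<theta> ^^ n) \<omega>))) \<le>
        (1 / (\<tau> k)\<^sup>2) powr (t - s) * exp (real n * 0) * (?d powr s * indicat_real (J k \<omega>) (Fw w \<omega> (z ((\<theta> ^^ n) \<omega>))))"
        by (simp add: mult_ac)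
    qed
  qed (use assms in simp_all)
  then show ?thesis by simp
qed

section \<open>Positive pressure at exponent zero\<close>

text \<open>Free concatenations of the blocks D0 D1 and D1 D1. Level 2 is the first that allows
  them: q 1 = \<beta> excludes the letter \<open>D0\<close> altogether, while level 2 excludes only
  two of them in a row.\<close>

primrec pair_word :: "bool list \<Rightarrow> real set list" where
  "pair_word [] = []"
| "pair_word (b # bs) = (if b then D0 else D1) # D1 # pair_word bs"

lemma pair_word_props: "set (pair_word bs) \<subseteq> G" "length (pair_word bs) = 2 * length bs"
  using \<alpha>\<beta>(6,7) by (induction bs) auto

lemma inj_pair_word: "inj pair_word"
proof (rule injI)
  fix as bs :: "bool list" assume "pair_word as = pair_word bs"
  then show "as = bs"
  proof (induction as arbitrary: bs)
    case Nil then show ?case by (cases bs) auto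
  next
    case (Cons a as) then show ?case using D01_ne by (cases bs) (auto split: if_splits)
  qed
qed

lemma pair_word_admissible:
  assumes "\<omega> \<in> space M" "x \<in> J 2 ((\<theta> ^^ (2 * length bs)) \<omega>)"
  shows "Fw (pair_word bs) \<omega> x \<in> J 2 \<omega>"
  using assms
proof (induction bs arbitrary: \<omega>)
  case (Cons b bs)
  have \<omega>1: "\<theta> \<omega> \<in> space M" and \<omega>2: "\<theta> (\<theta> \<omega>) \<in> space M" using Cons.prems(1) by simp_all
  let ?y = "Fw (pair_word bs) (\<theta> (\<theta> \<omega>)) x"
  have y: "?y \<in> J 2 (\<theta> (\<theta> \<omega>))"
    by (rule Cons.IH[OF \<omega>2]) (use Cons.prems(2) in \<open>simp add: \<theta>_shift del: funpow.simps\<close>)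
  have y01: "?y \<in> {0..1}" using J_inner[OF \<omega>2 y] by simp
  have u: "F (\<theta> \<omega>) D1 ?y \<in> J 2 (\<theta> \<omega>)" "\<beta> \<le> F (\<theta> \<omega>) D1 ?y" using J_F1[OF \<omega>1 y y01] by simp_all
  have u01: "F (\<theta> \<omega>) D1 ?y \<in> {0..1}" using F_mem01[OF \<omega>1 \<alpha>\<beta>(7) y01] .
  have "F \<omega> D0 (F (\<theta> \<omega>) D1 ?y) \<in> J 2 \<omega>"
  proof -
    have "q 1 (\<theta> \<omega>) \<le> F (\<theta> \<omega>) D1 ?y" using q_le_\<beta>[OF \<omega>1, of 1] u(2) by simp
    then have "q 2 \<omega> \<le> F \<omega> D0 (F (\<theta> \<omega>) D1 ?y)"
      using F0_mono(1)[OF Cons.prems(1) _ u01, of "q 1 (\<theta> \<omega>)"] q_bounds[OF \<omega>1, of 1]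
      by (simp add: numeral_2_eq_2 q_Suc)
    then show ?thesis using J_F_iff[OF Cons.prems(1) \<alpha>\<beta>(6) u01] u(1) by simp
  qed
  moreover have "F \<omega> D1 (F (\<theta> \<omega>) D1 ?y) \<in> J 2 \<omega>" using J_F1(1)[OF Cons.prems(1) u(1) u01] by simp
  ultimately show ?case by simp
qed simp

text \<open>At exponent 0 the partition sum counts admissible words. There are at least 2^m of
  length 2m, so the growth rate is at least (ln 2) / 2.\<close>

lemma TP_two_zero_pos: "0 < TP 2 0"
proof -
  interpret prob_space M by (rule prob_space_M)
  obtain B where B: "\<forall>n. \<bar>real n * TP 2 0 - (\<integral>\<omega>. ln (partition_sum 2 0 n \<omega>) \<partial>M)\<bar> \<le> B"
    using TP_approx[of 2 0] by auto
  have lower: "2 ^ m \<le> partition_sum 2 0 (2 * m) \<omega>" if \<omega>: "\<omega> \<in> space M" for m \<omega>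
  proof -
    let ?z = "z ((\<theta> ^^ (2 * m)) \<omega>)"
    have zi: "?z \<in> {0<..<1}" by (rule z_inner[OF \<omega>])
    let ?B = "{bs :: bool list. set bs \<subseteq> UNIV \<and> length bs = m}"
    have "(2::real) ^ m = (\<Sum>w\<in>pair_word ` ?B. 1)"
      using card_lists_length_eq[of "UNIV :: bool set" m] card_image[OF inj_on_subset[OF inj_pair_word], of ?B]
      by simp
    also have "\<dots> = (\<Sum>w\<in>pair_word ` ?B. \<bar>Dw w \<omega> ?z\<bar> powr 0 * indicat_real (J 2 \<omega>) (Fw w \<omega> ?z))"
    proof (rule sum.cong)
      fix w assume "w \<in> pair_word ` ?B"
      then obtain bs where bs: "w = pair_word bs" "length bs = m" by auto
      have "Fw w \<omega> ?z \<in> J 2 \<omega>" unfolding bs(1)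
        by (rule pair_word_admissible[OF \<omega>]) (simp add: bs z_in_J[OF \<theta>n_in[OF \<omega>]])
      \<comment> \<open>Since \<open>0 powr 0\<close> is 0, a word is counted only if its derivative
        is nonzero.\<close>
      moreover have "0 < \<bar>Dw w \<omega> ?z\<bar>" unfolding bs(1) by (rule Dw_pos[OF \<omega> pair_word_props(1) zi])
      ultimately show "(1::real) = \<bar>Dw w \<omega> ?z\<bar> powr 0 * indicat_real (J 2 \<omega>) (Fw w \<omega> ?z)" by simp
    qed simp
    also have "\<dots> \<le> partition_sum 2 0 (2 * m) \<omega>"
      unfolding partition_sum_def using pair_word_props by (intro sum_mono2 finite_words) auto
    finally show ?thesis .
  qed
  have "ln 2 \<le> 2 * TP 2 0"
  proof (rule real_mult_le_imp_le)
    fix m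
    have "(\<integral>\<omega>. real m * ln 2 \<partial>M) \<le> (\<integral>\<omega>. ln (partition_sum 2 0 (2 * m) \<omega>) \<partial>M)"
    proof (rule integral_mono)
      show "integrable M (\<lambda>\<omega>. ln (partition_sum 2 0 (2 * m) \<omega>))" by (rule partition_sum_integrable) simp_all
      fix \<omega> assume \<omega>: "\<omega> \<in> space M"
      have "ln (2 ^ m) \<le> ln (partition_sum 2 0 (2 * m) \<omega>)"
        using lower[OF \<omega>] partition_sum_pos[of 2 0, OF _ _ \<omega>] by (simp add: ln_le_cancel_iff)
      then show "real m * ln 2 \<le> ln (partition_sum 2 0 (2 * m) \<omega>)" by (simp add: ln_realpow)
    qed simp
    then have "real m * ln 2 \<le> (\<integral>\<omega>. ln (partition_sum 2 0 (2 * m) \<omega>) \<partial>M)" by (simp add: prob_space)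
    then show "real m * ln 2 \<le> real m * (2 * TP 2 0) + B"
      using B[rule_format, of "2 * m"] by (simp add: mult_ac abs_le_iff)
  qed
  then show ?thesis using ln_gt_zero[of "2::real"] by linarith
qed

section \<open>The limiting pressure\<close>

abbreviation "PR t \<equiv> pressure M G \<theta> T t"

text \<open>The truncated domain of level 0 is the single point 1, so the supremum starts at level
  1; the limit over all levels is the same.\<close>

lemma pressure_eq_SUP:
  assumes "0 \<le> t" shows "PR t = (SUP k. ereal (TP (Suc k) t))"
proof -
  have "incseq (\<lambda>k. ereal (TP (Suc k) t))"
    unfolding incseq_Suc_iff using TP_Suc[OF _ assms] by simp
  then have "(\<lambda>k. ereal (TP (Suc k) t)) \<longlonglongrightarrow> (SUP k. ereal (TP (Suc k) t))" by (rule LIMSEQ_SUP)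
  then have "(\<lambda>k. ereal (TP k t)) \<longlonglongrightarrow> (SUP k. ereal (TP (Suc k) t))" by (rule LIMSEQ_imp_Suc)
  then show ?thesis unfolding pressure_def by (rule limI)
qed

lemma pressure_antimono:
  assumes "0 \<le> s" "s \<le> t" shows "PR t \<le> PR s"
proof -
  have "(SUP k. ereal (TP (Suc k) t)) \<le> (SUP k. ereal (TP (Suc k) s))"
    by (rule SUP_mono') (use TP_antimono[OF _ assms] in simp)
  then show ?thesis using assms by (simp add: pressure_eq_SUP)
qed

lemma pressure_decay:
  assumes "0 \<le> s" "s \<le> t" shows "PR s \<le> PR t + ereal ((t - s) * ln A)"
proof -
  have "ereal (TP (Suc k) s) \<le> PR t + ereal ((t - s) * ln A)" for k
  proof -
    have "ereal (TP (Suc k) s) \<le> ereal (TP (Suc k) t) + ereal ((t - s) * ln A)"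
      using TP_decay[OF _ assms, of "Suc k"] by simp
    also have "\<dots> \<le> PR t + ereal ((t - s) * ln A)"
      using assms by (intro add_right_mono) (auto simp: pressure_eq_SUP intro: SUP_upper)
    finally show ?thesis .
  qed
  then have "(SUP k. ereal (TP (Suc k) s)) \<le> PR t + ereal ((t - s) * ln A)" by (rule SUP_least)
  then show ?thesis using assms by (simp add: pressure_eq_SUP)
qed

section \<open>The exponent at zero and the extension beyond b_T\<close>

text \<open>The derivative at 0 lies between \<kappa> and A, which bounds the integral below by ln
  \<kappa> once integrability is known; otherwise the integral would be 0 by convention.
  Measurability comes from the quotients T(h) / h, as T fixes 0.\<close>

lemma chi0_pos: "0 < chi0 M G T"
proof -
  interpret prob_space M by (rule prob_space_M)
  let ?D = "\<lambda>\<omega>. deriv_within D0 (T \<omega>) 0"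
  have bounds: "\<kappa> \<le> ?D \<omega>" "?D \<omega> \<le> A" if \<omega>: "\<omega> \<in> space M" for \<omega>
  proof -
    show "\<kappa> \<le> ?D \<omega>" by (rule T_branch(10)[OF \<omega> \<alpha>\<beta>(6)])
    have "\<bar>?D \<omega>\<bar> \<le> A" by (rule T_branch(6)[OF \<omega> \<alpha>\<beta>(6)]) (use \<alpha>\<beta>(1,4) in simp)
    then show "?D \<omega> \<le> A" by simp
  qed
  have meas: "?D \<in> borel_measurable M"
  proof (rule borel_measurable_LIMSEQ_real)
    define h where "h n = \<beta> / real (Suc n)" for n
    have h: "0 < h n" "h n \<le> \<beta>" for n
      using \<alpha>\<beta>(1) by (simp_all add: h_def divide_le_eq)
    have hG: "h n \<in> \<Union>G" for n using h[of n] \<alpha>\<beta>(4,6) by (intro UnionI[OF \<alpha>\<beta>(6)]) simp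
    show "(\<lambda>\<omega>. T \<omega> (h n) / h n) \<in> borel_measurable M" for n
      by (intro borel_measurable_divide T_measurable[OF hG]) simp
    show "(\<lambda>n. T \<omega> (h n) / h n) \<longlonglongrightarrow> ?D \<omega>" if \<omega>: "\<omega> \<in> space M" for \<omega>
    proof -
      note Tb = T_branch[OF \<omega> \<alpha>\<beta>(6), unfolded \<alpha>\<beta>(4)]
      have "\<forall>x\<in>{0..\<beta>}. T \<omega> differentiable (at x within {0..\<beta>})"
        using spec[OF conjunct1[OF Tb(1)[unfolded Cn_on_def]], of 0] by simp
      then have "T \<omega> differentiable (at 0 within {0..\<beta>})" using \<alpha>\<beta>(1) by simp
      then obtain D where D: "(T \<omega> has_real_derivative D) (at 0 within {0..\<beta>})"
        by (auto simp: real_differentiable_def)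
      have "deriv_within {0..\<beta>} (T \<omega>) 0 = D" by (rule deriv_within_eqI[OF \<alpha>\<beta>(1) _ D]) (use \<alpha>\<beta>(1) in simp)
      then have DD: "?D \<omega> = D" by (simp add: \<alpha>\<beta>(4))
      have "((\<lambda>y. (T \<omega> y - T \<omega> 0) / (y - 0)) \<longlongrightarrow> D) (at 0 within {0..\<beta>})"
        using D unfolding has_field_derivative_iff .
      moreover have "filterlim h (at 0 within {0..\<beta>}) sequentially"
        unfolding filterlim_at
      proof
        show "\<forall>\<^sub>F n in sequentially. h n \<in> {0..\<beta>} \<and> h n \<noteq> 0"
          using h by (intro always_eventually allI) (simp add: less_imp_le less_imp_neq[symmetric])
        show "h \<longlonglongrightarrow> 0" unfolding h_def by (rule LIMSEQ_Suc[OF lim_const_over_n])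
      qed
      ultimately have "(\<lambda>n. (T \<omega> (h n) - T \<omega> 0) / (h n - 0)) \<longlonglongrightarrow> D" by (rule filterlim_compose)
      then show ?thesis using DD Tb(8) by simp
    qed
  qed
  have "integrable M (\<lambda>\<omega>. ln \<bar>?D \<omega>\<bar>)"
  proof (rule integrable_const_bound)
    show "AE \<omega> in M. norm (ln \<bar>?D \<omega>\<bar>) \<le> ln A"
    proof (rule AE_I2)
      fix \<omega> assume "\<omega> \<in> space M"
      then have "1 \<le> ?D \<omega>" "?D \<omega> \<le> A" using bounds[of \<omega>] \<kappa>_gt by simp_all
      then show "norm (ln \<bar>?D \<omega>\<bar>) \<le> ln A" by simp
    qed
    show "(\<lambda>\<omega>. ln \<bar>?D \<omega>\<bar>) \<in> borel_measurable M" using meas by measurable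
  qed
  then have "ln \<kappa> \<le> chi0 M G T" unfolding chi0_def
  proof (rule integral_ge_const)
    show "AE \<omega> in M. ln \<kappa> \<le> ln \<bar>?D \<omega>\<bar>"
    proof (rule AE_I2)
      fix \<omega> assume "\<omega> \<in> space M"
      then have "\<kappa> \<le> ?D \<omega>" using bounds by simp
      then show "ln \<kappa> \<le> ln \<bar>?D \<omega>\<bar>" using \<kappa>_gt by simp
    qed
  qed
  then show ?thesis using ln_gt_zero[OF \<kappa>_gt] by linarith
qed

lemma b_T_extension:
  assumes fin: "b_T M G \<theta> T < \<infinity>"
  shows "\<exists>b_plus::real. ereal b_plus > b_T M G \<theta> T \<and> {0..<b_plus} \<subseteq> AA M G GC \<gamma> \<theta> T"
proof -
  let ?S = "{t. 0 \<le> t \<and> PR t \<ge> 0}"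
  define \<delta> where "\<delta> = chi0 M G T / (1 + real (gamma_plus GC \<gamma>))"
  have \<delta>: "0 < \<delta>" unfolding \<delta>_def using chi0_pos by (simp add: add_pos_nonneg)
  have lnA: "0 < ln A" using A_gt by simp
  \<comment> \<open>P(0) is at least \<open>TP 2 0\<close>, and decay at rate at most ln A keeps the
    pressure nonnegative up to \<open>t0\<close>. Hence the supremum b_T is positive.\<close>
  define t0 where "t0 = TP 2 0 / ln A"
  have t0: "0 < t0" unfolding t0_def using TP_two_zero_pos lnA by simp
  have P0: "ereal (TP 2 0) \<le> PR 0"
    unfolding pressure_eq_SUP[OF order_refl] by (rule SUP_upper2[of 1]) (simp_all add: numeral_2_eq_2)
  have t0S: "t0 \<in> ?S"
  proof -
    have "ereal (TP 2 0) \<le> PR t0 + ereal ((t0 - 0) * ln A)"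
      using P0 pressure_decay[of 0 t0] t0 by (meson less_imp_le order_refl order_trans)
    moreover have "(t0 - 0) * ln A = TP 2 0" using lnA by (simp add: t0_def)
    ultimately have "ereal (TP 2 0) \<le> PR t0 + ereal (TP 2 0)" by simp
    then have "0 \<le> PR t0" by (cases "PR t0") auto
    then show ?thesis using t0 by simp
  qed
  have up: "ereal s \<le> b_T M G \<theta> T" if "s \<in> ?S" for s
    unfolding b_T_def by (rule Sup_upper) (use that in blast)
  obtain b where b: "b_T M G \<theta> T = ereal b"
    using fin up[OF t0S] by (cases "b_T M G \<theta> T") auto
  have b0: "0 < b" using up[OF t0S] t0 b by simp
  have near: "\<exists>s\<in>?S. r < s" if "r < b" for r
  proof -
    have "ereal r < Sup (ereal ` ?S)" using that b unfolding b_T_def by simp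
    then obtain y where "y \<in> ereal ` ?S" "ereal r < y" unfolding less_Sup_iff by blast
    then show ?thesis by auto
  qed
  have below: "0 \<le> PR s" if s: "0 \<le> s" "s < b" for s
  proof -
    obtain u where u: "u \<in> ?S" "s < u" using near[OF s(2)] by blast
    then show ?thesis using pressure_antimono[of s u] s by (auto intro: order_trans)
  qed
  \<comment> \<open>The supremum controls P strictly left of b only, so the decay estimate starts
    from b - e, and then e tends to 0.\<close>
  have above: "- ereal ((s - b) * ln A) \<le> PR s" if "b \<le> s" for s
  proof -
    have "- ereal ((s - b) * ln A + e * ln A) \<le> PR s" if e: "0 < e" "e < b" for e
    proof -
      have "0 \<le> PR (b - e)" using e by (intro below) auto
      also have "PR (b - e) \<le> PR s + ereal ((s - (b - e)) * ln A)"
        using e \<open>b \<le> s\<close> by (intro pressure_decay) auto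
      finally have "0 \<le> PR s + ereal ((s - b) * ln A + e * ln A)" by (simp add: algebra_simps)
      then show ?thesis by (cases "PR s") auto
    qed
    then have *: "- ereal ((s - b) * ln A + e) \<le> PR s" if "0 < e" "e < b * ln A" for e
      using that lnA by (auto dest!: meta_spec[of _ "e / ln A"] simp: divide_less_eq)
    show ?thesis
    proof (cases "PR s")
      case (real r)
      have "- ((s - b) * ln A) - r \<le> 0"
      proof (rule field_le_epsilon)
        fix e :: real assume e: "0 < e"
        have p: "0 < b * ln A" using b0 lnA by simp
        have "0 < min e (b * ln A / 2)" "min e (b * ln A / 2) < b * ln A"
          using e p by (simp_all add: min_less_iff_disj)
        from *[OF this] show "- ((s - b) * ln A) - r \<le> 0 + e" using real by simp
      qed
      then show ?thesis using real by simp
    next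
      case MInf
      then show ?thesis using *[of "b * ln A / 2"] b0 lnA by simp
    qed simp
  qed
  \<comment> \<open>Chosen so that the loss (s - b) ln A stays below \<delta> b / 2 for s < b',
    while the line has already dropped by \<delta> s, which is at least \<delta> b.\<close>
  define b' where "b' = b + \<delta> * b / (2 * ln A)"
  have bb': "b < b'" unfolding b'_def using \<delta> b0 lnA by simp
  have "s \<in> AA M G GC \<gamma> \<theta> T" if s: "0 \<le> s" "s < b'" for s
  proof -
    have "ereal (- \<delta> * s) < PR s"
    proof (cases "s < b")
      case True
      show ?thesis
      \<comment> \<open>At s = 0 the line takes the value 0, so nonnegative pressure would not
        suffice there and P(0) > 0 enters.\<close>
      proof (cases "s = 0")
        case True
        have "ereal 0 < ereal (TP 2 0)" using TP_two_zero_pos by simp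
        then have "ereal 0 < PR 0" using P0 by (rule less_le_trans)
        then show ?thesis using True by simp
      next
        case False
        then have "ereal (- \<delta> * s) < 0" using \<delta> s by simp
        then show ?thesis using below[OF s(1) True] by (rule less_le_trans)
      qed
    next
      case False
      then have bs: "b \<le> s" by simp
      have "(s - b) * ln A < \<delta> * b / (2 * ln A) * ln A" using s(2) lnA unfolding b'_def by (intro mult_strict_right_mono) auto
      also have "\<dots> = \<delta> * b / 2" using lnA by simp
      also have "\<dots> < \<delta> * s" using \<delta> b0 bs mult_left_mono[of b s \<delta>] mult_pos_pos[OF \<delta> b0] by linarith
      finally have "ereal (- \<delta> * s) < - ereal ((s - b) * ln A)" by simp
      then show ?thesis using above[OF bs] by (rule less_le_trans)
    qed
    then show ?thesis using s unfolding AA_def \<delta>_def by simp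
  qed
  then show ?thesis using bb' b by (intro exI[of _ b'] conjI subsetI) auto
qed

end

theorem theorem10p5:
  fixes M :: "'w measure" and \<theta> :: "'w \<Rightarrow> 'w"
    and G GC GE :: "real set set" and \<kappa> A :: real
    and \<gamma> :: "real set \<Rightarrow> nat" and c v :: "real set \<Rightarrow> real"
    and T :: "'w \<Rightarrow> real \<Rightarrow> real"
  assumes "random_critically_finite M \<theta> G GC GE \<kappa> A \<gamma> c v T"
    and "b_T M G \<theta> T < \<infinity>"
  shows "\<exists>b_plus::real. ereal b_plus > b_T M G \<theta> T \<and> {0..<b_plus} \<subseteq> AA M G GC \<gamma> \<theta> T"
  using assms(2) by (rule random_cf.b_T_extension[OF random_cf.intro[OF assms(1)]])

end
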